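(* Let $\theta>0$, let $\sigma:\mathbb{R}\to\mathbb{R}$ be globally Lipschitz continuous with $\sigma\ge0$ on $\mathbb{R}$ and $\sigma(0)=0$, and let $\xi$ be a space-time white noise on $\mathbb{R}_+\times\mathbb{R}$. Let $u_0$ be a nonrandom (nonnegative) Borel measure on $\mathbb{R}$ that satisfies $$\int_{-\infty}^\infty e^{-cx^2}\,u_0(\mathrm{d}x)<\infty\qquad\text{for all }c>0,$$ and let $u$ solve $$\frac{\partial}{\partial t}u_t(x)=\frac{\theta}{2}\frac{\partial^2}{\partial x^2}u_t(x)+\sigma(u_t(x))\,\xi(t,x)\qquad(t>0,\ x\in\mathbb{R}),$$ starting from $u_0$. Then $u_0$ is a finite measure if and only if the system is finite, that is, if and only if $\|u_t\|_{L^1(\mathbb{R})}<\infty$ a.s. for all $t>0$.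
   Context: Space-time white noise $\xi$ is the generalized centered Gaussian random field with $\mathrm{Cov}[\xi(t,x),\xi(s,y)]=\delta_0(s-t)\delta_0(x-y)$ for $s,t\ge0$, $x,y\in\mathbb{R}$. Let $p_r(a)=(2\pi\theta r)^{-1/2}\exp(-a^2/(2\theta r))$ for $r>0$, $a\in\mathbb{R}$, and $(p_t*u_0)(x)=\int_{\mathbb{R}}p_t(x-y)\,u_0(\mathrm{d}y)$. The solution started from the measure $u_0$ is the mild random-field solution (in the sense of Walsh and of Chen–Dalang): the unique (up to modification) jointly measurable random field $\{u_t(x)\}_{t>0,x\in\mathbb{R}}$, adapted to the filtration generated by $\xi$, such that for all $t>0$ and $x\in\mathbb{R}$ one has $\int_0^t\mathrm{d}s\int_{\mathbb{R}}\mathrm{d}y\,[p_{t-s}(x-y)]^2\,\mathrm{E}[\sigma(u_s(y))^2]<\infty$, the map from $(t,x)\in(0,\infty)\times\mathbb{R}$ to the stochastic integral below is continuous in $L^2(\Omega)$, and almost surely $$u_t(x)=(p_t*u_0)(x)+\int_{(0,t)\times\mathbb{R}}p_{t-s}(x-y)\,\sigma(u_s(y))\,\xi(\mathrm{d}s\,\mathrm{d}y),$$ the integral being a Walsh stochastic integral. The version of $u$ that is continuous on $(0,\infty)\times\mathbb{R}$ is used. The system is called finite if $\|u_t\|_{L^1(\mathbb{R})}<\infty$ a.s. for all times $t$. *)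

theory Defs
  imports "HOL-Probability.Probability"
begin

definition spacetime :: "(real \<times> real) measure" where
  "spacetime = restrict_space lborel ({0..} \<times> UNIV)"

definition L2_spacetime :: "(real \<times> real \<Rightarrow> real) set" where
  "L2_spacetime =
    {\<phi> \<in> borel_measurable spacetime. integrable spacetime (\<lambda>z. (\<phi> z)\<^sup>2)}"

text \<open>The law of a centered Gaussian variable may be degenerate, in which case it has no density.\<close>

definition centered_gaussian :: "'a measure \<Rightarrow> ('a \<Rightarrow> real) \<Rightarrow> bool" where
  "centered_gaussian M X \<longleftrightarrow>
    X \<in> borel_measurable M \<and>
    ((AE \<omega> in M. X \<omega> = 0) \<or> (\<exists>s>0. distributed M lborel X (normal_density 0 s)))"

text \<open>
  The noise is a generalized random field: \<open>\<xi> \<phi>\<close> stands for the integral of \<open>\<phi>\<close> against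
  \<open>\<xi>\<close>, for \<open>\<phi>\<close> square integrable on the half plane. Testing the covariance
  \<open>\<delta>\<^sub>0 (s - t) \<delta>\<^sub>0 (x - y)\<close> against \<open>\<phi> \<otimes> \<psi>\<close> gives the integral of \<open>\<phi> \<psi>\<close>.
  A family is jointly Gaussian iff all its finite linear combinations are Gaussian; linearity of
  \<open>\<xi>\<close> up to null sets follows from the covariance.
\<close>

definition white_noise :: "'a measure \<Rightarrow> ((real \<times> real \<Rightarrow> real) \<Rightarrow> 'a \<Rightarrow> real) \<Rightarrow> bool" where
  "white_noise M \<xi> \<longleftrightarrow>
    (\<forall>F a. finite F \<and> F \<subseteq> L2_spacetime \<longrightarrow>
       centered_gaussian M (\<lambda>\<omega>. \<Sum>\<phi>\<in>F. a \<phi> * \<xi> \<phi> \<omega>)) \<and>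
    (\<forall>\<phi>\<in>L2_spacetime. \<forall>\<psi>\<in>L2_spacetime.
       (LINT \<omega>|M. \<xi> \<phi> \<omega> * \<xi> \<psi> \<omega>) = (LINT z|spacetime. \<phi> z * \<psi> z))"

text \<open>The filtration generated by the noise, augmented by the null sets of \<open>M\<close>.\<close>

definition noise_filtration ::
  "'a measure \<Rightarrow> ((real \<times> real \<Rightarrow> real) \<Rightarrow> 'a \<Rightarrow> real) \<Rightarrow> real \<Rightarrow> 'a measure" where
  "noise_filtration M \<xi> t = sigma (space M)
    ({\<xi> \<phi> -` B \<inter> space M | \<phi> B.
        \<phi> \<in> L2_spacetime \<and> (\<forall>s x. s > t \<longrightarrow> \<phi> (s, x) = 0) \<and> B \<in> sets borel}
     \<union> null_sets M)"

text \<open>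
  A list of tuples \<open>(X, a, b, A)\<close> encodes the simple predictable process which is the sum of the
  \<open>X(\<omega>) 1\<^bsub>(a,b]\<^esub>(s) 1\<^bsub>A\<^esub>(y)\<close>.
\<close>

type_synonym 'a simple_process = "(('a \<Rightarrow> real) \<times> real \<times> real \<times> real set) list"

definition simple_predictable ::
  "'a measure \<Rightarrow> ((real \<times> real \<Rightarrow> real) \<Rightarrow> 'a \<Rightarrow> real) \<Rightarrow> 'a simple_process \<Rightarrow> bool" where
  "simple_predictable M \<xi> L \<longleftrightarrow>
    (\<forall>(X, a, b, A) \<in> set L.
       0 \<le> a \<and> a < b \<and>
       A \<in> sets borel \<and> emeasure lborel A < \<infinity> \<and>
       X \<in> borel_measurable (noise_filtration M \<xi> a) \<and>
       (\<exists>C. \<forall>\<omega>\<in>space M. \<bar>X \<omega>\<bar> \<le> C))"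

definition simple_value :: "'a simple_process \<Rightarrow> real \<times> real \<Rightarrow> 'a \<Rightarrow> real" where
  "simple_value L z \<omega> = (\<Sum>(X, a, b, A)\<leftarrow>L. X \<omega> * indicator ({a<..b} \<times> A) z)"

definition simple_integral ::
  "((real \<times> real \<Rightarrow> real) \<Rightarrow> 'a \<Rightarrow> real) \<Rightarrow> 'a simple_process \<Rightarrow> 'a \<Rightarrow> real" where
  "simple_integral \<xi> L \<omega> = (\<Sum>(X, a, b, A)\<leftarrow>L. X \<omega> * \<xi> (indicator ({a<..b} \<times> A)) \<omega>)"

text \<open>
  The Walsh integral is the isometric extension of the integral of simple predictable processes
  to their closure in \<open>L\<^sup>2(ds dy dP)\<close>. It is determined up to null sets, so it is a relation
  between the integrand \<open>H\<close> and the random variable \<open>I\<close>.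
\<close>

definition has_walsh_integral ::
  "'a measure \<Rightarrow> ((real \<times> real \<Rightarrow> real) \<Rightarrow> 'a \<Rightarrow> real) \<Rightarrow>
     (real \<times> real \<Rightarrow> 'a \<Rightarrow> real) \<Rightarrow> ('a \<Rightarrow> real) \<Rightarrow> bool" where
  "has_walsh_integral M \<xi> H I \<longleftrightarrow>
    (\<lambda>(z, \<omega>). H z \<omega>) \<in> borel_measurable (spacetime \<Otimes>\<^sub>M M) \<and>
    I \<in> borel_measurable M \<and>
    (\<exists>L. (\<forall>n. simple_predictable M \<xi> (L n)) \<and>
       (\<lambda>n. nn_integral (spacetime \<Otimes>\<^sub>M M)
              (\<lambda>(z, \<omega>). ennreal ((simple_value (L n) z \<omega> - H z \<omega>)\<^sup>2))) \<longlonglongrightarrow> 0 \<and>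
       (\<lambda>n. \<integral>\<^sup>+\<omega>. ennreal ((simple_integral \<xi> (L n) \<omega> - I \<omega>)\<^sup>2) \<partial>M) \<longlonglongrightarrow> 0)"

definition heat_kernel :: "real \<Rightarrow> real \<Rightarrow> real \<Rightarrow> real" where
  "heat_kernel \<theta> r a = (2 * pi * \<theta> * r) powr (-1/2) * exp (- a\<^sup>2 / (2 * \<theta> * r))"

definition mild_integrand ::
  "real \<Rightarrow> (real \<Rightarrow> real) \<Rightarrow> (real \<Rightarrow> real \<Rightarrow> 'a \<Rightarrow> real) \<Rightarrow> real \<Rightarrow> real \<Rightarrow>
     real \<times> real \<Rightarrow> 'a \<Rightarrow> real" where
  "mild_integrand \<theta> \<sigma> u t x = (\<lambda>(s, y) \<omega>.
    if 0 < s \<and> s < t then heat_kernel \<theta> (t - s) (x - y) * \<sigma> (u s y \<omega>) else 0)"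

text \<open>
  Here \<open>u t x \<omega>\<close> is only relevant for \<open>t > 0\<close>, and \<open>I t x\<close> is the stochastic integral in the mild
  formulation. The last conjunct selects the version that is continuous off a null set.
\<close>

definition mild_solution ::
  "'a measure \<Rightarrow> ((real \<times> real \<Rightarrow> real) \<Rightarrow> 'a \<Rightarrow> real) \<Rightarrow> real \<Rightarrow> (real \<Rightarrow> real) \<Rightarrow>
     real measure \<Rightarrow> (real \<Rightarrow> real \<Rightarrow> 'a \<Rightarrow> real) \<Rightarrow> bool" where
  "mild_solution M \<xi> \<theta> \<sigma> u\<^sub>0 u \<longleftrightarrow>
    (\<lambda>((t, x), \<omega>). u t x \<omega>)
      \<in> borel_measurable (restrict_space borel ({0<..} \<times> UNIV) \<Otimes>\<^sub>M M) \<and>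
    (\<forall>t>0. \<forall>x. u t x \<in> borel_measurable (noise_filtration M \<xi> t)) \<and>
    (\<forall>t>0. \<forall>x.
       (\<integral>\<^sup>+s\<in>{0<..<t}. (\<integral>\<^sup>+y. ennreal ((heat_kernel \<theta> (t - s) (x - y))\<^sup>2) *
          (\<integral>\<^sup>+\<omega>. ennreal ((\<sigma> (u s y \<omega>))\<^sup>2) \<partial>M) \<partial>lborel) \<partial>lborel) < \<infinity>) \<and>
    (\<exists>I.
       (\<forall>t>0. \<forall>x. has_walsh_integral M \<xi> (mild_integrand \<theta> \<sigma> u t x) (I t x)) \<and>
       (\<forall>t>0. \<forall>x.
          ((\<lambda>(s, y). \<integral>\<^sup>+\<omega>. ennreal ((I s y \<omega> - I t x \<omega>)\<^sup>2) \<partial>M) \<longlongrightarrow> 0)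
            (at (t, x) within ({0<..} \<times> UNIV))) \<and>
       (\<forall>t>0. \<forall>x. AE \<omega> in M.
          u t x \<omega> = (LINT y|u\<^sub>0. heat_kernel \<theta> t (x - y)) + I t x \<omega>)) \<and>
    (AE \<omega> in M. continuous_on ({0<..} \<times> UNIV) (\<lambda>(t, x). u t x \<omega>))"

end

(*
  No comparison principle is needed: both directions follow from the first two moments of u_t(x).

  Let J_t(x) = (p_t * u_0)(x). The stochastic integral is centered, so E u_t(x) = J_t(x), and the
  Walsh isometry gives the Volterra inequality f <= A J^2 + B K f for f(s, y) = E[sigma(u_s(y))^2],
  where K is space-time convolution with p^2. As p_r^2 is r^(-1/2) p_(r/2) up to a constant, K J^2
  is at most a constant times t^(1/2) J^2, and on time windows of length tau, K K f is at most a
  constant times tau^(1/2) K f. Since K f is finite by definition of a mild solution, K f can be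
  absorbed on short windows, and E[u_t(x)^2] <= C_t J_t(x)^2.

  If u_0 is finite, then E ||u_t||_1 <= C_t^(1/2) u_0(R). Conversely, if ||u_t||_1 is almost surely
  finite, choose n such that A = {||u_t||_1 > n} has small probability. By the second moment bound,
  E[|u_t(x)| 1_A] <= J_t(x) / 2 for all x, so J_t(x) <= 2 E[|u_t(x)| 1_(A^c)], and integrating over
  x gives u_0(R) <= 2 n.
*)
theory Submission imports Defs begin

section \<open>Square integrable functions\<close>

text \<open>The noise is given only by Gaussian linear combinations and a covariance, so the
  independence behind the isometry has to be produced: characteristic functions decouple the noise
  after time \<open>t\<close> from finitely many earlier noise variables, and a pi-lambda argument
  extends this to the augmented filtration. The stochastic integral is known only as an L2 limit,
  which is enough for its mean and for a bound of its second moment up to a factor.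

  The Volterra inequality cannot be closed by comparing K f with f, since K f has no pointwise bound
  in terms of f. One more convolution turns it into an inequality for K f alone, where K K f is
  again comparable with K f. The resulting absorption h <= a + h / 2 says nothing if h is infinite,
  and its factor is made small by cutting f off before the window; hence the induction over windows,
  whose length depends on \<theta> and the Lipschitz constant but not on the time already covered.

  That J^2 reproduces itself under K reflects that p_s(y - a) p_s(y - b) is a kernel centered at the
  midpoint of a and b times a factor free of y.\<close>

lemma integrable_mult_square:
  fixes f g :: "'b \<Rightarrow> real"
  assumes [measurable]: "f \<in> borel_measurable N" "g \<in> borel_measurable N"
    and "integrable N (\<lambda>\<omega>. (f \<omega>)\<^sup>2)" "integrable N (\<lambda>\<omega>. (g \<omega>)\<^sup>2)"
  shows "integrable N (\<lambda>\<omega>. f \<omega> * g \<omega>)"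
proof (rule Bochner_Integration.integrable_bound)
  show "integrable N (\<lambda>\<omega>. (f \<omega>)\<^sup>2 + (g \<omega>)\<^sup>2)" using assms by simp
  show "AE \<omega> in N. norm (f \<omega> * g \<omega>) \<le> norm ((f \<omega>)\<^sup>2 + (g \<omega>)\<^sup>2)"
  proof (rule AE_I2)
    fix \<omega>
    have "2 * (\<bar>f \<omega>\<bar> * \<bar>g \<omega>\<bar>) \<le> (f \<omega>)\<^sup>2 + (g \<omega>)\<^sup>2"
      using sum_squares_bound[of "\<bar>f \<omega>\<bar>" "\<bar>g \<omega>\<bar>"] by simp
    moreover have "0 \<le> \<bar>f \<omega>\<bar> * \<bar>g \<omega>\<bar>" by simp
    ultimately show "norm (f \<omega> * g \<omega>) \<le> norm ((f \<omega>)\<^sup>2 + (g \<omega>)\<^sup>2)"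
      by (simp only: real_norm_def abs_mult)
  qed
qed simp

lemma L2_mult_integrable:
  "\<phi> \<in> L2_spacetime \<Longrightarrow> \<psi> \<in> L2_spacetime \<Longrightarrow> integrable spacetime (\<lambda>z. \<phi> z * \<psi> z)"
  by (intro integrable_mult_square) (auto simp: L2_spacetime_def)

lemma L2_add:
  assumes "\<phi> \<in> L2_spacetime" "\<psi> \<in> L2_spacetime"
  shows "(\<lambda>z. \<phi> z + \<psi> z) \<in> L2_spacetime"
proof -
  have "(\<lambda>z. (\<phi> z + \<psi> z)\<^sup>2) = (\<lambda>z. (\<phi> z)\<^sup>2 + (\<psi> z)\<^sup>2 + 2 * (\<phi> z * \<psi> z))"
    by (auto simp: power2_sum)
  then show ?thesis
    using assms L2_mult_integrable[OF assms] by (auto simp: L2_spacetime_def)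
qed

lemma halfplane_borel: "{0..} \<times> UNIV \<in> sets (borel :: (real \<times> real) measure)"
  unfolding borel_prod[symmetric] by auto

lemma sigma_finite_spacetime: "sigma_finite_measure spacetime"
  unfolding spacetime_def using halfplane_borel by (intro sigma_finite_measure_restrict_space) (auto intro: sigma_finite_lborel)

section \<open>Test functions before and after a fixed time\<close>

definition past :: "real \<Rightarrow> (real \<times> real \<Rightarrow> real) set" where
  "past t = {\<phi> \<in> L2_spacetime. \<forall>s x. s > t \<longrightarrow> \<phi> (s, x) = 0}"

text \<open>The functions in \<open>past t\<close> are those that generate
  \<open>noise_filtration M \<xi> t\<close>; those in \<open>future t\<close> vanish up to and
  including time \<open>t\<close>, so products across the two families are identically zero. The
  strict inequality on one side and the weak one on the other fit the half-open time intervals of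
  \<open>rect\<close>.\<close>

definition future :: "real \<Rightarrow> (real \<times> real \<Rightarrow> real) set" where
  "future t = {\<phi> \<in> L2_spacetime. \<forall>s x. s \<le> t \<longrightarrow> \<phi> (s, x) = 0}"

lemma future_L2: "\<psi> \<in> future t \<Longrightarrow> \<psi> \<in> L2_spacetime"
  by (simp add: future_def)

lemma future_add: "\<phi> \<in> future t \<Longrightarrow> \<psi> \<in> future t \<Longrightarrow> (\<lambda>z. \<phi> z + \<psi> z) \<in> future t"
  unfolding future_def using L2_add by auto

abbreviation rect :: "real \<Rightarrow> real \<Rightarrow> real set \<Rightarrow> real \<times> real \<Rightarrow> real" where
  "rect a b A \<equiv> indicator ({a<..b} \<times> A)"

lemma sets_spacetime_rect: "A \<in> sets borel \<Longrightarrow> rect a b A \<in> borel_measurable spacetime"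
  unfolding spacetime_def by (intro measurable_restrict_space1) (simp add: borel_prod[symmetric])

lemma rect_L2:
  assumes [measurable]: "A \<in> sets borel" and fin: "emeasure lborel A < \<infinity>"
  shows "rect a b A \<in> L2_spacetime"
proof -
  have "emeasure (lborel :: (real \<times> real) measure) ({a<..b} \<times> A) = emeasure lborel {a<..b} * emeasure lborel A"
    unfolding lborel_prod[symmetric] by (rule lborel.emeasure_pair_measure_Times) auto
  also have "\<dots> < \<infinity>" using fin by (cases "a \<le> b") (auto simp: ennreal_mult_less_top)
  finally have f: "emeasure (lborel :: (real \<times> real) measure) ({a<..b} \<times> A) < \<infinity>" .
  have m: "{a<..b} \<times> A \<in> sets (borel :: (real \<times> real) measure)"
    unfolding borel_prod[symmetric] by auto
  have h: "{0..} \<times> UNIV \<in> sets (borel :: (real \<times> real) measure)"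
    unfolding borel_prod[symmetric] by auto
  have "integrable lborel (rect a b A)"
    using m f by (intro integrable_real_indicator) auto
  then have "integrable lborel (\<lambda>z. indicat_real ({0..} \<times> UNIV) z *\<^sub>R rect a b A z)"
    using h by (intro integrable_mult_indicator) auto
  then have "integrable spacetime (rect a b A)"
    unfolding spacetime_def using h by (subst integrable_restrict_space) auto
  moreover have "(rect a b A z)\<^sup>2 = rect a b A z" for z
    by (simp add: indicator_def)
  ultimately show ?thesis
    unfolding L2_spacetime_def using sets_spacetime_rect[OF assms(1)] by auto
qed

lemma rect_future: "A \<in> sets borel \<Longrightarrow> emeasure lborel A < \<infinity> \<Longrightarrow> t \<le> a \<Longrightarrow> rect a b A \<in> future t"
  unfolding future_def using rect_L2 by auto

lemma rect_past: "A \<in> sets borel \<Longrightarrow> emeasure lborel A < \<infinity> \<Longrightarrow> b \<le> t \<Longrightarrow> rect a b A \<in> past t"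
  unfolding past_def using rect_L2 by auto

lemma integral_double_sum:
  fixes f :: "nat \<Rightarrow> nat \<Rightarrow> 'b \<Rightarrow> real"
  assumes i: "\<And>i j. i < n \<Longrightarrow> j < n \<Longrightarrow> integrable N (f i j)"
  shows "(LINT x|N. (\<Sum>i<n. \<Sum>j<n. f i j x)) = (\<Sum>i<n. \<Sum>j<n. LINT x|N. f i j x)"
proof -
  have "(LINT x|N. (\<Sum>i<n. \<Sum>j<n. f i j x)) = (\<Sum>i<n. LINT x|N. (\<Sum>j<n. f i j x))"
    by (rule Bochner_Integration.integral_sum) (auto intro!: Bochner_Integration.integrable_sum i)
  also have "\<dots> = (\<Sum>i<n. \<Sum>j<n. LINT x|N. f i j x)"
    by (intro sum.cong refl Bochner_Integration.integral_sum) (auto intro!: i)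
  finally show ?thesis .
qed

text \<open>The integrands of the two sides differ by the square of \<open>2 * f x - g x\<close>. In
  \<open>ennreal\<close> the inequality also covers infinite integrals, so it can be applied before
  integrability is known.\<close>

lemma nn_integral_square_triangle:
  fixes f g :: "'b \<Rightarrow> real"
  assumes [measurable]: "f \<in> borel_measurable N" "g \<in> borel_measurable N"
  shows "(\<integral>\<^sup>+x. ennreal ((g x)\<^sup>2) \<partial>N) \<le> 2 * (\<integral>\<^sup>+x. ennreal ((f x)\<^sup>2) \<partial>N) + 2 * (\<integral>\<^sup>+x. ennreal ((f x - g x)\<^sup>2) \<partial>N)"
proof -
  have "(\<integral>\<^sup>+x. ennreal ((g x)\<^sup>2) \<partial>N) \<le> (\<integral>\<^sup>+x. 2 * ennreal ((f x)\<^sup>2) + 2 * ennreal ((f x - g x)\<^sup>2) \<partial>N)"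
  proof (rule nn_integral_mono)
    fix x
    have "(g x)\<^sup>2 \<le> 2 * (f x)\<^sup>2 + 2 * (f x - g x)\<^sup>2"
      using zero_le_power2[of "2 * f x - g x"] by (simp add: power2_eq_square algebra_simps)
    then have "ennreal ((g x)\<^sup>2) \<le> ennreal (2 * (f x)\<^sup>2 + 2 * (f x - g x)\<^sup>2)"
      by (rule ennreal_leI)
    also have "\<dots> = 2 * ennreal ((f x)\<^sup>2) + 2 * ennreal ((f x - g x)\<^sup>2)"
      by (simp add: ennreal_plus ennreal_mult)
    finally show "ennreal ((g x)\<^sup>2) \<le> 2 * ennreal ((f x)\<^sup>2) + 2 * ennreal ((f x - g x)\<^sup>2)" .
  qed
  then show ?thesis by (simp add: nn_integral_add nn_integral_cmult)
qed

section \<open>Gaussian families and independence\<close>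

context prob_space
begin

lemma integrable_trig:
  fixes Y Z :: "'a \<Rightarrow> real"
  assumes [measurable]: "Y \<in> borel_measurable M" "Z \<in> borel_measurable M"
  shows "integrable M (\<lambda>\<omega>. cos (Y \<omega>) * cos (Z \<omega>))" "integrable M (\<lambda>\<omega>. cos (Y \<omega>) * sin (Z \<omega>))"
    "integrable M (\<lambda>\<omega>. sin (Y \<omega>) * cos (Z \<omega>))" "integrable M (\<lambda>\<omega>. sin (Y \<omega>) * sin (Z \<omega>))"
    "integrable M (\<lambda>\<omega>. cos (Y \<omega>))" "integrable M (\<lambda>\<omega>. sin (Y \<omega>))"
proof -
  have bounded: "integrable M h" if "h \<in> borel_measurable M" "\<And>\<omega>. \<bar>h \<omega>\<bar> \<le> 1" for h :: "'a \<Rightarrow> real"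
    by (rule integrable_const_bound[of _ 1]) (use that in auto)
  show "integrable M (\<lambda>\<omega>. cos (Y \<omega>) * cos (Z \<omega>))"
    by (rule bounded) (simp_all add: abs_mult mult_le_one)
  show "integrable M (\<lambda>\<omega>. cos (Y \<omega>) * sin (Z \<omega>))"
    by (rule bounded) (simp_all add: abs_mult mult_le_one)
  show "integrable M (\<lambda>\<omega>. sin (Y \<omega>) * cos (Z \<omega>))"
    by (rule bounded) (simp_all add: abs_mult mult_le_one)
  show "integrable M (\<lambda>\<omega>. sin (Y \<omega>) * sin (Z \<omega>))"
    by (rule bounded) (simp_all add: abs_mult mult_le_one)
  show "integrable M (\<lambda>\<omega>. cos (Y \<omega>))"
    by (rule bounded) (simp_all add: abs_mult mult_le_one)
  show "integrable M (\<lambda>\<omega>. sin (Y \<omega>))"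
    by (rule bounded) (simp_all add: abs_mult mult_le_one)
qed

lemma integrable_bounded_mult:
  assumes [measurable]: "X \<in> borel_measurable M" and X: "\<And>\<omega>. \<omega> \<in> space M \<Longrightarrow> \<bar>X \<omega>\<bar> \<le> C" and Y: "integrable M Y"
  shows "integrable M (\<lambda>\<omega>. X \<omega> * Y \<omega> :: real)"
proof (rule Bochner_Integration.integrable_bound)
  show "integrable M (\<lambda>\<omega>. C * \<bar>Y \<omega>\<bar>)" using Y by simp
  show "(\<lambda>\<omega>. X \<omega> * Y \<omega>) \<in> borel_measurable M" using Y by simp
  show "AE \<omega> in M. norm (X \<omega> * Y \<omega>) \<le> norm (C * \<bar>Y \<omega>\<bar>)"
  proof (rule AE_I2)
    fix \<omega> assume "\<omega> \<in> space M"
    then have "\<bar>X \<omega>\<bar> \<le> \<bar>C\<bar>" using X by force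
    then show "norm (X \<omega> * Y \<omega>) \<le> norm (C * \<bar>Y \<omega>\<bar>)"
      by (simp add: abs_mult mult_right_mono)
  qed
qed

lemma integrable_of_square:
  assumes [measurable]: "Y \<in> borel_measurable M" and "integrable M (\<lambda>\<omega>. (Y \<omega> :: real)\<^sup>2)"
  shows "integrable M Y"
  using integrable_mult_square[where N=M and f=Y and g="\<lambda>_. 1"] assms by simp

lemma expectation_square_le:
  assumes [measurable]: "Y \<in> borel_measurable M" and "integrable M (\<lambda>\<omega>. (Y \<omega> :: real)\<^sup>2)"
  shows "(expectation Y)\<^sup>2 \<le> expectation (\<lambda>\<omega>. (Y \<omega>)\<^sup>2)"
  using variance_eq[OF integrable_of_square[OF assms] assms(2)] variance_positive[of Y] by simp

lemma integrable_square_iff: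
  assumes [measurable]: "Y \<in> borel_measurable M"
  shows "integrable M (\<lambda>\<omega>. (Y \<omega> :: real)\<^sup>2) \<longleftrightarrow> (\<integral>\<^sup>+\<omega>. ennreal ((Y \<omega>)\<^sup>2) \<partial>M) < \<infinity>"
  by (simp add: integrable_iff_bounded)

text \<open>The tail events decrease to the event that \<open>X\<close> is infinite, which is null,
  and probability is continuous from above.\<close>

lemma small_probability_tail:
  assumes [measurable]: "X \<in> borel_measurable M" and X: "AE \<omega> in M. X \<omega> < (\<infinity>::ennreal)" and e: "e > 0"
  shows "\<exists>n::nat. prob {\<omega> \<in> space M. X \<omega> > of_nat n} < e"
proof -
  let ?A = "\<lambda>n::nat. {\<omega> \<in> space M. X \<omega> > of_nat n}"
  have "(\<lambda>n. prob (?A n)) \<longlonglongrightarrow> prob (\<Inter>n. ?A n)"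
  proof (rule finite_Lim_measure_decseq)
    show "decseq ?A"
    proof (rule decseq_SucI, clarify)
      fix n \<omega> assume "of_nat (Suc n) < X \<omega>"
      moreover have "(of_nat n :: ennreal) \<le> of_nat (Suc n)" by (simp del: of_nat_Suc)
      ultimately show "of_nat n < X \<omega>" by (rule le_less_trans[rotated])
    qed
  qed auto
  moreover have "prob (\<Inter>n. ?A n) = 0"
  proof -
    have "AE \<omega> in M. \<omega> \<notin> (\<Inter>n. ?A n)"
      using X
    proof eventually_elim
      case (elim \<omega>)
      then obtain n :: nat where "X \<omega> < of_nat n" by (metis ennreal_Ex_less_of_nat infinity_ennreal_def)
      then show ?case by (auto intro!: exI[of _ n] simp: less_le_not_le)
    qed
    moreover have "(\<Inter>n. ?A n) \<in> sets M" by measurable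
    ultimately have "(\<Inter>n. ?A n) \<in> null_sets M"
      by (simp add: AE_iff_null_sets)
    then show ?thesis by (simp add: measure_eq_0_null_sets)
  qed
  ultimately have "(\<lambda>n. prob (?A n)) \<longlonglongrightarrow> 0" by simp
  then have "eventually (\<lambda>n. prob (?A n) < e) sequentially"
    using e by (rule order_tendstoD)
  then show ?thesis by (auto simp: eventually_sequentially)
qed

text \<open>A nondegenerate law is rescaled to the standard normal, whose moments and characteristic
  function are available; the degenerate law has no density and stays a separate case.\<close>

lemma centered_gaussian_std:
  assumes "centered_gaussian M X"
  obtains s Z where "distributed M lborel Z std_normal_density" "AE \<omega> in M. X \<omega> = s * Z \<omega>" 
  | "AE \<omega> in M. X \<omega> = 0"
proof -
  from assms consider "AE \<omega> in M. X \<omega> = 0" 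
    | s where "s > 0" "distributed M lborel X (normal_density 0 s)"
    unfolding centered_gaussian_def by auto
  then show ?thesis
  proof cases
    case 2
    then have "distributed M lborel (\<lambda>x. (X x - 0) / s) std_normal_density"
      by (subst (asm) normal_standard_normal_convert) auto
    with 2 show ?thesis
      by (intro that(1)[of "\<lambda>x. (X x - 0) / s" s]) auto
  qed (use that(2) in blast)
qed

lemma std_normal_moments:
  assumes Z: "distributed M lborel Z std_normal_density"
  shows "integrable M Z" "integrable M (\<lambda>\<omega>. (Z \<omega>)\<^sup>2)" "expectation Z = 0" 
    "expectation (\<lambda>\<omega>. (Z \<omega>)\<^sup>2) = 1"
proof -
  have [measurable]: "Z \<in> borel_measurable M"
    using Z by (auto simp: distributed_def)
  show "integrable M Z"
    using integrable_std_normal_moment[of 1] distributed_integrable[OF Z, of "\<lambda>x. x"] by simp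
  show "integrable M (\<lambda>\<omega>. (Z \<omega>)\<^sup>2)"
    using integrable_std_normal_moment[of 2] distributed_integrable[OF Z, of "\<lambda>x. x^2"] by simp
  show e: "expectation Z = 0"
    using standard_normal_distributed_expectation[OF Z] .
  show "expectation (\<lambda>\<omega>. (Z \<omega>)\<^sup>2) = 1"
    using standard_normal_distributed_variance[OF Z] e by simp
qed

text \<open>Real and imaginary part of the characteristic function of the standard normal
  law.\<close>

lemma std_normal_trig:
  assumes Z: "distributed M lborel Z std_normal_density"
  shows "expectation (\<lambda>\<omega>. cos (t * Z \<omega>)) = exp (- t\<^sup>2 / 2)" "expectation (\<lambda>\<omega>. sin (t * Z \<omega>)) = 0"
proof -
  have [measurable]: "Z \<in> borel_measurable M"
    using Z by (auto simp: distributed_def)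
  have "(LINT x|std_normal_distribution. iexp (t * x)) = exp (- t\<^sup>2 / 2)"
    using char_std_normal_distribution by (simp add: char_def fun_eq_iff)
  moreover have "std_normal_distribution = distr M lborel Z"
    using distributed_distr_eq_density[OF Z] by simp
  ultimately have c: "(LINT x|M. iexp (t * Z x)) = complex_of_real (exp (- t\<^sup>2 / 2))"
    by (simp add: integral_distr)
  have i: "integrable M (\<lambda>x. iexp (t * Z x))"
    by (rule integrable_const_bound[of _ 1]) auto
  from c[THEN arg_cong[where f=Re]] c[THEN arg_cong[where f=Im]]
  show "expectation (\<lambda>\<omega>. cos (t * Z \<omega>)) = exp (- t\<^sup>2 / 2)" "expectation (\<lambda>\<omega>. sin (t * Z \<omega>)) = 0"
    unfolding integral_Re[OF i, symmetric] integral_Im[OF i, symmetric] 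
    by (simp_all only: Re_exp Im_exp Re_complex_of_real Im_complex_of_real) simp_all
qed

text \<open>No frequency appears, since it can be put into \<open>X\<close>: multiples of centered
  Gaussians are again of this kind. Expressing the cosine mean through the second moment makes the
  formula valid for the degenerate law as well.\<close>

lemma centered_gaussian_moments:
  assumes X: "centered_gaussian M X"
  shows "integrable M X" "integrable M (\<lambda>\<omega>. (X \<omega>)\<^sup>2)" "expectation X = 0"
    "expectation (\<lambda>\<omega>. cos (X \<omega>)) = exp (- expectation (\<lambda>\<omega>. (X \<omega>)\<^sup>2) / 2)"
    "expectation (\<lambda>\<omega>. sin (X \<omega>)) = 0"
proof -
  have [measurable]: "X \<in> borel_measurable M"
    using X by (auto simp: centered_gaussian_def)
  have "integrable M X \<and> integrable M (\<lambda>\<omega>. (X \<omega>)\<^sup>2) \<and> expectation X = 0 \<and>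
    expectation (\<lambda>\<omega>. cos (X \<omega>)) = exp (- expectation (\<lambda>\<omega>. (X \<omega>)\<^sup>2) / 2) \<and>
    expectation (\<lambda>\<omega>. sin (X \<omega>)) = 0"
    using X
  proof (cases rule: centered_gaussian_std)
    case (1 s Z)
    then have [measurable]: "Z \<in> borel_measurable M"
      by (auto simp: distributed_def)
    note c = integral_cong_AE[of _ M] integrable_cong_AE[of _ M]
    have "integrable M X \<longleftrightarrow> integrable M (\<lambda>\<omega>. s * Z \<omega>)"
      using 1(2) by (intro c) auto
    moreover have "integrable M (\<lambda>\<omega>. (X \<omega>)\<^sup>2) \<longleftrightarrow> integrable M (\<lambda>\<omega>. (s * Z \<omega>)\<^sup>2)"
      using 1(2) by (intro c) auto
    moreover have "expectation X = expectation (\<lambda>\<omega>. s * Z \<omega>)"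
      using 1(2) by (intro c) auto
    moreover have "expectation (\<lambda>\<omega>. (X \<omega>)\<^sup>2) = expectation (\<lambda>\<omega>. (s * Z \<omega>)\<^sup>2)"
      using 1(2) by (intro c) auto
    moreover have "expectation (\<lambda>\<omega>. cos (X \<omega>)) = expectation (\<lambda>\<omega>. cos (s * Z \<omega>))"
      using 1(2) by (intro c) auto
    moreover have "expectation (\<lambda>\<omega>. sin (X \<omega>)) = expectation (\<lambda>\<omega>. sin (s * Z \<omega>))"
      using 1(2) by (intro c) auto
    ultimately show ?thesis
      using std_normal_moments[OF 1(1)] std_normal_trig[OF 1(1)] by (simp add: power_mult_distrib)
  next
    case 2
    note c = integral_cong_AE[of _ M] integrable_cong_AE[of _ M]
    have "integrable M X \<longleftrightarrow> integrable M (\<lambda>\<omega>. 0::real)"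
      using 2 by (intro c) auto
    moreover have "integrable M (\<lambda>\<omega>. (X \<omega>)\<^sup>2) \<longleftrightarrow> integrable M (\<lambda>\<omega>. 0::real)"
      using 2 by (intro c) auto
    moreover have "expectation X = expectation (\<lambda>\<omega>. 0)"
      using 2 by (intro c) auto
    moreover have "expectation (\<lambda>\<omega>. (X \<omega>)\<^sup>2) = expectation (\<lambda>\<omega>. 0)"
      using 2 by (intro c) auto
    moreover have "expectation (\<lambda>\<omega>. cos (X \<omega>)) = expectation (\<lambda>\<omega>. 1)"
      using 2 by (intro c) auto
    moreover have "expectation (\<lambda>\<omega>. sin (X \<omega>)) = expectation (\<lambda>\<omega>. 0)"
      using 2 by (intro c) auto
    ultimately show ?thesis
      by (simp add: prob_space)
  qed
  then show "integrable M X" "integrable M (\<lambda>\<omega>. (X \<omega>)\<^sup>2)" "expectation X = 0"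
    "expectation (\<lambda>\<omega>. cos (X \<omega>)) = exp (- expectation (\<lambda>\<omega>. (X \<omega>)\<^sup>2) / 2)"
    "expectation (\<lambda>\<omega>. sin (X \<omega>)) = 0"
    by auto
qed

text \<open>
  After scaling \<open>W\<close> to \<open>\<bar>W\<bar> \<le> 1\<close>, the laws of \<open>Y\<close> under \<open>M\<close> and under the density \<open>1 + W\<close>
  are probability measures with equal characteristic functions.
\<close>

lemma weighted_trig_unique:
  assumes [measurable]: "W \<in> borel_measurable M" "Y \<in> borel_measurable M"
    and bound: "\<And>\<omega>. \<omega> \<in> space M \<Longrightarrow> \<bar>W \<omega>\<bar> \<le> C"
    and c: "\<And>t. expectation (\<lambda>\<omega>. W \<omega> * cos (t * Y \<omega>)) = 0"
    and s: "\<And>t. expectation (\<lambda>\<omega>. W \<omega> * sin (t * Y \<omega>)) = 0"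
    and B[measurable]: "B \<in> sets borel"
  shows "expectation (\<lambda>\<omega>. W \<omega> * indicator B (Y \<omega>)) = (0::real)"
proof -
  \<comment> \<open>The maximum with 1 makes division by \<open>D\<close> legitimate for any
    \<open>C\<close> and leaves \<open>\<bar>W \<omega> / D\<bar> \<le> 1\<close>, so that
    \<open>V\<close> is a nonnegative density.\<close>
  define D where "D = max C 1"
  have D: "D > 0" "\<And>\<omega>. \<omega> \<in> space M \<Longrightarrow> \<bar>W \<omega>\<bar> \<le> D"
    using bound unfolding D_def by (fastforce)+
  define V where "V = (\<lambda>\<omega>. 1 + W \<omega> / D)"
  have [measurable]: "V \<in> borel_measurable M" unfolding V_def by simp
  have V0: "V \<omega> \<ge> 0" and V2: "V \<omega> \<le> 2" if "\<omega> \<in> space M" for \<omega>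
    using D(2)[OF that] D(1) unfolding V_def by (auto simp: field_simps abs_le_iff)
  then have V: "AE \<omega> in M. 0 \<le> V \<omega>" by auto
  have Wint: "integrable M (\<lambda>\<omega>. W \<omega> * g \<omega>)" if [measurable]: "g \<in> borel_measurable M"
      and "\<And>\<omega>. \<bar>g \<omega>\<bar> \<le> 1" for g :: "'a \<Rightarrow> real"
  proof (rule integrable_const_bound[of _ D])
    show "AE \<omega> in M. norm (W \<omega> * g \<omega>) \<le> D"
    proof (rule AE_I2)
      fix \<omega> assume "\<omega> \<in> space M"
      then show "norm (W \<omega> * g \<omega>) \<le> D"
        using mult_mono[OF D(2) that(2)[of \<omega>]] D(1) by (auto simp: abs_mult)
    qed
  qed simp
  have gint: "integrable M g" if [measurable]: "g \<in> borel_measurable M"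
      and "\<And>\<omega>. \<bar>g \<omega>\<bar> \<le> 1" for g :: "'a \<Rightarrow> real"
    by (rule integrable_const_bound[of _ 1]) (use that in auto)
  have W0: "expectation W = 0"
    using c[of 0] by simp
  have Vg: "expectation (\<lambda>\<omega>. V \<omega> * g \<omega>) = expectation g + expectation (\<lambda>\<omega>. W \<omega> * g \<omega>) / D"
    if [measurable]: "g \<in> borel_measurable M"
      and "\<And>\<omega>. \<bar>g \<omega>\<bar> \<le> 1" for g :: "'a \<Rightarrow> real"
  proof -
    have "expectation (\<lambda>\<omega>. V \<omega> * g \<omega>) = expectation (\<lambda>\<omega>. g \<omega> + (W \<omega> * g \<omega>) / D)"
      unfolding V_def by (simp add: field_simps)
    also have "\<dots> = expectation g + expectation (\<lambda>\<omega>. W \<omega> * g \<omega>) / D"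
      using Wint[OF that] gint[OF that] by simp
    finally show ?thesis .
  qed
  have Vint: "integrable M V"
    by (rule integrable_const_bound[of _ 2]) (use V0 V2 in auto)
  define N where "N = density M V"
  have emN: "emeasure N (space N) = 1"
  proof -
    have "emeasure N (space N) = (\<integral>\<^sup>+\<omega>. V \<omega> \<partial>M)"
      unfolding N_def by (simp add: emeasure_density cong: nn_integral_cong)
    also have "\<dots> = ennreal (expectation V)"
      using Vint V by (rule nn_integral_eq_integral)
    also have "expectation V = 1"
      using Vg[of "\<lambda>_. 1"] W0 by (simp add: prob_space)
    finally show ?thesis by simp
  qed
  interpret N: prob_space N
    by (rule prob_spaceI) (rule emN)
  have [measurable]: "Y \<in> borel_measurable N" unfolding N_def by simp
  have "distr N borel Y = distr M borel Y"
  proof (rule Levy_uniqueness)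
    show "real_distribution (distr N borel Y)"
      by (rule N.real_distribution_distr) simp
    show "real_distribution (distr M borel Y)"
      by (rule real_distribution_distr) simp
    show "char (distr N borel Y) = char (distr M borel Y)"
    proof
      fix t
      have i1: "integrable M (\<lambda>x. iexp (t * Y x))"
        by (rule integrable_const_bound[of _ 1]) auto
      have i2: "integrable M (\<lambda>x. V x *\<^sub>R iexp (t * Y x))"
        by (rule integrable_const_bound[of _ 2]) (use V0 V2 in auto)
      have "char (distr N borel Y) t = (LINT x|M. V x *\<^sub>R iexp (t * Y x))"
        unfolding char_def N_def by (simp add: integral_distr integral_density V)
      also have "\<dots> = (LINT x|M. iexp (t * Y x))"
      proof (rule complex_eqI)
        show "Re (LINT x|M. V x *\<^sub>R iexp (t * Y x)) = Re (LINT x|M. iexp (t * Y x))"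
          unfolding integral_Re[OF i1, symmetric] integral_Re[OF i2, symmetric]
          using Vg[of "\<lambda>x. cos (t * Y x)"] c[of t] by (simp add: Re_exp)
        show "Im (LINT x|M. V x *\<^sub>R iexp (t * Y x)) = Im (LINT x|M. iexp (t * Y x))"
          unfolding integral_Im[OF i1, symmetric] integral_Im[OF i2, symmetric]
          using Vg[of "\<lambda>x. sin (t * Y x)"] s[of t] by (simp add: Im_exp)
      qed
      finally show "char (distr N borel Y) t = char (distr M borel Y) t"
        unfolding char_def by (simp add: integral_distr)
    qed
  qed
  moreover have "(LINT y|distr N borel Y. indicat_real B y) = expectation (\<lambda>\<omega>. V \<omega> * indicat_real B (Y \<omega>))"
    unfolding N_def by (subst integral_distr, simp, simp, subst integral_density) (simp_all add: V)
  moreover have "(LINT y|distr M borel Y. indicat_real B y) = expectation (\<lambda>\<omega>. indicat_real B (Y \<omega>))"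
    by (subst integral_distr) simp_all
  \<comment> \<open>The two laws agree, so the indicator has the same mean with the density
    \<open>V\<close> as without it; the difference of these means is the claimed expectation divided
    by \<open>D\<close>.\<close>
  ultimately show ?thesis
    using Vg[of "\<lambda>\<omega>. indicator B (Y \<omega>)"] D(1) by (simp add: indicator_def del: integral_indicator)
qed

end

section \<open>Linearity and covariance of the noise\<close>

locale noise = prob_space M for M :: "'a measure" +
  fixes \<xi> :: "(real \<times> real \<Rightarrow> real) \<Rightarrow> 'a \<Rightarrow> real"
  assumes white: "white_noise M \<xi>"
begin

lemma gaussian_sum:
  "finite F \<Longrightarrow> F \<subseteq> L2_spacetime \<Longrightarrow> centered_gaussian M (\<lambda>\<omega>. \<Sum>\<phi>\<in>F. a \<phi> * \<xi> \<phi> \<omega>)"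
  using white unfolding white_noise_def by blast

lemma noise_covariance:
  "\<phi> \<in> L2_spacetime \<Longrightarrow> \<psi> \<in> L2_spacetime \<Longrightarrow>
    expectation (\<lambda>\<omega>. \<xi> \<phi> \<omega> * \<xi> \<psi> \<omega>) = (LINT z|spacetime. \<phi> z * \<psi> z)"
  using white unfolding white_noise_def by blast

lemma gaussian_noise: "\<phi> \<in> L2_spacetime \<Longrightarrow> centered_gaussian M (\<xi> \<phi>)"
  using gaussian_sum[of "{\<phi>}" "\<lambda>_. 1"] by simp

lemma measurable_noise: "\<phi> \<in> L2_spacetime \<Longrightarrow> \<xi> \<phi> \<in> borel_measurable M"
  using gaussian_noise unfolding centered_gaussian_def by blast

lemma noise_moments:
  assumes "\<phi> \<in> L2_spacetime"
  shows "integrable M (\<xi> \<phi>)" "integrable M (\<lambda>\<omega>. (\<xi> \<phi> \<omega>)\<^sup>2)" "expectation (\<xi> \<phi>) = 0"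
  using centered_gaussian_moments[OF gaussian_noise[OF assms]] by auto

lemma integrable_noise_mult:
  assumes "\<phi> \<in> L2_spacetime" "\<psi> \<in> L2_spacetime"
  shows "integrable M (\<lambda>\<omega>. \<xi> \<phi> \<omega> * \<xi> \<psi> \<omega>)"
  by (intro integrable_mult_square measurable_noise noise_moments assms)

text \<open>Linearity is a consequence of the covariance: the second moment of \<open>\<xi> \<eta>
  \<omega> - \<xi> \<phi> \<omega> - \<xi> \<psi> \<omega>\<close> expands into inner products of
  the test functions, which cancel. As these are integrals over \<open>spacetime\<close>, equality
  on the closed half plane suffices.\<close>

lemma noise_add:
  assumes "\<phi> \<in> L2_spacetime" "\<psi> \<in> L2_spacetime" "\<eta> \<in> L2_spacetime"
    and eq: "\<And>z. z \<in> space spacetime \<Longrightarrow> \<eta> z = \<phi> z + \<psi> z"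
  shows "AE \<omega> in M. \<xi> \<eta> \<omega> = \<xi> \<phi> \<omega> + \<xi> \<psi> \<omega>"
proof -
  define G where "G f g = (LINT z|spacetime. f z * g z)" for f g :: "real \<times> real \<Rightarrow> real"
  have G: "G f \<eta> = G f \<phi> + G f \<psi>" "G \<eta> f = G \<phi> f + G \<psi> f" if "f \<in> L2_spacetime" for f
  proof -
    have "G f \<eta> = (LINT z|spacetime. f z * \<phi> z + f z * \<psi> z)"
      unfolding G_def by (intro Bochner_Integration.integral_cong refl) (simp add: eq distrib_left)
    also have "\<dots> = G f \<phi> + G f \<psi>"
      unfolding G_def by (intro Bochner_Integration.integral_add L2_mult_integrable assms that)
    finally show 1: "G f \<eta> = G f \<phi> + G f \<psi>" .
    then show "G \<eta> f = G \<phi> f + G \<psi> f"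
      by (simp add: G_def mult.commute)
  qed
  note [measurable] = measurable_noise[OF assms(1)] measurable_noise[OF assms(2)] measurable_noise[OF assms(3)]
  note i = integrable_noise_mult
  have i2: "integrable M (\<lambda>\<omega>. (\<xi> \<eta> \<omega> - \<xi> \<phi> \<omega> - \<xi> \<psi> \<omega>)\<^sup>2)" and
    e: "expectation (\<lambda>\<omega>. (\<xi> \<eta> \<omega> - \<xi> \<phi> \<omega> - \<xi> \<psi> \<omega>)\<^sup>2) = 
      G \<eta> \<eta> + G \<phi> \<phi> + G \<psi> \<psi> - 2 * G \<eta> \<phi> - 2 * G \<eta> \<psi> + 2 * G \<phi> \<psi>"
  proof -
    have *: "(\<lambda>\<omega>. (\<xi> \<eta> \<omega> - \<xi> \<phi> \<omega> - \<xi> \<psi> \<omega>)\<^sup>2) = (\<lambda>\<omega>. \<xi> \<eta> \<omega> * \<xi> \<eta> \<omega> + \<xi> \<phi> \<omega> * \<xi> \<phi> \<omega> + \<xi> \<psi> \<omega> * \<xi> \<psi> \<omega>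
      - 2 * (\<xi> \<eta> \<omega> * \<xi> \<phi> \<omega>) - 2 * (\<xi> \<eta> \<omega> * \<xi> \<psi> \<omega>) + 2 * (\<xi> \<phi> \<omega> * \<xi> \<psi> \<omega>))"
      by (auto simp: power2_eq_square algebra_simps)
    show "integrable M (\<lambda>\<omega>. (\<xi> \<eta> \<omega> - \<xi> \<phi> \<omega> - \<xi> \<psi> \<omega>)\<^sup>2)"
      unfolding * using assms(1-3) by (intro Bochner_Integration.integrable_add Bochner_Integration.integrable_diff integrable_mult_right i)
    show "expectation (\<lambda>\<omega>. (\<xi> \<eta> \<omega> - \<xi> \<phi> \<omega> - \<xi> \<psi> \<omega>)\<^sup>2) = 
      G \<eta> \<eta> + G \<phi> \<phi> + G \<psi> \<psi> - 2 * G \<eta> \<phi> - 2 * G \<eta> \<psi> + 2 * G \<phi> \<psi>"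
      unfolding * using assms(1-3) by (simp add: i noise_covariance G_def)
  qed
  have "expectation (\<lambda>\<omega>. (\<xi> \<eta> \<omega> - \<xi> \<phi> \<omega> - \<xi> \<psi> \<omega>)\<^sup>2) = 0"
    unfolding e using assms(1-3) by (simp add: G) (simp add: G_def mult.commute)
  with i2 have "AE \<omega> in M. (\<xi> \<eta> \<omega> - \<xi> \<phi> \<omega> - \<xi> \<psi> \<omega>)\<^sup>2 = 0"
    by (subst (asm) integral_nonneg_eq_0_iff_AE) auto
  then show ?thesis by eventually_elim (simp add: power2_eq_iff_nonneg)
qed

section \<open>Independence of past and future noise\<close>

lemma past_future_orthogonal:
  assumes "\<phi> \<in> past t" "\<psi> \<in> future t"
  shows "expectation (\<lambda>\<omega>. \<xi> \<phi> \<omega> * \<xi> \<psi> \<omega>) = 0"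
proof -
  have "\<phi> (s, x) * \<psi> (s, x) = 0" for s x
    using assms unfolding past_def future_def by (cases "s \<le> t") auto
  then have "\<phi> z * \<psi> z = 0" for z
    by (cases z) blast
  then have "(LINT z|spacetime. \<phi> z * \<psi> z) = 0"
    by (simp only: Bochner_Integration.integral_zero)
  then show ?thesis
    using assms noise_covariance[of \<phi> \<psi>] by (simp add: past_def future_def)
qed

text \<open>These variables serve as phases of trigonometric test functions. The span is closed
  under adding a multiple of another past noise variable, and its elements stay Gaussian when a
  multiple of a future noise variable is added.\<close>

definition past_span :: "real \<Rightarrow> ('a \<Rightarrow> real) set" where
  "past_span t = {(\<lambda>\<omega>. \<Sum>\<phi>\<in>F. a \<phi> * \<xi> \<phi> \<omega>) | F a. finite F \<and> F \<subseteq> past t}"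

text \<open>Gaussian sums are indexed by a set of test functions, so a term whose test function
  already occurs in \<open>F\<close> has to be merged into the existing coefficient.\<close>

lemma sum_insert_coefficient:
  assumes "finite F"
  shows "\<exists>a'. \<forall>\<omega>. (\<Sum>\<phi>\<in>F. a \<phi> * \<xi> \<phi> \<omega>) + b * \<xi> \<psi> \<omega> = (\<Sum>\<phi>\<in>insert \<psi> F. a' \<phi> * \<xi> \<phi> \<omega>)"
proof (cases "\<psi> \<in> F")
  case True
  then have "insert \<psi> F = F" by auto
  with assms True show ?thesis
    by (intro exI[of _ "a(\<psi> := a \<psi> + b)"]) (simp add: sum.remove distrib_right)
next
  case False
  have "(\<Sum>\<phi>\<in>F. (a(\<psi> := b)) \<phi> * \<xi> \<phi> \<omega>) = (\<Sum>\<phi>\<in>F. a \<phi> * \<xi> \<phi> \<omega>)" for \<omega>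
    using False by (intro sum.cong) auto
  with assms False show ?thesis
    by (intro exI[of _ "a(\<psi> := b)"]) simp
qed

lemma past_span_add:
  assumes "Y \<in> past_span t" "\<phi> \<in> past t"
  shows "(\<lambda>\<omega>. Y \<omega> + b * \<xi> \<phi> \<omega>) \<in> past_span t"
proof -
  from assms obtain F a where F: "finite F" "F \<subseteq> past t" and Y: "Y = (\<lambda>\<omega>. \<Sum>\<phi>\<in>F. a \<phi> * \<xi> \<phi> \<omega>)"
    unfolding past_span_def by auto
  from sum_insert_coefficient[OF F(1), of a b \<phi>] obtain a' where
    "(\<lambda>\<omega>. Y \<omega> + b * \<xi> \<phi> \<omega>) = (\<lambda>\<omega>. \<Sum>\<phi>\<in>insert \<phi> F. a' \<phi> * \<xi> \<phi> \<omega>)"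
    unfolding Y by auto
  with F assms(2) show ?thesis
    unfolding past_span_def by blast
qed

lemma past_span_0: "(\<lambda>\<omega>. 0) \<in> past_span t"
  unfolding past_span_def by (rule CollectI, rule exI[of _ "{}"]) auto

text \<open>The cross term vanishes because past and future test functions have disjoint supports;
  additive second moments are what makes the Gaussian characteristic function factor.\<close>

lemma gaussian_past_span_add:
  assumes Y: "Y \<in> past_span t" and \<psi>: "\<psi> \<in> future t"
  shows "centered_gaussian M (\<lambda>\<omega>. Y \<omega> + b * \<xi> \<psi> \<omega>)"
    and "expectation (\<lambda>\<omega>. (Y \<omega> + b * \<xi> \<psi> \<omega>)\<^sup>2) = 
      expectation (\<lambda>\<omega>. (Y \<omega>)\<^sup>2) + b\<^sup>2 * expectation (\<lambda>\<omega>. (\<xi> \<psi> \<omega>)\<^sup>2)"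
proof -
  from assms obtain F a where F: "finite F" "F \<subseteq> past t" and Yeq: "Y = (\<lambda>\<omega>. \<Sum>\<phi>\<in>F. a \<phi> * \<xi> \<phi> \<omega>)"
    unfolding past_span_def by auto
  have L2: "F \<subseteq> L2_spacetime" "\<psi> \<in> L2_spacetime"
    using F \<psi> by (auto simp: past_def future_def)
  from sum_insert_coefficient[OF F(1), of a b \<psi>] obtain a' where
    "(\<lambda>\<omega>. Y \<omega> + b * \<xi> \<psi> \<omega>) = (\<lambda>\<omega>. \<Sum>\<phi>\<in>insert \<psi> F. a' \<phi> * \<xi> \<phi> \<omega>)"
    unfolding Yeq by auto
  then show "centered_gaussian M (\<lambda>\<omega>. Y \<omega> + b * \<xi> \<psi> \<omega>)"
    using gaussian_sum[of "insert \<psi> F" a'] F(1) L2 by simp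
  have Yg: "centered_gaussian M Y"
    unfolding Yeq using gaussian_sum[OF F(1) L2(1)] by simp
  then have [measurable]: "Y \<in> borel_measurable M" by (simp add: centered_gaussian_def)
  note [measurable] = measurable_noise[OF L2(2)]
  have iY: "integrable M (\<lambda>\<omega>. (Y \<omega>)\<^sup>2)"
    using centered_gaussian_moments[OF Yg] by simp
  have i: "integrable M (\<lambda>\<omega>. Y \<omega> * \<xi> \<psi> \<omega>)"
    by (intro integrable_mult_square iY noise_moments L2) simp_all
  have "expectation (\<lambda>\<omega>. Y \<omega> * \<xi> \<psi> \<omega>) = expectation (\<lambda>\<omega>. \<Sum>\<phi>\<in>F. a \<phi> * (\<xi> \<phi> \<omega> * \<xi> \<psi> \<omega>))"
    unfolding Yeq by (simp add: sum_distrib_right mult.assoc)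
  also have "\<dots> = (\<Sum>\<phi>\<in>F. a \<phi> * expectation (\<lambda>\<omega>. \<xi> \<phi> \<omega> * \<xi> \<psi> \<omega>))"
    using L2 by (subst Bochner_Integration.integral_sum) (auto intro!: integrable_noise_mult)
  also have "\<dots> = 0"
    using F \<psi> by (intro sum.neutral) (auto simp: past_future_orthogonal)
  finally have c: "expectation (\<lambda>\<omega>. Y \<omega> * \<xi> \<psi> \<omega>) = 0" .
  have "(\<lambda>\<omega>. (Y \<omega> + b * \<xi> \<psi> \<omega>)\<^sup>2) = (\<lambda>\<omega>. (Y \<omega>)\<^sup>2 + b\<^sup>2 * (\<xi> \<psi> \<omega>)\<^sup>2 + 2 * b * (Y \<omega> * \<xi> \<psi> \<omega>))"
    by (auto simp: power2_eq_square algebra_simps)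
  then show "expectation (\<lambda>\<omega>. (Y \<omega> + b * \<xi> \<psi> \<omega>)\<^sup>2) = 
      expectation (\<lambda>\<omega>. (Y \<omega>)\<^sup>2) + b\<^sup>2 * expectation (\<lambda>\<omega>. (\<xi> \<psi> \<omega>)\<^sup>2)"
    using iY noise_moments(2)[OF L2(2)] i c by simp
qed

lemma gaussian_past_span: "Y \<in> past_span t \<Longrightarrow> centered_gaussian M Y"
  using gaussian_sum unfolding past_span_def past_def by fastforce

lemma measurable_past_span: "Y \<in> past_span t \<Longrightarrow> Y \<in> borel_measurable M"
  using gaussian_past_span by (simp add: centered_gaussian_def)

text \<open>The weight in front of the indicator is orthogonal to every cosine and sine of a
  multiple of \<open>\<xi> \<psi>\<close>, because the joint characteristic function factors.
  \<open>weighted_trig_unique\<close> then replaces these trigonometric functions by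
  indicators.\<close>

lemma trig_future_indicator:
  assumes Y: "Y \<in> past_span t" and \<psi>: "\<psi> \<in> future t" and B: "B \<in> sets borel"
  shows "expectation (\<lambda>\<omega>. (cos (Y \<omega>) - expectation (\<lambda>\<omega>. cos (Y \<omega>))) * indicator B (\<xi> \<psi> \<omega>)) = 0"
    and "expectation (\<lambda>\<omega>. sin (Y \<omega>) * indicator B (\<xi> \<psi> \<omega>)) = 0"
proof -
  let ?T = "\<xi> \<psi>"
  have L2: "\<psi> \<in> L2_spacetime" using \<psi> by (simp add: future_def)
  note [measurable] = measurable_noise[OF L2] measurable_past_span[OF Y] B
  note g = centered_gaussian_moments(4,5)[OF gaussian_past_span_add(1)[OF Y \<psi>]]
  have gY: "expectation (\<lambda>\<omega>. cos (Y \<omega>)) = exp (- expectation (\<lambda>\<omega>. (Y \<omega>)\<^sup>2) / 2)"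
    using centered_gaussian_moments(4)[OF gaussian_past_span[OF Y]] .
  define EY where "EY = expectation (\<lambda>\<omega>. (Y \<omega>)\<^sup>2)"
  define ET where "ET = expectation (\<lambda>\<omega>. (\<xi> \<psi> \<omega>)\<^sup>2)"
  have c: "expectation (\<lambda>\<omega>. cos (Y \<omega> + b * ?T \<omega>)) = exp (- (EY + b\<^sup>2 * ET) / 2)"
    and s: "expectation (\<lambda>\<omega>. sin (Y \<omega> + b * ?T \<omega>)) = 0" for b
    unfolding EY_def ET_def using g[of b] gaussian_past_span_add(2)[OF Y \<psi>, of b] by simp_all
  have cT: "expectation (\<lambda>\<omega>. cos (b * ?T \<omega>)) = exp (- (b\<^sup>2 * ET) / 2)"
    and sT: "expectation (\<lambda>\<omega>. sin (b * ?T \<omega>)) = 0" for b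
    unfolding ET_def using centered_gaussian_moments(4,5)[OF gaussian_past_span_add(1)[OF past_span_0[of t] \<psi>, of b]]
     gaussian_past_span_add(2)[OF past_span_0[of t] \<psi>, of b] by simp_all
  note it = integrable_trig
  \<comment> \<open>Comparing the addition formulas at \<open>b\<close> and \<open>-b\<close>
    isolates the four products, since the second moment is even in \<open>b\<close>.\<close>
  have cc: "expectation (\<lambda>\<omega>. cos (Y \<omega>) * cos (b * ?T \<omega>)) = exp (- (EY + b\<^sup>2 * ET) / 2)"
   and ss: "expectation (\<lambda>\<omega>. sin (Y \<omega>) * sin (b * ?T \<omega>)) = 0"
   and cs: "expectation (\<lambda>\<omega>. cos (Y \<omega>) * sin (b * ?T \<omega>)) = 0" 
   and sc: "expectation (\<lambda>\<omega>. sin (Y \<omega>) * cos (b * ?T \<omega>)) = 0" for b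
    using c[of b] c[of "-b"] s[of b] s[of "-b"] by (simp_all add: cos_add sin_add it cos_diff sin_diff)
  show "expectation (\<lambda>\<omega>. (cos (Y \<omega>) - expectation (\<lambda>\<omega>. cos (Y \<omega>))) * indicator B (\<xi> \<psi> \<omega>)) = 0"
  proof (rule weighted_trig_unique[where C=2])
    show "\<bar>cos (Y \<omega>) - expectation (\<lambda>\<omega>. cos (Y \<omega>))\<bar> \<le> 2" for \<omega>
    proof -
      have "0 \<le> EY" unfolding EY_def by simp
      then have "0 \<le> expectation (\<lambda>\<omega>. cos (Y \<omega>)) \<and> expectation (\<lambda>\<omega>. cos (Y \<omega>)) \<le> 1"
        unfolding gY by (simp add: EY_def[symmetric])
      then show ?thesis using cos_le_one[of "Y \<omega>"] cos_ge_minus_one[of "Y \<omega>"] by linarith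
    qed
    show "expectation (\<lambda>\<omega>. (cos (Y \<omega>) - expectation (\<lambda>\<omega>. cos (Y \<omega>))) * cos (b * ?T \<omega>)) = 0" for b
    proof -
      have "exp (- (EY + b\<^sup>2 * ET) / 2) = exp (- EY / 2) * exp (- (b\<^sup>2 * ET) / 2)"
        by (simp add: exp_add[symmetric] add_divide_distrib diff_divide_distrib)
      moreover have "expectation (\<lambda>\<omega>. (cos (Y \<omega>) - expectation (\<lambda>\<omega>. cos (Y \<omega>))) * cos (b * ?T \<omega>))
        = expectation (\<lambda>\<omega>. cos (Y \<omega>) * cos (b * ?T \<omega>)) - expectation (\<lambda>\<omega>. cos (Y \<omega>)) * expectation (\<lambda>\<omega>. cos (b * ?T \<omega>))"
        unfolding left_diff_distrib by (subst Bochner_Integration.integral_diff)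
          (auto intro!: it(1)[of Y "\<lambda>\<omega>. b * ?T \<omega>"] it(5)[of "\<lambda>\<omega>. b * ?T \<omega>" "\<lambda>\<omega>. b * ?T \<omega>"])
      ultimately show ?thesis
        using cc[of b] cT[of b] gY by (simp add: EY_def[symmetric])
    qed
    show "expectation (\<lambda>\<omega>. (cos (Y \<omega>) - expectation (\<lambda>\<omega>. cos (Y \<omega>))) * sin (b * ?T \<omega>)) = 0" for b
      unfolding left_diff_distrib using cs[of b] sT[of b]
      by (subst Bochner_Integration.integral_diff)
        (auto intro!: it(2)[of Y "\<lambda>\<omega>. b * ?T \<omega>"] it(6)[of "\<lambda>\<omega>. b * ?T \<omega>" "\<lambda>\<omega>. b * ?T \<omega>"])
  qed simp_all
  show "expectation (\<lambda>\<omega>. sin (Y \<omega>) * indicator B (\<xi> \<psi> \<omega>)) = 0"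
    by (rule weighted_trig_unique[where C=1]) (simp_all add: ss sc)
qed

text \<open>Finite-dimensional events of the noise. With lists, an intersection is a concatenation,
  and an induction can peel off one constraint at a time.\<close>

definition cylinder :: "((real \<times> real \<Rightarrow> real) \<times> real set) list \<Rightarrow> 'a set" where
  "cylinder js = {\<omega> \<in> space M. \<forall>(\<phi>, B) \<in> set js. \<xi> \<phi> \<omega> \<in> B}"

lemma cylinder_sets [measurable]:
  assumes "set js \<subseteq> past t \<times> sets borel"
  shows "cylinder js \<in> sets M"
  using assms
proof (induction js)
  case Nil
  then show ?case by (simp add: cylinder_def)
next
  case (Cons j js)
  obtain \<phi> B where j: "j = (\<phi>, B)" by fastforce
  with Cons.prems have [measurable]: "B \<in> sets borel" and "\<phi> \<in> L2_spacetime"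
    by (auto simp: past_def)
  note [measurable] = measurable_noise[OF \<open>\<phi> \<in> L2_spacetime\<close>]
  have "cylinder (j # js) = (\<xi> \<phi> -` B \<inter> space M) \<inter> cylinder js"
    unfolding cylinder_def j by auto
  also have "\<dots> \<in> sets M"
    using Cons
    by (intro sets.Int measurable_sets[OF measurable_noise[OF \<open>\<phi> \<in> L2_spacetime\<close>] \<open>B \<in> sets borel\<close>]) simp
  finally show ?case .
qed

text \<open>
  Uncorrelated jointly Gaussian variables are independent. The induction trades one trigonometric
  factor for one indicator at a time: by the product-to-sum formulas, multiplying \<open>cos (Y \<omega>)\<close> by
  \<open>cos (t * \<xi> \<phi> \<omega>)\<close> stays within the induction hypothesis, and the uniqueness result above applies.
\<close>

lemma cylinder_trig:
  assumes \<psi>: "\<psi> \<in> future t" and B0: "B0 \<in> sets borel"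
  shows "set js \<subseteq> past t \<times> sets borel \<Longrightarrow> Y \<in> past_span t \<Longrightarrow>
    expectation (\<lambda>\<omega>. (indicator B0 (\<xi> \<psi> \<omega>) - expectation (\<lambda>\<omega>. indicator B0 (\<xi> \<psi> \<omega>)))
      * indicator (cylinder js) \<omega> * cos (Y \<omega>)) = 0 \<and>
    expectation (\<lambda>\<omega>. (indicator B0 (\<xi> \<psi> \<omega>) - expectation (\<lambda>\<omega>. indicator B0 (\<xi> \<psi> \<omega>)))
      * indicator (cylinder js) \<omega> * sin (Y \<omega>)) = 0"
proof (induction js arbitrary: Y)
  let ?T = "\<xi> \<psi>"
  define p where "p = expectation (\<lambda>\<omega>. indicat_real B0 (?T \<omega>))"
  \<comment> \<open>The centered indicator of the future event. Being at most 1 in absolute value,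
    it remains an admissible weight after multiplication by indicators and trigonometric
    factors.\<close>
  define G where "G = (\<lambda>\<omega>. indicator B0 (?T \<omega>) - p)"
  have L2: "\<psi> \<in> L2_spacetime" using \<psi> by (simp add: future_def)
  note [measurable] = measurable_noise[OF L2] B0
  have p01: "0 \<le> p" "p \<le> 1"
    unfolding p_def by (auto intro!: integral_le_const integrable_const_bound[of _ 1] simp del: integral_indicator)
  then have G1: "\<bar>G \<omega>\<bar> \<le> 1" for \<omega>
    unfolding G_def by (auto simp: indicator_def)
  have Gm[measurable]: "G \<in> borel_measurable M" unfolding G_def by simp
  {
    case Nil
    note [measurable] = measurable_past_span[OF Nil(2)]
    note it = integrable_trig(5,6)[OF measurable_past_span[OF Nil(2)] measurable_past_span[OF Nil(2)]]
    have i: "integrable M (\<lambda>\<omega>. indicat_real B0 (?T \<omega>) * cos (Y \<omega>))" 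
      "integrable M (\<lambda>\<omega>. indicat_real B0 (?T \<omega>) * sin (Y \<omega>))"
      "integrable M (\<lambda>\<omega>. indicat_real B0 (?T \<omega>))"
      by (rule integrable_const_bound[of _ 1]; auto simp: abs_mult indicator_def)+
    have i': "integrable M (\<lambda>\<omega>. cos (Y \<omega>) * indicat_real B0 (?T \<omega>))"
      using i(1) by (simp only: mult.commute)
    \<comment> \<open>The earlier lemma centers the cosine; solving for the mixed mean gives the
      factorization, after which the indicator can be centered instead.\<close>
    have "expectation (\<lambda>\<omega>. (cos (Y \<omega>) - expectation (\<lambda>\<omega>. cos (Y \<omega>))) * indicator B0 (?T \<omega>))
        = expectation (\<lambda>\<omega>. indicat_real B0 (?T \<omega>) * cos (Y \<omega>)) - expectation (\<lambda>\<omega>. cos (Y \<omega>)) * p"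
      unfolding left_diff_distrib p_def
      by (subst Bochner_Integration.integral_diff) (auto intro!: i i' simp: mult.commute)
    then have 1: "expectation (\<lambda>\<omega>. indicat_real B0 (?T \<omega>) * cos (Y \<omega>)) = expectation (\<lambda>\<omega>. cos (Y \<omega>)) * p"
      using trig_future_indicator(1)[OF Nil(2) \<psi> B0] by simp
    have 2: "expectation (\<lambda>\<omega>. indicat_real B0 (?T \<omega>) * sin (Y \<omega>)) = 0"
      using trig_future_indicator(2)[OF Nil(2) \<psi> B0] by (simp add: mult.commute)
    have 3: "expectation (\<lambda>\<omega>. sin (Y \<omega>)) = 0"
      using centered_gaussian_moments(5)[OF gaussian_past_span[OF Nil(2)]] .
    have "expectation (\<lambda>\<omega>. G \<omega> * cos (Y \<omega>)) = 0"
      unfolding G_def left_diff_distrib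
      by (subst Bochner_Integration.integral_diff) (auto intro!: i it simp: 1)
    moreover have "expectation (\<lambda>\<omega>. G \<omega> * sin (Y \<omega>)) = 0"
      unfolding G_def left_diff_distrib
      by (subst Bochner_Integration.integral_diff) (auto intro!: i it simp: 2 3)
    moreover have "expectation (\<lambda>\<omega>. G \<omega> * indicator (cylinder []) \<omega> * f \<omega>) = expectation (\<lambda>\<omega>. G \<omega> * f \<omega>)" for f
      by (rule Bochner_Integration.integral_cong) (auto simp: cylinder_def)
    ultimately show ?case unfolding G_def p_def by simp
  next
    case (Cons j js)
    obtain \<phi> B where j: "j = (\<phi>, B)" by fastforce
    with Cons.prems have B[measurable]: "B \<in> sets borel" and \<phi>: "\<phi> \<in> past t" "\<phi> \<in> L2_spacetime"
      and js: "set js \<subseteq> past t \<times> sets borel" by (auto simp: past_def)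
    note [measurable] = measurable_noise[OF \<phi>(2)] measurable_past_span[OF Cons.prems(2)] cylinder_sets[OF js]
    let ?I = "\<lambda>\<omega>. indicat_real (cylinder js) \<omega>"
    have gb: "integrable M (\<lambda>\<omega>. G \<omega> * ?I \<omega> * f \<omega>)" if [measurable]: "f \<in> borel_measurable M" 
      and "\<And>\<omega>. \<bar>f \<omega>\<bar> \<le> 1" for f :: "'a \<Rightarrow> real"
      by (rule integrable_const_bound[of _ 1]) (use that G1 in \<open>auto simp: abs_mult indicator_def mult_le_one\<close>)
    have IH: "expectation (\<lambda>\<omega>. G \<omega> * ?I \<omega> * cos (Y \<omega> + b * \<xi> \<phi> \<omega>)) = 0" 
       "expectation (\<lambda>\<omega>. G \<omega> * ?I \<omega> * sin (Y \<omega> + b * \<xi> \<phi> \<omega>)) = 0" for b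
      using Cons.IH[OF js past_span_add[OF Cons.prems(2) \<phi>(1), of b]] unfolding G_def p_def by auto
    \<comment> \<open>Product-to-sum: the products below are half a sum (\<open>c = 1\<close>) or
      half a difference (\<open>c = -1\<close>) of \<open>h\<close> at the phases
      \<open>Y \<omega> + b * \<xi> \<phi> \<omega>\<close> and
      \<open>Y \<omega> - b * \<xi> \<phi> \<omega>\<close>, both of which belong to
      \<open>past_span t\<close>.\<close>
    have pm: "expectation (\<lambda>\<omega>. G \<omega> * ?I \<omega> * f \<omega>) = 0" 
      if e: "\<And>\<omega>. f \<omega> = (h (Y \<omega> + b * \<xi> \<phi> \<omega>) + c * h (Y \<omega> + (- b) * \<xi> \<phi> \<omega>)) / 2"
         and h: "h = cos \<or> h = sin" for f h b and c :: real
    proof -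
      have [measurable]: "h \<in> borel_measurable borel" and h1: "\<bar>h x\<bar> \<le> 1" for x
        using h by auto
      have "expectation (\<lambda>\<omega>. G \<omega> * ?I \<omega> * f \<omega>) = expectation (\<lambda>\<omega>. (1/2) * (G \<omega> * ?I \<omega> * h (Y \<omega> + b * \<xi> \<phi> \<omega>)) 
          + (c/2) * (G \<omega> * ?I \<omega> * h (Y \<omega> + (- b) * \<xi> \<phi> \<omega>)))"
        unfolding e by (intro Bochner_Integration.integral_cong refl) (simp add: algebra_simps)
      also have "\<dots> = (1/2) * expectation (\<lambda>\<omega>. G \<omega> * ?I \<omega> * h (Y \<omega> + b * \<xi> \<phi> \<omega>)) 
          + (c/2) * expectation (\<lambda>\<omega>. G \<omega> * ?I \<omega> * h (Y \<omega> + (- b) * \<xi> \<phi> \<omega>))"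
        by (subst Bochner_Integration.integral_add)
          (auto intro!: integrable_mult_right gb h1 simp del: mult_minus_left)
      also have "\<dots> = 0" using h IH[of b] IH[of "-b"] by auto
      finally show ?thesis .
    qed
    have ind: "indicat_real (cylinder (j # js)) \<omega> = ?I \<omega> * indicator B (\<xi> \<phi> \<omega>)" for \<omega>
      unfolding cylinder_def j by (auto simp: indicator_def)
    have "expectation (\<lambda>\<omega>. (G \<omega> * ?I \<omega> * cos (Y \<omega>)) * indicator B (\<xi> \<phi> \<omega>)) = 0"
    proof (rule weighted_trig_unique[where C=1])
      show "\<bar>G \<omega> * ?I \<omega> * cos (Y \<omega>)\<bar> \<le> 1" for \<omega>
        using G1[of \<omega>] by (auto simp: abs_mult indicator_def mult_le_one)
      show "expectation (\<lambda>\<omega>. (G \<omega> * ?I \<omega> * cos (Y \<omega>)) * cos (b * \<xi> \<phi> \<omega>)) = 0" for b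
        using pm[of "\<lambda>\<omega>. cos (Y \<omega>) * cos (b * \<xi> \<phi> \<omega>)" cos b 1] 
        by (simp add: cos_add cos_diff mult.assoc)
      show "expectation (\<lambda>\<omega>. (G \<omega> * ?I \<omega> * cos (Y \<omega>)) * sin (b * \<xi> \<phi> \<omega>)) = 0" for b
        using pm[of "\<lambda>\<omega>. cos (Y \<omega>) * sin (b * \<xi> \<phi> \<omega>)" sin b "-1"] 
        by (simp add: sin_add sin_diff mult.assoc)
    qed simp_all
    moreover have "expectation (\<lambda>\<omega>. (G \<omega> * ?I \<omega> * sin (Y \<omega>)) * indicator B (\<xi> \<phi> \<omega>)) = 0"
    proof (rule weighted_trig_unique[where C=1])
      show "\<bar>G \<omega> * ?I \<omega> * sin (Y \<omega>)\<bar> \<le> 1" for \<omega>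
        using G1[of \<omega>] by (auto simp: abs_mult indicator_def mult_le_one)
      show "expectation (\<lambda>\<omega>. (G \<omega> * ?I \<omega> * sin (Y \<omega>)) * cos (b * \<xi> \<phi> \<omega>)) = 0" for b
        using pm[of "\<lambda>\<omega>. sin (Y \<omega>) * cos (b * \<xi> \<phi> \<omega>)" sin b 1] 
        by (simp add: sin_add sin_diff mult.assoc)
      show "expectation (\<lambda>\<omega>. (G \<omega> * ?I \<omega> * sin (Y \<omega>)) * sin (b * \<xi> \<phi> \<omega>)) = 0" for b
        \<comment> \<open>The minus sign puts the product of sines into the form required by
          \<open>pm\<close>, whose first summand enters with a plus.\<close>
        using pm[of "\<lambda>\<omega>. - (sin (Y \<omega>) * sin (b * \<xi> \<phi> \<omega>))" cos b "-1"] 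
        by (simp add: cos_add cos_diff mult.assoc)
    qed simp_all
    ultimately show ?case
      unfolding ind G_def p_def by (simp add: ac_simps)
  }
qed

text \<open>The case \<open>Y = 0\<close> of the preceding identity: the cosine is 1 and only the
  indicator of the cylinder remains.\<close>

lemma cylinder_future_indep:
  assumes \<psi>: "\<psi> \<in> future t" and B[measurable]: "B \<in> sets borel" and js: "set js \<subseteq> past t \<times> sets borel"
  shows "prob (cylinder js \<inter> (\<xi> \<psi> -` B \<inter> space M)) = prob (cylinder js) * prob (\<xi> \<psi> -` B \<inter> space M)"
proof -
  have L2: "\<psi> \<in> L2_spacetime" using \<psi> by (simp add: future_def)
  note [measurable] = measurable_noise[OF L2] cylinder_sets[OF js]
  let ?b = "\<xi> \<psi> -` B \<inter> space M"
  have p: "expectation (\<lambda>\<omega>. indicat_real B (\<xi> \<psi> \<omega>)) = prob ?b"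
  proof -
    have "expectation (\<lambda>\<omega>. indicat_real B (\<xi> \<psi> \<omega>)) = expectation (indicator ?b)"
      by (rule Bochner_Integration.integral_cong) (auto simp: indicator_def)
    then show ?thesis by simp
  qed
  have "0 = expectation (\<lambda>\<omega>. (indicator B (\<xi> \<psi> \<omega>) - prob ?b) * indicator (cylinder js) \<omega>)"
    using cylinder_trig[OF \<psi> B js past_span_0] p by simp
  also have "\<dots> = expectation (\<lambda>\<omega>. indicator (cylinder js \<inter> ?b) \<omega> - prob ?b * indicator (cylinder js) \<omega>)"
    by (rule Bochner_Integration.integral_cong) (auto simp: indicator_def)
  also have "\<dots> = prob (cylinder js \<inter> ?b) - prob ?b * prob (cylinder js)"
    by (subst Bochner_Integration.integral_diff) (auto intro!: integrable_real_indicator simp: less_top[symmetric])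
  finally show ?thesis by simp
qed

section \<open>The augmented filtration and its independence of later noise\<close>

lemma noise_filtration_sets:
  "sets (noise_filtration M \<xi> t) \<subseteq>
    sigma_sets (space M) ({cylinder js | js. set js \<subseteq> past t \<times> sets borel} \<union> null_sets M)"
proof -
  let ?G = "{\<xi> \<phi> -` B \<inter> space M | \<phi> B.
        \<phi> \<in> L2_spacetime \<and> (\<forall>s x. s > t \<longrightarrow> \<phi> (s, x) = 0) \<and> B \<in> sets borel}
     \<union> null_sets M"
  have "?G \<subseteq> Pow (space M)" using sets.sets_into_space by auto
  then have "sets (noise_filtration M \<xi> t) = sigma_sets (space M) ?G"
    unfolding noise_filtration_def by (rule sets_measure_of)
  also have "\<dots> \<subseteq> sigma_sets (space M) ({cylinder js | js. set js \<subseteq> past t \<times> sets borel} \<union> null_sets M)"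
  proof (rule sigma_sets_mono', rule Un_mono)
    show "{\<xi> \<phi> -` B \<inter> space M | \<phi> B. \<phi> \<in> L2_spacetime \<and> (\<forall>s x. s > t \<longrightarrow> \<phi> (s, x) = 0) \<and> B \<in> sets borel}
      \<subseteq> {cylinder js | js. set js \<subseteq> past t \<times> sets borel}"
    proof clarify
      fix \<phi> B assume "\<phi> \<in> L2_spacetime" "\<forall>s x. s > t \<longrightarrow> \<phi> (s, x) = 0" "B \<in> sets (borel :: real measure)"
      then show "\<exists>js. \<xi> \<phi> -` B \<inter> space M = cylinder js \<and> set js \<subseteq> past t \<times> sets borel"
        by (intro exI[of _ "[(\<phi>, B)]"]) (auto simp: cylinder_def past_def)
    qed
  qed simp
  finally show ?thesis .
qed

lemma noise_filtration_subset: "sets (noise_filtration M \<xi> t) \<subseteq> sets M"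
proof -
  have "sigma_sets (space M) ({cylinder js | js. set js \<subseteq> past t \<times> sets borel} \<union> null_sets M) \<subseteq> sets M"
    by (rule sets.sigma_sets_subset) auto
  with noise_filtration_sets show ?thesis by blast
qed

lemma space_noise_filtration [simp]: "space (noise_filtration M \<xi> t) = space M"
  unfolding noise_filtration_def
  by (rule space_measure_of) (use sets.sets_into_space in auto)

lemma noise_filtration_measurable: "X \<in> borel_measurable (noise_filtration M \<xi> t) \<Longrightarrow> X \<in> borel_measurable M"
  using noise_filtration_subset[of t] by (auto simp: measurable_def)

text \<open>The generators of the filtration need not be closed under intersection; cylinders
  together with null sets are, and both are independent of \<open>\<xi> \<psi>\<close>, cylinders by
  the Gaussian computation and null sets trivially. A pi-lambda argument extends this to the whole
  filtration.\<close>

lemma indep_future: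
  assumes X: "X \<in> borel_measurable (noise_filtration M \<xi> t)" and \<psi>: "\<psi> \<in> future t"
  shows "indep_var borel X borel (\<xi> \<psi>)"
proof -
  have L2: "\<psi> \<in> L2_spacetime" using \<psi> by (simp add: future_def)
  note [measurable] = measurable_noise[OF L2]
  let ?E = "{cylinder js | js. set js \<subseteq> past t \<times> sets borel} \<union> null_sets M"
  let ?F = "{\<xi> \<psi> -` B \<inter> space M | B. B \<in> sets borel}"
  have "indep_set ?E ?F"
  proof (rule indep_setI)
    show "?E \<subseteq> events" by auto
    show "?F \<subseteq> events" by auto
    fix a b assume ab: "a \<in> ?E" "b \<in> ?F"
    then obtain B where B: "B \<in> sets borel" "b = \<xi> \<psi> -` B \<inter> space M" by auto
    from ab(1) show "prob (a \<inter> b) = prob a * prob b"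
    proof
      assume "a \<in> {cylinder js | js. set js \<subseteq> past t \<times> sets borel}"
      then show ?thesis using cylinder_future_indep[OF \<psi> B(1)] B(2) by auto
    next
      assume a: "a \<in> null_sets M"
      moreover have "a \<inter> b \<in> null_sets M"
        using a B by (intro null_set_Int2) auto
      ultimately show ?thesis by (auto simp: null_sets_def measure_def)
    qed
  qed
  moreover have "Int_stable ?E"
  proof (rule Int_stableI)
    fix a b assume a: "a \<in> ?E" and b: "b \<in> ?E"
    then have "a \<in> sets M" "b \<in> sets M" by auto
    show "a \<inter> b \<in> ?E"
    proof (cases "a \<in> null_sets M \<or> b \<in> null_sets M")
      case True
      then show ?thesis
        using \<open>a \<in> sets M\<close> \<open>b \<in> sets M\<close> by (auto intro: null_set_Int1 null_set_Int2)
    next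
      case False
      with a b obtain js ks where "set js \<subseteq> past t \<times> sets borel" "set ks \<subseteq> past t \<times> sets borel"
        "a = cylinder js" "b = cylinder ks" by auto
      moreover then have "a \<inter> b = cylinder (js @ ks)" by (auto simp: cylinder_def)
      ultimately have "a \<inter> b = cylinder (js @ ks) \<and> set (js @ ks) \<subseteq> past t \<times> sets borel" by simp
      then show ?thesis by blast
    qed
  qed
  moreover have "Int_stable ?F"
  proof (rule Int_stableI)
    fix a b assume "a \<in> ?F" "b \<in> ?F"
    then obtain A B where "A \<in> sets borel" "B \<in> sets borel" "a = \<xi> \<psi> -` A \<inter> space M" "b = \<xi> \<psi> -` B \<inter> space M"
      by auto
    then have "a \<inter> b = \<xi> \<psi> -` (A \<inter> B) \<inter> space M \<and> A \<inter> B \<in> sets borel" by auto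
    then show "a \<inter> b \<in> ?F" by blast
  qed
  ultimately have ind: "indep_set (sigma_sets (space M) ?E) (sigma_sets (space M) ?F)"
    by (rule indep_set_sigma_sets)
  have "{X -` A \<inter> space M | A. A \<in> sets borel} \<subseteq> sets (noise_filtration M \<xi> t)"
    using measurable_sets[OF X] by auto
  then have "sigma_sets (space M) {X -` A \<inter> space M | A. A \<in> sets borel} \<subseteq> sets (noise_filtration M \<xi> t)"
    using sets.sigma_sets_subset[of _ "noise_filtration M \<xi> t"] by simp
  then have "sigma_sets (space M) {X -` A \<inter> space M | A. A \<in> sets borel} \<subseteq> sigma_sets (space M) ?E"
    using noise_filtration_sets by blast
  with ind show ?thesis
    unfolding indep_var_eq indep_sets2_eq using noise_filtration_measurable[OF X] by (auto intro: measurable_noise L2)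
qed

section \<open>The Walsh isometry\<close>

text \<open>The martingale property of the noise: the future factor is independent of
  \<open>X\<close> and has mean zero.\<close>

lemma future_integral:
  assumes X: "X \<in> borel_measurable (noise_filtration M \<xi> t)" "integrable M X" and \<psi>: "\<psi> \<in> future t"
  shows "integrable M (\<lambda>\<omega>. X \<omega> * \<xi> \<psi> \<omega>)" "expectation (\<lambda>\<omega>. X \<omega> * \<xi> \<psi> \<omega>) = 0"
  using indep_var_integrable[OF indep_future[OF X(1) \<psi>] X(2)]
    indep_var_lebesgue_integral[OF indep_future[OF X(1) \<psi>] X(2)] noise_moments[OF future_L2[OF \<psi>]] by auto

lemma future_integral_square:
  assumes X: "X \<in> borel_measurable (noise_filtration M \<xi> t)" "integrable M X" and \<psi>: "\<psi> \<in> future t"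
  shows "integrable M (\<lambda>\<omega>. X \<omega> * (\<xi> \<psi> \<omega>)\<^sup>2)" 
    "expectation (\<lambda>\<omega>. X \<omega> * (\<xi> \<psi> \<omega>)\<^sup>2) = expectation X * (LINT z|spacetime. \<psi> z * \<psi> z)"
proof -
  have "indep_var borel ((\<lambda>x. x) \<circ> X) borel ((\<lambda>x. x\<^sup>2) \<circ> \<xi> \<psi>)"
    by (rule indep_var_compose[OF indep_future[OF X(1) \<psi>]]) auto
  then have i: "indep_var borel X borel (\<lambda>\<omega>. (\<xi> \<psi> \<omega>)\<^sup>2)"
    by (simp add: comp_def)
  note L2 = future_L2[OF \<psi>]
  show "integrable M (\<lambda>\<omega>. X \<omega> * (\<xi> \<psi> \<omega>)\<^sup>2)" 
    "expectation (\<lambda>\<omega>. X \<omega> * (\<xi> \<psi> \<omega>)\<^sup>2) = expectation X * (LINT z|spacetime. \<psi> z * \<psi> z)"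
    using indep_var_integrable[OF i X(2)] indep_var_lebesgue_integral[OF i X(2)] noise_moments(2)[OF L2]
      noise_covariance[OF L2 L2] by (auto simp: power2_eq_square)
qed

text \<open>\<open>indep_future\<close> concerns one future variable at a time. Polarization reduces
  the mixed product to squares of single variables, namely the noise of \<phi>, of \<psi> and of
  their sum.\<close>

lemma future_integral_mult:
  assumes X: "X \<in> borel_measurable (noise_filtration M \<xi> t)" "integrable M X" 
    and \<phi>: "\<phi> \<in> future t" and \<psi>: "\<psi> \<in> future t"
  shows "expectation (\<lambda>\<omega>. X \<omega> * (\<xi> \<phi> \<omega> * \<xi> \<psi> \<omega>)) = expectation X * (LINT z|spacetime. \<phi> z * \<psi> z)"
proof -
  let ?s = "\<lambda>z. \<phi> z + \<psi> z"
  have s: "?s \<in> future t" using future_add[OF \<phi> \<psi>] .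
  note L2 = future_L2[OF \<phi>] future_L2[OF \<psi>] future_L2[OF s]
  note [measurable] = measurable_noise[OF L2(1)] measurable_noise[OF L2(2)] measurable_noise[OF L2(3)]
    noise_filtration_measurable[OF X(1)]
  note iS = future_integral_square[OF X s] and ip = future_integral_square[OF X \<phi>] 
    and iq = future_integral_square[OF X \<psi>]
  let ?e = "\<lambda>\<omega>. (X \<omega> * (\<xi> ?s \<omega>)\<^sup>2 - X \<omega> * (\<xi> \<phi> \<omega>)\<^sup>2 - X \<omega> * (\<xi> \<psi> \<omega>)\<^sup>2) / 2"
  have "AE \<omega> in M. X \<omega> * (\<xi> \<phi> \<omega> * \<xi> \<psi> \<omega>) = ?e \<omega>"
    using noise_add[OF L2(1) L2(2) L2(3)] by (auto simp: power2_eq_square algebra_simps)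
  then have "expectation (\<lambda>\<omega>. X \<omega> * (\<xi> \<phi> \<omega> * \<xi> \<psi> \<omega>)) = expectation ?e"
    by (intro integral_cong_AE) simp_all
  also have "\<dots> = expectation X * ((LINT z|spacetime. ?s z * ?s z) - (LINT z|spacetime. \<phi> z * \<phi> z) 
      - (LINT z|spacetime. \<psi> z * \<psi> z)) / 2"
    using iS ip iq by (simp add: right_diff_distrib)
  also have "(LINT z|spacetime. ?s z * ?s z) = (LINT z|spacetime. \<phi> z * \<phi> z + \<psi> z * \<psi> z + 2 * (\<phi> z * \<psi> z))"
    by (intro Bochner_Integration.integral_cong refl) (simp add: algebra_simps)
  also have "\<dots> = (LINT z|spacetime. \<phi> z * \<phi> z) + (LINT z|spacetime. \<psi> z * \<psi> z) + 2 * (LINT z|spacetime. \<phi> z * \<psi> z)"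
    using L2 by (simp add: L2_mult_integrable)
  finally show ?thesis by simp
qed

lemma noise_filtration_gens: "{\<xi> \<phi> -` B \<inter> space M | \<phi> B.
        \<phi> \<in> L2_spacetime \<and> (\<forall>s x. s > t \<longrightarrow> \<phi> (s, x) = 0) \<and> B \<in> sets borel}
     \<union> null_sets M \<subseteq> Pow (space M)"
  using sets.sets_into_space by auto

lemma noise_filtration_mono:
  assumes "s \<le> t"
  shows "sets (noise_filtration M \<xi> s) \<subseteq> sets (noise_filtration M \<xi> t)"
  unfolding noise_filtration_def sets_measure_of[OF noise_filtration_gens]
  by (rule sigma_sets_mono') (use assms in force)

lemma measurable_noise_filtration_mono:
  "X \<in> borel_measurable (noise_filtration M \<xi> s) \<Longrightarrow> s \<le> t \<Longrightarrow> X \<in> borel_measurable (noise_filtration M \<xi> t)"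
  using noise_filtration_mono[of s t] by (auto simp: measurable_def)

lemma past_measurable:
  assumes "\<phi> \<in> past t"
  shows "\<xi> \<phi> \<in> borel_measurable (noise_filtration M \<xi> t)"
proof (rule measurableI)
  fix B :: "real set" assume "B \<in> sets borel"
  with assms show "\<xi> \<phi> -` B \<inter> space (noise_filtration M \<xi> t) \<in> sets (noise_filtration M \<xi> t)"
    unfolding space_noise_filtration unfolding noise_filtration_def sets_measure_of[OF noise_filtration_gens]
    by (intro sigma_sets.Basic) (auto simp: past_def)
qed simp

text \<open>
  The part of the first rectangle before time \<open>c\<close> is measurable with respect to the past of \<open>c\<close>; the
  remaining part and the second rectangle are both independent of that past.
\<close>

lemma isometry_rect_ordered:
  assumes X: "X \<in> borel_measurable (noise_filtration M \<xi> a)" "\<And>\<omega>. \<omega> \<in> space M \<Longrightarrow> \<bar>X \<omega>\<bar> \<le> C"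
    and Y: "Y \<in> borel_measurable (noise_filtration M \<xi> c)" "\<And>\<omega>. \<omega> \<in> space M \<Longrightarrow> \<bar>Y \<omega>\<bar> \<le> D"
    and A: "A \<in> sets borel" "emeasure lborel A < \<infinity>" and B: "B \<in> sets borel" "emeasure lborel B < \<infinity>"
    and ac: "a \<le> c"
  shows "expectation (\<lambda>\<omega>. (X \<omega> * \<xi> (rect a b A) \<omega>) * (Y \<omega> * \<xi> (rect c d B) \<omega>)) =
    expectation (\<lambda>\<omega>. X \<omega> * Y \<omega>) * (LINT z|spacetime. rect a b A z * rect c d B z)"
proof -
  note [measurable] = noise_filtration_measurable[OF X(1)] noise_filtration_measurable[OF Y(1)]
    measurable_noise[OF rect_L2[OF A]] measurable_noise[OF rect_L2[OF B]]
  have Xc: "X \<in> borel_measurable (noise_filtration M \<xi> c)"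
    using measurable_noise_filtration_mono[OF X(1) ac] .
  have XYc: "(\<lambda>\<omega>. X \<omega> * Y \<omega>) \<in> borel_measurable (noise_filtration M \<xi> c)"
    using Xc Y(1) by simp
  have XY: "\<bar>X \<omega> * Y \<omega>\<bar> \<le> C * D" if "\<omega> \<in> space M" for \<omega>
    using mult_mono[OF X(2)[OF that] Y(2)[OF that]] X(2)[OF that] by (force simp: abs_mult)
  have XYi: "integrable M (\<lambda>\<omega>. X \<omega> * Y \<omega>)"
    by (rule integrable_const_bound[of _ "C * D"]) (use XY in auto)
  \<comment> \<open>Everything but the last factor is known at time \<open>c\<close>, so the mean
    vanishes. The right end \<open>b'\<close> is left free because both the whole first rectangle
    and its part before \<open>c\<close> occur below.\<close>
  have past: "expectation (\<lambda>\<omega>. (X \<omega> * Y \<omega> * \<xi> (rect a b' A) \<omega>) * \<xi> (rect c d B) \<omega>) = 0" if "b' \<le> c" for b'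
  proof (rule future_integral(2)[OF _ _ rect_future[OF B order_refl]])
    have "\<xi> (rect a b' A) \<in> borel_measurable (noise_filtration M \<xi> c)"
      by (intro past_measurable rect_past A that)
    with XYc show "(\<lambda>\<omega>. X \<omega> * Y \<omega> * \<xi> (rect a b' A) \<omega>) \<in> borel_measurable (noise_filtration M \<xi> c)"
      by simp
    show "integrable M (\<lambda>\<omega>. X \<omega> * Y \<omega> * \<xi> (rect a b' A) \<omega>)"
      by (rule integrable_bounded_mult[OF _ XY noise_moments(1)[OF rect_L2[OF A]]]) simp_all
  qed
  show ?thesis
  proof (cases "b \<le> c")
    case True
    then have "rect a b A z * rect c d B z = 0" for z
      by (auto simp: indicator_def)
    then have "(LINT z|spacetime. rect a b A z * rect c d B z) = 0"
      by (simp only: Bochner_Integration.integral_zero)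
    with past[OF True] show ?thesis by (simp add: ac_simps)
  next
    case False
    have add: "AE \<omega> in M. \<xi> (rect a b A) \<omega> = \<xi> (rect a c A) \<omega> + \<xi> (rect c b A) \<omega>"
      by (rule noise_add) (use A False ac in \<open>auto intro!: rect_L2 simp: indicator_def\<close>)
    note [measurable] = measurable_noise[OF rect_L2[OF A, of a c]] measurable_noise[OF rect_L2[OF A, of c b]]
    have i: "integrable M (\<lambda>\<omega>. X \<omega> * Y \<omega> * (\<xi> (rect p q A) \<omega> * \<xi> (rect c d B) \<omega>))" for p q
      by (rule integrable_bounded_mult[OF _ XY integrable_noise_mult[OF rect_L2[OF A] rect_L2[OF B]]]) simp_all
    have "expectation (\<lambda>\<omega>. (X \<omega> * \<xi> (rect a b A) \<omega>) * (Y \<omega> * \<xi> (rect c d B) \<omega>)) =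
      expectation (\<lambda>\<omega>. X \<omega> * Y \<omega> * (\<xi> (rect a c A) \<omega> * \<xi> (rect c d B) \<omega>) + 
        X \<omega> * Y \<omega> * (\<xi> (rect c b A) \<omega> * \<xi> (rect c d B) \<omega>))"
      using add by (intro integral_cong_AE) (auto simp: algebra_simps)
    also have "\<dots> = expectation (\<lambda>\<omega>. X \<omega> * Y \<omega>) * (LINT z|spacetime. rect c b A z * rect c d B z)"
      using past[OF order_refl] future_integral_mult[OF XYc XYi rect_future[OF A order_refl, of c b] rect_future[OF B order_refl, of c d]]
      by (subst Bochner_Integration.integral_add[OF i i]) (simp add: mult.assoc)
    \<comment> \<open>On the support of the second rectangle all times exceed \<open>c\<close>,
      where the left ends \<open>a\<close> and \<open>c\<close> make no difference.\<close>
    also have "(LINT z|spacetime. rect c b A z * rect c d B z) = (LINT z|spacetime. rect a b A z * rect c d B z)"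
      using ac by (intro Bochner_Integration.integral_cong refl) (auto simp: indicator_def)
    finally show ?thesis .
  qed
qed

lemma isometry_rect:
  assumes X: "X \<in> borel_measurable (noise_filtration M \<xi> a)" "\<And>\<omega>. \<omega> \<in> space M \<Longrightarrow> \<bar>X \<omega>\<bar> \<le> C"
    and Y: "Y \<in> borel_measurable (noise_filtration M \<xi> c)" "\<And>\<omega>. \<omega> \<in> space M \<Longrightarrow> \<bar>Y \<omega>\<bar> \<le> D"
    and A: "A \<in> sets borel" "emeasure lborel A < \<infinity>" and B: "B \<in> sets borel" "emeasure lborel B < \<infinity>"
  shows "expectation (\<lambda>\<omega>. (X \<omega> * \<xi> (rect a b A) \<omega>) * (Y \<omega> * \<xi> (rect c d B) \<omega>)) =
    expectation (\<lambda>\<omega>. X \<omega> * Y \<omega>) * (LINT z|spacetime. rect a b A z * rect c d B z)"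
proof (cases "a \<le> c")
  case True
  then show ?thesis by (intro isometry_rect_ordered[OF X Y A B])
next
  case False
  then have "expectation (\<lambda>\<omega>. (Y \<omega> * \<xi> (rect c d B) \<omega>) * (X \<omega> * \<xi> (rect a b A) \<omega>)) =
    expectation (\<lambda>\<omega>. Y \<omega> * X \<omega>) * (LINT z|spacetime. rect c d B z * rect a b A z)"
    by (intro isometry_rect_ordered[OF Y X B A]) auto
  then show ?thesis by (simp add: mult.commute)
qed

text \<open>The rectangles of \<open>L\<close> may overlap. Instead of refining them, both squares
  are expanded over all pairs of terms, and each side becomes the mean of the sum of
  \<open>X i \<omega> * X j \<omega>\<close> times the inner product of the two rectangles.\<close>

lemma simple_isometry:
  assumes L: "simple_predictable M \<xi> L"
  shows "(\<lambda>\<omega>. simple_integral \<xi> L \<omega>) \<in> borel_measurable M"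
    and "integrable M (\<lambda>\<omega>. simple_integral \<xi> L \<omega>)"
    and "integrable M (\<lambda>\<omega>. (simple_integral \<xi> L \<omega>)\<^sup>2)"
    and "expectation (\<lambda>\<omega>. simple_integral \<xi> L \<omega>) = 0"
    and "(\<lambda>(z, \<omega>). simple_value L z \<omega>) \<in> borel_measurable (spacetime \<Otimes>\<^sub>M M)"
    and "(\<integral>\<^sup>+(z, \<omega>). ennreal ((simple_value L z \<omega>)\<^sup>2) \<partial>(spacetime \<Otimes>\<^sub>M M)) =
      (\<integral>\<^sup>+\<omega>. ennreal ((simple_integral \<xi> L \<omega>)\<^sup>2) \<partial>M)"
proof -
  define n where "n = length L"
  define X where "X i = fst (L ! i)" for i
  define a where "a i = fst (snd (L ! i))" for i
  define b where "b i = fst (snd (snd (L ! i)))" for i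
  define A where "A i = snd (snd (snd (L ! i)))" for i
  define R where "R i = rect (a i) (b i) (A i)" for i
  have S: "simple_integral \<xi> L = (\<lambda>\<omega>. \<Sum>i<n. X i \<omega> * \<xi> (R i) \<omega>)"
    unfolding simple_integral_def X_def R_def a_def b_def A_def n_def 
    by (simp add: sum_list_sum_nth fun_eq_iff case_prod_beta lessThan_atLeast0)
  have V: "simple_value L = (\<lambda>z \<omega>. \<Sum>i<n. X i \<omega> * R i z)"
    unfolding simple_value_def X_def R_def a_def b_def A_def n_def 
    by (simp add: sum_list_sum_nth fun_eq_iff case_prod_beta lessThan_atLeast0)
  have L': "A i \<in> sets borel" "emeasure lborel (A i) < \<infinity>"
       "X i \<in> borel_measurable (noise_filtration M \<xi> (a i))"
       "\<exists>C. \<forall>\<omega>\<in>space M. \<bar>X i \<omega>\<bar> \<le> C" if "i < n" for i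
  proof -
    have "L ! i \<in> set L" using that by (simp add: n_def)
    then show "A i \<in> sets borel" "emeasure lborel (A i) < \<infinity>"
       "X i \<in> borel_measurable (noise_filtration M \<xi> (a i))"
       "\<exists>C. \<forall>\<omega>\<in>space M. \<bar>X i \<omega>\<bar> \<le> C"
      using L unfolding simple_predictable_def X_def a_def b_def A_def by (auto simp: case_prod_beta)
  qed
  then obtain C where C: "\<bar>X i \<omega>\<bar> \<le> C i" if "i < n" "\<omega> \<in> space M" for i \<omega>
    by metis
  have L2: "R i \<in> L2_spacetime" "R i \<in> future (a i)" if "i < n" for i
    unfolding R_def using L'[OF that] by (auto intro: rect_L2 rect_future)
  have Xm: "X i \<in> borel_measurable M" if "i < n" for i
    using noise_filtration_measurable[OF L'(3)[OF that]] .
  have Xi: "integrable M (X i)" if "i < n" for i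
    by (rule integrable_const_bound[of _ "C i"]) (use C Xm that in auto)
  have XX: "\<bar>X i \<omega> * X j \<omega>\<bar> \<le> C i * C j" if "i < n" "j < n" "\<omega> \<in> space M" for i j \<omega>
    using mult_mono[OF C[OF that(1,3)] C[OF that(2,3)]] C[OF that(1,3)] by (force simp: abs_mult)
  have XXi: "integrable M (\<lambda>\<omega>. X i \<omega> * X j \<omega>)" if "i < n" "j < n" for i j
    by (rule integrable_const_bound[of _ "C i * C j"]) (use XX Xm that in auto)
  have XRm: "(\<lambda>\<omega>. X i \<omega> * \<xi> (R i) \<omega>) \<in> borel_measurable M" if "i < n" for i
    using Xm[OF that] measurable_noise[OF L2(1)[OF that]] by simp
  have Ri: "integrable M (\<lambda>\<omega>. (X i \<omega> * \<xi> (R i) \<omega>) * (X j \<omega> * \<xi> (R j) \<omega>))" if "i < n" "j < n" for i j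
  proof -
    have "integrable M (\<lambda>\<omega>. (X i \<omega> * X j \<omega>) * (\<xi> (R i) \<omega> * \<xi> (R j) \<omega>))"
      by (rule integrable_bounded_mult[OF _ XX[OF that] integrable_noise_mult[OF L2(1)[OF that(1)] L2(1)[OF that(2)]]])
        (use that Xm in auto)
    then show ?thesis by (simp add: ac_simps)
  qed
  have T: "integrable M (\<lambda>\<omega>. X i \<omega> * \<xi> (R i) \<omega>)" "expectation (\<lambda>\<omega>. X i \<omega> * \<xi> (R i) \<omega>) = 0" if "i < n" for i
    using future_integral[OF L'(3)[OF that] Xi[OF that] L2(2)[OF that]] by auto
  show Sm: "(\<lambda>\<omega>. simple_integral \<xi> L \<omega>) \<in> borel_measurable M"
    unfolding S using XRm by (intro borel_measurable_sum) auto
  show "integrable M (\<lambda>\<omega>. simple_integral \<xi> L \<omega>)"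
    unfolding S using T(1) by (intro Bochner_Integration.integrable_sum) simp
  show "expectation (\<lambda>\<omega>. simple_integral \<xi> L \<omega>) = 0"
    unfolding S using T by (simp add: Bochner_Integration.integral_sum)
  have S2: "(\<lambda>\<omega>. (simple_integral \<xi> L \<omega>)\<^sup>2) = (\<lambda>\<omega>. \<Sum>i<n. \<Sum>j<n. (X i \<omega> * \<xi> (R i) \<omega>) * (X j \<omega> * \<xi> (R j) \<omega>))"
    unfolding S by (simp add: power2_eq_square sum_product)
  show S2i: "integrable M (\<lambda>\<omega>. (simple_integral \<xi> L \<omega>)\<^sup>2)"
    unfolding S2 using Ri by (intro Bochner_Integration.integrable_sum) auto
  let ?G = "\<lambda>i j. LINT z|spacetime. R i z * R j z"
  have "expectation (\<lambda>\<omega>. (simple_integral \<xi> L \<omega>)\<^sup>2) = 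
    (\<Sum>i<n. \<Sum>j<n. expectation (\<lambda>\<omega>. (X i \<omega> * \<xi> (R i) \<omega>) * (X j \<omega> * \<xi> (R j) \<omega>)))"
    unfolding S2 using Ri by (rule integral_double_sum)
  also have "\<dots> = (\<Sum>i<n. \<Sum>j<n. expectation (\<lambda>\<omega>. X i \<omega> * X j \<omega>) * ?G i j)"
  proof (intro sum.cong refl)
    fix i j assume "i \<in> {..<n}" "j \<in> {..<n}"
    then have "i < n" "j < n" by auto
    then show "expectation (\<lambda>\<omega>. (X i \<omega> * \<xi> (R i) \<omega>) * (X j \<omega> * \<xi> (R j) \<omega>)) = expectation (\<lambda>\<omega>. X i \<omega> * X j \<omega>) * ?G i j"
      unfolding R_def by (intro isometry_rect[where C="C i" and D="C j"] L' C)
  qed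
  also have "\<dots> = expectation (\<lambda>\<omega>. \<Sum>i<n. \<Sum>j<n. X i \<omega> * X j \<omega> * ?G i j)"
    using XXi by (subst integral_double_sum) (auto intro!: integrable_mult_left)
  finally have E: "expectation (\<lambda>\<omega>. (simple_integral \<xi> L \<omega>)\<^sup>2) = expectation (\<lambda>\<omega>. \<Sum>i<n. \<Sum>j<n. X i \<omega> * X j \<omega> * ?G i j)" .
  have Rm: "R i \<in> borel_measurable spacetime" if "i < n" for i
    using L2[OF that] by (simp add: L2_spacetime_def)
  show Vm: "(\<lambda>(z, \<omega>). simple_value L z \<omega>) \<in> borel_measurable (spacetime \<Otimes>\<^sub>M M)"
    unfolding V case_prod_beta
  proof (intro borel_measurable_sum borel_measurable_times)
    fix i assume "i \<in> {..<n}"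
    then have [measurable]: "X i \<in> borel_measurable M" "R i \<in> borel_measurable spacetime"
      using Xm Rm by auto
    show "(\<lambda>p. X i (snd p)) \<in> borel_measurable (spacetime \<Otimes>\<^sub>M M)" 
      "(\<lambda>p. R i (fst p)) \<in> borel_measurable (spacetime \<Otimes>\<^sub>M M)"
      by simp_all
  qed
  interpret S: sigma_finite_measure spacetime by (rule sigma_finite_spacetime)
  interpret P: pair_sigma_finite spacetime M ..
  have V2: "(LINT z|spacetime. (simple_value L z \<omega>)\<^sup>2) = (\<Sum>i<n. \<Sum>j<n. X i \<omega> * X j \<omega> * ?G i j)"
    and V2i: "integrable spacetime (\<lambda>z. (simple_value L z \<omega>)\<^sup>2)" for \<omega>
  proof -
    have eq: "(\<lambda>z. (simple_value L z \<omega>)\<^sup>2) = (\<lambda>z. \<Sum>i<n. \<Sum>j<n. (X i \<omega> * X j \<omega>) * (R i z * R j z))"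
      unfolding V by (simp add: power2_eq_square sum_product ac_simps)
    have i: "integrable spacetime (\<lambda>z. (X i \<omega> * X j \<omega>) * (R i z * R j z))" if "i < n" "j < n" for i j
      using L2 that by (intro integrable_mult_right L2_mult_integrable) auto
    show "integrable spacetime (\<lambda>z. (simple_value L z \<omega>)\<^sup>2)"
      unfolding eq by (intro Bochner_Integration.integrable_sum i) auto
    show "(LINT z|spacetime. (simple_value L z \<omega>)\<^sup>2) = (\<Sum>i<n. \<Sum>j<n. X i \<omega> * X j \<omega> * ?G i j)"
      unfolding eq using i by (subst integral_double_sum) auto
  qed
  have "(\<integral>\<^sup>+(z, \<omega>). ennreal ((simple_value L z \<omega>)\<^sup>2) \<partial>(spacetime \<Otimes>\<^sub>M M)) =
     (\<integral>\<^sup>+\<omega>. \<integral>\<^sup>+z. ennreal ((simple_value L z \<omega>)\<^sup>2) \<partial>spacetime \<partial>M)"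
    using Vm by (subst P.nn_integral_snd[symmetric]) (auto simp: case_prod_beta)
  also have "\<dots> = (\<integral>\<^sup>+\<omega>. ennreal (\<Sum>i<n. \<Sum>j<n. X i \<omega> * X j \<omega> * ?G i j) \<partial>M)"
    using V2i V2 by (subst nn_integral_eq_integral) auto
  also have "\<dots> = ennreal (expectation (\<lambda>\<omega>. \<Sum>i<n. \<Sum>j<n. X i \<omega> * X j \<omega> * ?G i j))"
  proof (rule nn_integral_eq_integral)
    show "integrable M (\<lambda>\<omega>. \<Sum>i<n. \<Sum>j<n. X i \<omega> * X j \<omega> * ?G i j)"
      using XXi by (intro Bochner_Integration.integrable_sum integrable_mult_left) auto
    \<comment> \<open>The double sum may have negative terms; it is nonnegative as the integral of a
      square.\<close>
    show "AE \<omega> in M. 0 \<le> (\<Sum>i<n. \<Sum>j<n. X i \<omega> * X j \<omega> * ?G i j)"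
      unfolding V2[symmetric] by simp
  qed
  also have "\<dots> = (\<integral>\<^sup>+\<omega>. ennreal ((simple_integral \<xi> L \<omega>)\<^sup>2) \<partial>M)"
    unfolding E[symmetric] using S2i by (intro nn_integral_eq_integral[symmetric]) auto
  finally show "(\<integral>\<^sup>+(z, \<omega>). ennreal ((simple_value L z \<omega>)\<^sup>2) \<partial>(spacetime \<Otimes>\<^sub>M M)) =
      (\<integral>\<^sup>+\<omega>. ennreal ((simple_integral \<xi> L \<omega>)\<^sup>2) \<partial>M)" .
qed

text \<open>Two applications of the triangle inequality for squares, one on \<open>M\<close> and one
  on the product space, produce the factor 4 and error terms that vanish along the approximating
  sequence.\<close>

lemma walsh_integral_bound:
  assumes "has_walsh_integral M \<xi> H I"
  shows "(\<integral>\<^sup>+\<omega>. ennreal ((I \<omega>)\<^sup>2) \<partial>M) \<le> 4 * (\<integral>\<^sup>+(z, \<omega>). ennreal ((H z \<omega>)\<^sup>2) \<partial>(spacetime \<Otimes>\<^sub>M M))"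
proof -
  let ?P = "spacetime \<Otimes>\<^sub>M M"
  from assms obtain L where [measurable]: "(\<lambda>(z, \<omega>). H z \<omega>) \<in> borel_measurable ?P" "I \<in> borel_measurable M"
    and L: "\<And>n. simple_predictable M \<xi> (L n)"
    and e: "(\<lambda>n. \<integral>\<^sup>+(z, \<omega>). ennreal ((simple_value (L n) z \<omega> - H z \<omega>)\<^sup>2) \<partial>?P) \<longlonglongrightarrow> 0" (is "?e \<longlonglongrightarrow> 0")
    and d: "(\<lambda>n. \<integral>\<^sup>+\<omega>. ennreal ((simple_integral \<xi> (L n) \<omega> - I \<omega>)\<^sup>2) \<partial>M) \<longlonglongrightarrow> 0" (is "?d \<longlonglongrightarrow> 0")
    unfolding has_walsh_integral_def by auto
  let ?H = "(\<integral>\<^sup>+(z, \<omega>). ennreal ((H z \<omega>)\<^sup>2) \<partial>?P)"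
  have "(\<integral>\<^sup>+\<omega>. ennreal ((I \<omega>)\<^sup>2) \<partial>M) \<le> 4 * ?H + 4 * ?e n + 2 * ?d n" for n
  proof -
    note s = simple_isometry[OF L[of n]]
    have "(\<integral>\<^sup>+\<omega>. ennreal ((I \<omega>)\<^sup>2) \<partial>M) \<le> 2 * (\<integral>\<^sup>+\<omega>. ennreal ((simple_integral \<xi> (L n) \<omega>)\<^sup>2) \<partial>M) + 2 * ?d n"
      by (rule nn_integral_square_triangle) (use s in auto)
    also have "(\<integral>\<^sup>+\<omega>. ennreal ((simple_integral \<xi> (L n) \<omega>)\<^sup>2) \<partial>M) = (\<integral>\<^sup>+(z, \<omega>). ennreal ((simple_value (L n) z \<omega>)\<^sup>2) \<partial>?P)"
      using s by simp
    also have "\<dots> \<le> 2 * ?H + 2 * ?e n"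
    proof -
      have "(\<integral>\<^sup>+p. ennreal ((simple_value (L n) (fst p) (snd p))\<^sup>2) \<partial>?P) \<le> 2 * (\<integral>\<^sup>+p. ennreal ((H (fst p) (snd p))\<^sup>2) \<partial>?P)
         + 2 * (\<integral>\<^sup>+p. ennreal ((H (fst p) (snd p) - simple_value (L n) (fst p) (snd p))\<^sup>2) \<partial>?P)"
        using s(5) by (intro nn_integral_square_triangle) (auto simp: case_prod_beta)
      moreover have "(H (fst p) (snd p) - simple_value (L n) (fst p) (snd p))\<^sup>2 =
          (simple_value (L n) (fst p) (snd p) - H (fst p) (snd p))\<^sup>2" for p
        by (rule power2_commute)
      ultimately show ?thesis by (simp only: split_beta')
    qed
    finally show ?thesis
      by (simp add: distrib_left add_right_mono mult_left_mono mult.assoc[symmetric])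
  qed
  moreover have "(\<lambda>n. 4 * ?H + 4 * ?e n + 2 * ?d n) \<longlonglongrightarrow> 4 * ?H + 4 * 0 + 2 * 0"
    by (intro tendsto_add ennreal_tendsto_cmult e d tendsto_const) auto
  ultimately show ?thesis
    by (intro LIMSEQ_le_const[where X="\<lambda>n. 4 * ?H + 4 * ?e n + 2 * ?d n"]) auto
qed

text \<open>Simple integrals have mean zero, so the squared mean of \<open>I\<close> equals that of
  the approximation error and is at most the mean square error, which tends to 0.\<close>

lemma walsh_integral_mean:
  assumes "has_walsh_integral M \<xi> H I"
    and fin: "(\<integral>\<^sup>+(z, \<omega>). ennreal ((H z \<omega>)\<^sup>2) \<partial>(spacetime \<Otimes>\<^sub>M M)) < \<infinity>"
  shows "integrable M (\<lambda>\<omega>. (I \<omega>)\<^sup>2)" "integrable M I" "expectation I = 0"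
proof -
  let ?P = "spacetime \<Otimes>\<^sub>M M"
  from assms obtain L where I[measurable]: "I \<in> borel_measurable M"
    and L: "\<And>n. simple_predictable M \<xi> (L n)"
    and d: "(\<lambda>n. \<integral>\<^sup>+\<omega>. ennreal ((simple_integral \<xi> (L n) \<omega> - I \<omega>)\<^sup>2) \<partial>M) \<longlonglongrightarrow> 0" (is "?d \<longlonglongrightarrow> 0")
    unfolding has_walsh_integral_def by auto
  have "4 * (\<integral>\<^sup>+(z, \<omega>). ennreal ((H z \<omega>)\<^sup>2) \<partial>(spacetime \<Otimes>\<^sub>M M)) < \<infinity>"
    using fin by (simp add: ennreal_mult_less_top)
  then have "(\<integral>\<^sup>+\<omega>. ennreal ((I \<omega>)\<^sup>2) \<partial>M) < \<infinity>"
    using walsh_integral_bound[OF assms(1)] by (rule le_less_trans[rotated])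
  then show I2: "integrable M (\<lambda>\<omega>. (I \<omega>)\<^sup>2)"
    by (simp add: integrable_square_iff)
  then show Ii: "integrable M I"
    by (rule integrable_of_square[OF I])
  have "ennreal ((expectation I)\<^sup>2) \<le> ?d n" for n
  proof (cases "?d n < \<infinity>")
    case True
    note s = simple_isometry[OF L[of n]]
    have [measurable]: "simple_integral \<xi> (L n) \<in> borel_measurable M" using s(1) by simp
    have i: "integrable M (\<lambda>\<omega>. (simple_integral \<xi> (L n) \<omega> - I \<omega>)\<^sup>2)"
      using True by (subst integrable_square_iff) auto
    have "expectation (\<lambda>\<omega>. simple_integral \<xi> (L n) \<omega> - I \<omega>) = - expectation I"
      using s Ii by simp
    then have "(expectation I)\<^sup>2 \<le> expectation (\<lambda>\<omega>. (simple_integral \<xi> (L n) \<omega> - I \<omega>)\<^sup>2)"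
      using expectation_square_le[OF _ i] by simp
    then have "ennreal ((expectation I)\<^sup>2) \<le> ennreal (expectation (\<lambda>\<omega>. (simple_integral \<xi> (L n) \<omega> - I \<omega>)\<^sup>2))"
      by (rule ennreal_leI)
    also have "\<dots> = ?d n" by (rule nn_integral_eq_integral[OF i, symmetric]) auto
    finally show ?thesis .
  qed (simp add: less_top[symmetric])
  then have "ennreal ((expectation I)\<^sup>2) \<le> 0"
    by (intro LIMSEQ_le_const[OF d]) auto
  then show "expectation I = 0" by simp
qed

end

section \<open>Heat kernel estimates\<close>

lemma powr_minus_half_sqrt: "x > 0 \<Longrightarrow> x powr (-1/2) = 1 / sqrt x"
  for x :: real
proof -
  assume "x > 0"
  have "x powr (-1/2) = x powr - (1/2)" by simp
  also have "\<dots> = 1 / sqrt x"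
    unfolding powr_minus using \<open>x > 0\<close> by (subst powr_half_sqrt) (simp_all only: inverse_eq_divide less_imp_le)
  finally show ?thesis .
qed

lemma heat_kernel_normal:
  assumes "\<theta> > 0" "r > 0"
  shows "heat_kernel \<theta> r a = normal_density 0 (sqrt (\<theta> * r)) a"
proof -
  have "(2 * pi * \<theta> * r) powr (-1/2) = 1 / sqrt (2 * pi * (\<theta> * r))"
    using assms by (subst powr_minus_half_sqrt) (simp_all add: mult.assoc)
  then show ?thesis
    using assms by (simp add: heat_kernel_def normal_density_def)
qed

lemma heat_kernel_nonneg [simp]: "heat_kernel \<theta> r a \<ge> 0"
  by (simp add: heat_kernel_def)

lemma heat_kernel_measurable [measurable (raw)]:
  assumes [measurable]: "f \<in> borel_measurable M" "g \<in> borel_measurable M"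
  shows "(\<lambda>x. heat_kernel \<theta> (f x) (g x)) \<in> borel_measurable M"
  unfolding heat_kernel_def by measurable

lemma nn_integral_heat_kernel:
  assumes "\<theta> > 0" "r > 0"
  shows "(\<integral>\<^sup>+x. ennreal (heat_kernel \<theta> r (x - y)) \<partial>lborel) = 1"
proof -
  have "(\<integral>\<^sup>+x. ennreal (heat_kernel \<theta> r (x - y)) \<partial>lborel) = (\<integral>\<^sup>+x. ennreal (normal_density y (sqrt (\<theta> * r)) x) \<partial>lborel)"
    using assms by (simp add: heat_kernel_normal normal_density_def)
  also have "\<dots> = ennreal (LINT x|lborel. normal_density y (sqrt (\<theta> * r)) x)"
    using assms by (intro nn_integral_eq_integral) auto
  finally show ?thesis using assms by simp
qed

lemma heat_kernel_semigroup:
  assumes "\<theta> > 0" "r > 0" "s > 0"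
  shows "(\<integral>\<^sup>+y. ennreal (heat_kernel \<theta> r (x - y)) * ennreal (heat_kernel \<theta> s (y - z)) \<partial>lborel) = ennreal (heat_kernel \<theta> (r + s) (x - z))"
proof -
  have "(\<integral>\<^sup>+y. ennreal (heat_kernel \<theta> r (x - y)) * ennreal (heat_kernel \<theta> s (y - z)) \<partial>lborel)
     = (\<integral>\<^sup>+y. ennreal (heat_kernel \<theta> r (x - z - y) * heat_kernel \<theta> s y) \<partial>lborel)"
    by (subst nn_integral_real_affine[where c=1 and t=z]) (simp_all add: ennreal_mult algebra_simps)
  also have "\<dots> = ennreal (normal_density 0 (sqrt ((sqrt (\<theta> * r))\<^sup>2 + (sqrt (\<theta> * s))\<^sup>2)) (x - z))"
    using assms conv_normal_density_zero_mean[of "sqrt (\<theta> * r)" "sqrt (\<theta> * s)"]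
    by (simp add: heat_kernel_normal fun_eq_iff)
  also have "\<dots> = ennreal (heat_kernel \<theta> (r + s) (x - z))"
    using assms by (simp add: heat_kernel_normal distrib_left)
  finally show ?thesis .
qed

text \<open>Squaring halves the variance, and the prefactor is found by comparing both sides at
  \<open>a = 0\<close>. It carries the time singularity \<open>1 / sqrt r\<close>, which is
  integrable.\<close>

lemma heat_kernel_square:
  assumes "\<theta> > 0" "r > 0"
  shows "(heat_kernel \<theta> r a)\<^sup>2 = 1 / (2 * sqrt (pi * \<theta>)) * (1 / sqrt r) * heat_kernel \<theta> (r / 2) a"
proof -
  have e: "(exp (- a\<^sup>2 / (2 * (\<theta> * r))))\<^sup>2 = exp (- a\<^sup>2 / (\<theta> * r))"
    by (simp add: exp_double[symmetric] power2_eq_square mult_exp_exp)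
  have s: "sqrt (2 * pi * (\<theta> * r)) * sqrt (2 * pi * (\<theta> * r)) = 2 * sqrt (pi * \<theta>) * sqrt r * sqrt (pi * (\<theta> * r))"
  proof -
    have "sqrt (2 * pi * (\<theta> * r)) * sqrt (2 * pi * (\<theta> * r)) = 2 * (pi * \<theta> * r)"
      using assms by simp
    also have "\<dots> = 2 * (sqrt (pi * \<theta> * r) * sqrt (pi * \<theta> * r))"
      using assms by simp
    also have "\<dots> = 2 * sqrt (pi * \<theta>) * sqrt r * sqrt (pi * (\<theta> * r))"
      by (simp add: real_sqrt_mult mult.assoc)
    finally show ?thesis .
  qed
  have "(heat_kernel \<theta> r a)\<^sup>2 = 1 / (sqrt (2 * pi * (\<theta> * r)) * sqrt (2 * pi * (\<theta> * r))) * exp (- a\<^sup>2 / (\<theta> * r))"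
    using assms e by (simp add: heat_kernel_normal normal_density_def power_mult_distrib power_divide power2_eq_square)
  also have "\<dots> = 1 / (2 * sqrt (pi * \<theta>)) * (1 / sqrt r) * (1 / sqrt (pi * (\<theta> * r)) * exp (- a\<^sup>2 / (\<theta> * r)))"
    unfolding s by simp
  also have "1 / sqrt (pi * (\<theta> * r)) * exp (- a\<^sup>2 / (\<theta> * r)) = heat_kernel \<theta> (r / 2) a"
    using assms by (simp add: heat_kernel_normal normal_density_def)
  finally show ?thesis .
qed

text \<open>The parallelogram identity in the exponents. If \<open>a\<close> and \<open>b\<close>
  are the displacements of one point from two others, only the second factor depends on that
  point.\<close>

lemma heat_kernel_mult:
  assumes "\<theta> > 0" "s > 0"
  shows "heat_kernel \<theta> s a * heat_kernel \<theta> s b = heat_kernel \<theta> (2 * s) (a - b) * heat_kernel \<theta> (s / 2) ((a + b) / 2)"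
proof -
  have e: "exp (- a\<^sup>2 / (2 * (\<theta> * s))) * exp (- b\<^sup>2 / (2 * (\<theta> * s))) = exp (- (a - b)\<^sup>2 / (4 * (\<theta> * s))) * exp (- (a + b)\<^sup>2 / (4 * (\<theta> * s)))"
    unfolding exp_add[symmetric]
  proof (rule arg_cong[where f=exp])
    have "\<theta> * s > 0" using assms by simp
    then show "- a\<^sup>2 / (2 * (\<theta> * s)) + - b\<^sup>2 / (2 * (\<theta> * s)) = - (a - b)\<^sup>2 / (4 * (\<theta> * s)) + - (a + b)\<^sup>2 / (4 * (\<theta> * s))"
      by (simp add: divide_simps power2_eq_square) (simp add: algebra_simps)
  qed
  have s: "sqrt (2 * pi * (\<theta> * s)) * sqrt (2 * pi * (\<theta> * s)) = sqrt (4 * pi * (\<theta> * s)) * sqrt (pi * (\<theta> * s))"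
    unfolding real_sqrt_mult[symmetric] by (simp add: algebra_simps)
  have "heat_kernel \<theta> s a * heat_kernel \<theta> s b = 1 / (sqrt (2 * pi * (\<theta> * s)) * sqrt (2 * pi * (\<theta> * s))) * 
      (exp (- a\<^sup>2 / (2 * (\<theta> * s))) * exp (- b\<^sup>2 / (2 * (\<theta> * s))))"
    using assms by (simp add: heat_kernel_normal normal_density_def)
  also have "\<dots> = heat_kernel \<theta> (2 * s) (a - b) * heat_kernel \<theta> (s / 2) ((a + b) / 2)"
    unfolding e s using assms
    by (simp add: heat_kernel_normal normal_density_def power_divide algebra_simps)
  finally show ?thesis .
qed

text \<open>The exponential grows with time, and \<open>sqrt t / sqrt s\<close> is the ratio of the
  normalizing factors.\<close>

lemma heat_kernel_time_mono:
  assumes "\<theta> > 0" "0 < s" "s \<le> t"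
  shows "heat_kernel \<theta> s a \<le> sqrt t / sqrt s * heat_kernel \<theta> t a"
proof -
  have st: "\<theta> * s > 0" "\<theta> * t > 0" "\<theta> * s \<le> \<theta> * t" "t > 0" using assms by auto
  have "exp (- a\<^sup>2 / (2 * (\<theta> * s))) \<le> exp (- a\<^sup>2 / (2 * (\<theta> * t)))"
    using st by (simp add: frac_le)
  then have "heat_kernel \<theta> s a \<le> 1 / sqrt (2 * pi * (\<theta> * s)) * exp (- a\<^sup>2 / (2 * (\<theta> * t)))"
    using assms by (simp add: heat_kernel_normal normal_density_def divide_right_mono)
  also have "\<dots> = sqrt t / sqrt s * heat_kernel \<theta> t a"
    using assms st by (simp add: heat_kernel_normal normal_density_def real_sqrt_mult power_mult_distrib)
  finally show ?thesis .
qed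

section \<open>Time integrals with square root singularities\<close>

lemma nn_integral_inverse_sqrt:
  assumes "t > 0"
  shows "(\<integral>\<^sup>+s\<in>{0<..<t}. ennreal (1 / sqrt s) \<partial>lborel) = ennreal (2 * sqrt t)"
proof -
  have "((\<lambda>s. s powr (-1/2)) has_integral (t powr (1/2) / (1/2))) {0..t}"
    using has_integral_powr_from_0[of "-1/2" t] assms by simp
  then have "((\<lambda>s. s powr (-1/2)) has_integral (2 * sqrt t)) {0<..<t}"
    using assms by (simp add: has_integral_Icc_iff_Ioo powr_half_sqrt mult.commute)
  then have "(\<integral>\<^sup>+s. ennreal (indicator {0<..<t} s * s powr (-1/2)) \<partial>lborel) = ennreal (2 * sqrt t)"
    by (intro nn_integral_has_integral_lebesgue) auto
  also have "(\<integral>\<^sup>+s. ennreal (indicator {0<..<t} s * s powr (-1/2)) \<partial>lborel) = (\<integral>\<^sup>+s\<in>{0<..<t}. ennreal (1 / sqrt s) \<partial>lborel)"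
    by (intro nn_integral_cong) (simp add: indicator_def powr_minus_half_sqrt[simplified])
  finally show ?thesis .
qed

text \<open>The exact value is the Beta integral B(1/2, 1/2) = \<pi>, independent of the interval by
  scaling. The bound uses that one of \<open>t - r\<close> and \<open>r - s\<close> is at least half
  of \<open>t - s\<close>; this gives 4 sqrt 2, rounded up to 6.\<close>

lemma nn_integral_beta_bound:
  assumes st: "(s::real) < t"
  shows "(\<integral>\<^sup>+r\<in>{s<..<t}. ennreal (1 / sqrt (t - r) * (1 / sqrt (r - s))) \<partial>lborel) \<le> 6"
proof -
  define d where "d = t - s"
  have d: "d > 0" using st by (simp add: d_def)
  let ?g = "\<lambda>r. sqrt 2 / sqrt d * (1 / sqrt (t - r) + 1 / sqrt (r - s))"
  have le: "1 / sqrt (t - r) * (1 / sqrt (r - s)) \<le> ?g r" if "s < r" "r < t" for r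
  proof -
    define a b where "a = t - r" and "b = r - s"
    have ab: "a > 0" "b > 0" "d = a + b" using that by (auto simp: a_def b_def d_def)
    have half: "1 / sqrt x \<le> sqrt 2 / sqrt d" if "x \<ge> d / 2" for x
    proof -
      have "x > 0" using that d by simp
      have "sqrt d \<le> sqrt (2 * x)" using that by simp
      then show ?thesis using d \<open>x > 0\<close> by (simp add: divide_simps real_sqrt_mult)
    qed
    have "a \<ge> d / 2 \<or> b \<ge> d / 2" using ab by auto
    then show ?thesis
    proof
      assume "a \<ge> d / 2"
      have "1 / sqrt a * (1 / sqrt b) \<le> sqrt 2 / sqrt d * (1 / sqrt b)"
        by (rule mult_right_mono[OF half[OF \<open>a \<ge> d / 2\<close>]]) (use ab in simp)
      also have "\<dots> \<le> sqrt 2 / sqrt d * (1 / sqrt a + 1 / sqrt b)"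
        by (rule mult_left_mono) (use ab d in auto)
      finally show ?thesis by (simp add: a_def b_def)
    next
      assume "b \<ge> d / 2"
      have "1 / sqrt a * (1 / sqrt b) \<le> 1 / sqrt a * (sqrt 2 / sqrt d)"
        by (rule mult_left_mono[OF half[OF \<open>b \<ge> d / 2\<close>]]) (use ab in simp)
      also have "\<dots> = sqrt 2 / sqrt d * (1 / sqrt a)" by simp
      also have "\<dots> \<le> sqrt 2 / sqrt d * (1 / sqrt a + 1 / sqrt b)"
        by (rule mult_left_mono) (use ab d in auto)
      finally show ?thesis by (simp add: a_def b_def)
    qed
  qed
  have i1: "(\<integral>\<^sup>+r\<in>{s<..<t}. ennreal (1 / sqrt (r - s)) \<partial>lborel) = ennreal (2 * sqrt d)"
  proof -
    have "(\<integral>\<^sup>+r\<in>{s<..<t}. ennreal (1 / sqrt (r - s)) \<partial>lborel) = (\<integral>\<^sup>+r\<in>{0<..<d}. ennreal (1 / sqrt r) \<partial>lborel)"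
      by (subst nn_integral_real_affine[where c=1 and t=s])
        (auto intro!: nn_integral_cong simp: indicator_def d_def)
    then show ?thesis using nn_integral_inverse_sqrt[OF d] by simp
  qed
  have i2: "(\<integral>\<^sup>+r\<in>{s<..<t}. ennreal (1 / sqrt (t - r)) \<partial>lborel) = ennreal (2 * sqrt d)"
  proof -
    have "(\<integral>\<^sup>+r\<in>{s<..<t}. ennreal (1 / sqrt (t - r)) \<partial>lborel) = (\<integral>\<^sup>+r\<in>{0<..<d}. ennreal (1 / sqrt r) \<partial>lborel)"
      by (subst nn_integral_real_affine[where c="-1" and t=t])
        (auto intro!: nn_integral_cong simp: indicator_def d_def)
    then show ?thesis using nn_integral_inverse_sqrt[OF d] by simp
  qed
  have "(\<integral>\<^sup>+r\<in>{s<..<t}. ennreal (1 / sqrt (t - r) * (1 / sqrt (r - s))) \<partial>lborel) \<le>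
     (\<integral>\<^sup>+r. ennreal (sqrt 2 / sqrt d) * (ennreal (1 / sqrt (t - r)) * indicator {s<..<t} r + ennreal (1 / sqrt (r - s)) * indicator {s<..<t} r) \<partial>lborel)"
  proof (rule nn_integral_mono)
    fix r
    show "ennreal (1 / sqrt (t - r) * (1 / sqrt (r - s))) * indicator {s<..<t} r \<le> 
      ennreal (sqrt 2 / sqrt d) * (ennreal (1 / sqrt (t - r)) * indicator {s<..<t} r + ennreal (1 / sqrt (r - s)) * indicator {s<..<t} r)"
    proof (cases "s < r \<and> r < t")
      case True
      then have "ennreal (1 / sqrt (t - r) * (1 / sqrt (r - s))) \<le> ennreal (?g r)"
        by (intro ennreal_leI le) auto
      also have "\<dots> = ennreal (sqrt 2 / sqrt d) * (ennreal (1 / sqrt (t - r)) + ennreal (1 / sqrt (r - s)))"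
        using True d by (subst ennreal_mult) (auto simp: ennreal_plus)
      finally show ?thesis using True by simp
    qed simp
  qed
  also have "\<dots> = ennreal (sqrt 2 / sqrt d) * (ennreal (2 * sqrt d) + ennreal (2 * sqrt d))"
    by (simp add: nn_integral_cmult nn_integral_add i1 i2)
  also have "\<dots> = ennreal (4 * sqrt 2)"
    using d by (simp add: ennreal_plus[symmetric] ennreal_mult'[symmetric] del: ennreal_plus)
  also have "\<dots> \<le> ennreal 6"
  proof (rule ennreal_leI)
    have "sqrt 2 \<le> 3/2" by (rule real_le_lsqrt) (auto simp: power2_eq_square)
    then show "4 * sqrt 2 \<le> (6::real)" by simp
  qed
  finally show ?thesis by simp
qed

section \<open>Space-time convolution with the squared heat kernel\<close>

definition st_kernel :: "real \<Rightarrow> real \<times> real \<Rightarrow> real \<times> real \<Rightarrow> ennreal" where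
  "st_kernel \<theta> p z = (if 0 < fst z \<and> fst z < fst p
     then ennreal ((heat_kernel \<theta> (fst p - fst z) (snd p - snd z))\<^sup>2) else 0)"

text \<open>The operator K of the overview. The restriction of times sits in
  \<open>st_kernel\<close>, so the integral runs over a fixed domain and Tonelli applies directly to
  iterates.\<close>

definition st_conv :: "real \<Rightarrow> (real \<times> real \<Rightarrow> ennreal) \<Rightarrow> real \<times> real \<Rightarrow> ennreal" where
  "st_conv \<theta> f p = (\<integral>\<^sup>+z. st_kernel \<theta> p z * f z \<partial>lborel)"

lemma borel_measurable_fst_snd [measurable]:
  "fst \<in> borel_measurable (borel :: (real \<times> real) measure)" "snd \<in> borel_measurable (borel :: (real \<times> real) measure)"
  unfolding borel_prod[symmetric] by auto

lemma st_kernel_measurable [measurable (raw)]: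
  assumes [measurable]: "f \<in> measurable M (borel :: (real \<times> real) measure)" "g \<in> measurable M (borel :: (real \<times> real) measure)"
  shows "(\<lambda>x. st_kernel \<theta> (f x) (g x)) \<in> borel_measurable M"
proof -
  have [measurable]: "(\<lambda>x. fst (f x)) \<in> borel_measurable M" "(\<lambda>x. snd (f x)) \<in> borel_measurable M"
    "(\<lambda>x. fst (g x)) \<in> borel_measurable M" "(\<lambda>x. snd (g x)) \<in> borel_measurable M"
    by (rule measurable_compose[OF assms(1)] measurable_compose[OF assms(2)], simp)+
  show ?thesis unfolding st_kernel_def by measurable
qed

lemma st_conv_measurable [measurable]:
  assumes [measurable]: "f \<in> borel_measurable borel"
  shows "st_conv \<theta> f \<in> borel_measurable borel"
  unfolding st_conv_def by measurable

lemma st_conv_iterated: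
  assumes [measurable]: "f \<in> borel_measurable borel"
  shows "st_conv \<theta> f (t, x) = 
    (\<integral>\<^sup>+s\<in>{0<..<t}. (\<integral>\<^sup>+y. ennreal ((heat_kernel \<theta> (t - s) (x - y))\<^sup>2) * f (s, y) \<partial>lborel) \<partial>lborel)"
proof -
  have [measurable]: "f \<in> borel_measurable (borel \<Otimes>\<^sub>M borel)"
    unfolding borel_prod by simp
  have "st_conv \<theta> f (t, x) = (\<integral>\<^sup>+z. st_kernel \<theta> (t, x) z * f z \<partial>(lborel \<Otimes>\<^sub>M lborel))"
    unfolding st_conv_def lborel_prod ..
  also have "\<dots> = (\<integral>\<^sup>+s. (\<integral>\<^sup>+y. st_kernel \<theta> (t, x) (s, y) * f (s, y) \<partial>lborel) \<partial>lborel)"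
    by (rule lborel.nn_integral_fst[symmetric]) (simp add: lborel_prod)
  also have "\<dots> = (\<integral>\<^sup>+s\<in>{0<..<t}. (\<integral>\<^sup>+y. ennreal ((heat_kernel \<theta> (t - s) (x - y))\<^sup>2) * f (s, y) \<partial>lborel) \<partial>lborel)"
    by (intro nn_integral_cong) (auto simp: st_kernel_def indicator_def)
  finally show ?thesis .
qed

lemma st_conv_mono:
  "(\<And>z. 0 < fst z \<Longrightarrow> fst z < fst p \<Longrightarrow> f z \<le> g z) \<Longrightarrow> st_conv \<theta> f p \<le> st_conv \<theta> g p"
  unfolding st_conv_def st_kernel_def by (intro nn_integral_mono) (auto intro: mult_left_mono)

lemma st_conv_add:
  assumes [measurable]: "f \<in> borel_measurable borel" "g \<in> borel_measurable borel"
  shows "st_conv \<theta> (\<lambda>z. f z + g z) p = st_conv \<theta> f p + st_conv \<theta> g p"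
  unfolding st_conv_def by (subst nn_integral_add[symmetric]) (auto simp: distrib_left)

lemma st_conv_cmult:
  assumes [measurable]: "f \<in> borel_measurable borel"
  shows "st_conv \<theta> (\<lambda>z. C * f z) p = C * st_conv \<theta> f p"
  unfolding st_conv_def by (subst nn_integral_cmult[symmetric]) (auto simp: ac_simps)

text \<open>The squared kernel lives at time \<open>r / 2\<close>. Giving the other factor time
  \<open>s / 2\<close> lets the semigroup property produce a kernel depending on
  \<open>r + s\<close> only, up to the singular factor.\<close>

lemma heat_kernel_square_conv:
  assumes \<theta>: "\<theta> > 0" and rs: "r > 0" "s > 0"
  shows "(\<integral>\<^sup>+y. ennreal ((heat_kernel \<theta> r (x - y))\<^sup>2) * ennreal (heat_kernel \<theta> (s / 2) (y - z)) \<partial>lborel) =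
    ennreal (1 / (2 * sqrt (pi * \<theta>)) * (1 / sqrt r) * heat_kernel \<theta> ((r + s) / 2) (x - z))"
proof -
  let ?c = "1 / (2 * sqrt (pi * \<theta>)) * (1 / sqrt r)"
  have c: "?c \<ge> 0" using \<theta> rs by simp
  have "(\<integral>\<^sup>+y. ennreal ((heat_kernel \<theta> r (x - y))\<^sup>2) * ennreal (heat_kernel \<theta> (s / 2) (y - z)) \<partial>lborel) =
    (\<integral>\<^sup>+y. ennreal ?c * (ennreal (heat_kernel \<theta> (r / 2) (x - y)) * ennreal (heat_kernel \<theta> (s / 2) (y - z))) \<partial>lborel)"
    unfolding heat_kernel_square[OF \<theta> rs(1)] ennreal_mult'[OF c] by (simp only: mult.assoc)
  also have "\<dots> = ennreal ?c * ennreal (heat_kernel \<theta> (r / 2 + s / 2) (x - z))"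
    using \<theta> rs by (subst nn_integral_cmult) (simp_all add: heat_kernel_semigroup)
  finally show ?thesis
    using c by (simp only: ennreal_mult'[symmetric] add_divide_distrib)
qed

text \<open>Once both squares are written as kernels at half time, the spatial integral is a
  semigroup identity whose kernel is free of the intermediate time, and a Beta integral in time
  remains. Turning that kernel back into a square yields the factor
  \<open>sqrt (fst p - fst w)\<close>, which makes the composition small over short times.\<close>

lemma st_kernel_comp:
  assumes \<theta>: "\<theta> > 0"
  shows "(\<integral>\<^sup>+z. st_kernel \<theta> p z * st_kernel \<theta> z w \<partial>lborel) \<le>
    ennreal (3 / sqrt (pi * \<theta>) * sqrt (fst p - fst w)) * st_kernel \<theta> p w"
proof -
  obtain t x s y where p: "p = (t, x)" and w: "w = (s, y)" by fastforce
  define c where "c = 1 / (2 * sqrt (pi * \<theta>))"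
  have c: "c > 0" using \<theta> by (simp add: c_def)
  show ?thesis
  proof (cases "0 < s \<and> s < t")
    case False
    then have "st_kernel \<theta> p z * st_kernel \<theta> z w = 0" for z
      unfolding st_kernel_def p w by auto
    then show ?thesis by (simp only: nn_integral_const mult_zero_left zero_le)
  next
    case True
    let ?q = "heat_kernel \<theta> ((t - s) / 2) (x - y)"
    have "(\<integral>\<^sup>+z. st_kernel \<theta> p z * st_kernel \<theta> z w \<partial>lborel) = 
      (\<integral>\<^sup>+r\<in>{0<..<t}. (\<integral>\<^sup>+v. ennreal ((heat_kernel \<theta> (t - r) (x - v))\<^sup>2) * st_kernel \<theta> (r, v) w \<partial>lborel) \<partial>lborel)"
      using st_conv_iterated[of "\<lambda>z. st_kernel \<theta> z w" \<theta> t x] by (simp add: st_conv_def p)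
    also have "\<dots> \<le> (\<integral>\<^sup>+r. ennreal (c\<^sup>2 * ?q) * (ennreal (1 / sqrt (t - r) * (1 / sqrt (r - s))) * indicator {s<..<t} r) \<partial>lborel)"
    proof (rule nn_integral_mono)
      fix r
      show "(\<integral>\<^sup>+v. ennreal ((heat_kernel \<theta> (t - r) (x - v))\<^sup>2) * st_kernel \<theta> (r, v) w \<partial>lborel) * indicator {0<..<t} r
        \<le> ennreal (c\<^sup>2 * ?q) * (ennreal (1 / sqrt (t - r) * (1 / sqrt (r - s))) * indicator {s<..<t} r)"
      proof (cases "s < r \<and> r < t")
        case rst: True
        define d where "d = c * (1 / sqrt (r - s))"
        have d: "d \<ge> 0" using c rst by (simp add: d_def)
        have "(\<integral>\<^sup>+v. ennreal ((heat_kernel \<theta> (t - r) (x - v))\<^sup>2) * st_kernel \<theta> (r, v) w \<partial>lborel)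
          = (\<integral>\<^sup>+v. ennreal d * (ennreal ((heat_kernel \<theta> (t - r) (x - v))\<^sup>2) * ennreal (heat_kernel \<theta> ((r - s) / 2) (v - y))) \<partial>lborel)"
        proof (rule nn_integral_cong)
          fix v
          have "st_kernel \<theta> (r, v) w = ennreal ((heat_kernel \<theta> (r - s) (v - y))\<^sup>2)"
            using True rst by (simp add: st_kernel_def w)
          also have "(heat_kernel \<theta> (r - s) (v - y))\<^sup>2 = d * heat_kernel \<theta> ((r - s) / 2) (v - y)"
            using heat_kernel_square[OF \<theta>, of "r - s"] rst by (simp add: d_def c_def)
          finally show "ennreal ((heat_kernel \<theta> (t - r) (x - v))\<^sup>2) * st_kernel \<theta> (r, v) w = 
            ennreal d * (ennreal ((heat_kernel \<theta> (t - r) (x - v))\<^sup>2) * ennreal (heat_kernel \<theta> ((r - s) / 2) (v - y)))"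
            using d by (simp add: ennreal_mult' ac_simps)
        qed
        also have "\<dots> = ennreal d * ennreal (c * (1 / sqrt (t - r)) * heat_kernel \<theta> ((t - r + (r - s)) / 2) (x - y))"
          unfolding c_def using heat_kernel_square_conv[OF \<theta>, of "t - r" "r - s" x y] rst
          by (subst nn_integral_cmult) auto
        also have "\<dots> = ennreal (d * (c * (1 / sqrt (t - r)) * heat_kernel \<theta> ((t - r + (r - s)) / 2) (x - y)))"
          by (rule ennreal_mult'[OF d, symmetric])
        also have "d * (c * (1 / sqrt (t - r)) * heat_kernel \<theta> ((t - r + (r - s)) / 2) (x - y))
          = (c\<^sup>2 * ?q) * (1 / sqrt (t - r) * (1 / sqrt (r - s)))"
          by (simp add: d_def power2_eq_square ac_simps)
        also have "ennreal \<dots> = ennreal (c\<^sup>2 * ?q) * ennreal (1 / sqrt (t - r) * (1 / sqrt (r - s)))"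
          using rst by (intro ennreal_mult) auto
        finally show ?thesis using True rst by simp
      next
        case False
        have "st_kernel \<theta> (r, v) w * indicator {0<..<t} r = 0" for v
          using False unfolding st_kernel_def w by (auto simp: indicator_def)
        then show ?thesis
          by (cases "0 < r \<and> r < t") auto
      qed
    qed
    also have "\<dots> \<le> ennreal (c\<^sup>2 * ?q) * 6"
      using True nn_integral_beta_bound[of s t] by (subst nn_integral_cmult) (auto intro!: mult_left_mono)
    also have "\<dots> = ennreal (6 * c\<^sup>2 * ?q)"
      by (subst ennreal_mult''[symmetric, of 6, simplified]) (auto simp: mult.commute)
    \<comment> \<open>The square formula is inverted at time \<open>t - s\<close>, which trades one
      factor \<open>c\<close> for \<open>sqrt (t - s)\<close>; the remaining \<open>6 * c\<close> is
      \<open>3 / sqrt (pi * \<theta>)\<close>.\<close>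
    also have "6 * c\<^sup>2 * ?q = 3 / sqrt (pi * \<theta>) * sqrt (t - s) * (heat_kernel \<theta> (t - s) (x - y))\<^sup>2"
      using True \<theta> by (subst heat_kernel_square) (auto simp: c_def power2_eq_square)
    also have "ennreal \<dots> = ennreal (3 / sqrt (pi * \<theta>) * sqrt (fst p - fst w)) * st_kernel \<theta> p w"
      using True \<theta> by (subst ennreal_mult) (simp_all add: st_kernel_def p w)
    finally show ?thesis .
  qed
qed

text \<open>Tonelli reduces the claim to \<open>st_kernel_comp\<close>. As \<open>f\<close> lives
  after time \<open>T\<close>, only elapsed times below \<tau> occur, so the factor is small however
  large \<open>T\<close> is.\<close>

lemma st_conv_st_conv:
  assumes \<theta>: "\<theta> > 0" and f[measurable]: "f \<in> borel_measurable borel"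
    and supp: "\<And>z. fst z \<le> T \<Longrightarrow> f z = 0" and p: "fst p \<le> T + \<tau>"
  shows "st_conv \<theta> (st_conv \<theta> f) p \<le> ennreal (3 / sqrt (pi * \<theta>) * sqrt \<tau>) * st_conv \<theta> f p"
proof -
  have P: "pair_sigma_finite (lborel :: (real \<times> real) measure) (lborel :: (real \<times> real) measure)" ..
  have "st_conv \<theta> (st_conv \<theta> f) p = (\<integral>\<^sup>+z. (\<integral>\<^sup>+w. st_kernel \<theta> p z * st_kernel \<theta> z w * f w \<partial>lborel) \<partial>lborel)"
    unfolding st_conv_def by (simp add: nn_integral_cmult[symmetric] mult.assoc)
  also have "\<dots> = (\<integral>\<^sup>+w. (\<integral>\<^sup>+z. st_kernel \<theta> p z * st_kernel \<theta> z w * f w \<partial>lborel) \<partial>lborel)"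
    by (rule pair_sigma_finite.Fubini'[OF P, symmetric]) simp
  also have "\<dots> = (\<integral>\<^sup>+w. (\<integral>\<^sup>+z. st_kernel \<theta> p z * st_kernel \<theta> z w \<partial>lborel) * f w \<partial>lborel)"
    by (simp add: nn_integral_multc)
  also have "\<dots> \<le> (\<integral>\<^sup>+w. ennreal (3 / sqrt (pi * \<theta>) * sqrt \<tau>) * (st_kernel \<theta> p w * f w) \<partial>lborel)"
  proof (rule nn_integral_mono)
    fix w
    show "(\<integral>\<^sup>+z. st_kernel \<theta> p z * st_kernel \<theta> z w \<partial>lborel) * f w \<le> ennreal (3 / sqrt (pi * \<theta>) * sqrt \<tau>) * (st_kernel \<theta> p w * f w)"
    proof (cases "fst w \<le> T")
      case False
      have "(\<integral>\<^sup>+z. st_kernel \<theta> p z * st_kernel \<theta> z w \<partial>lborel) \<le> ennreal (3 / sqrt (pi * \<theta>) * sqrt (fst p - fst w)) * st_kernel \<theta> p w"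
        by (rule st_kernel_comp[OF \<theta>])
      also have "\<dots> \<le> ennreal (3 / sqrt (pi * \<theta>) * sqrt \<tau>) * st_kernel \<theta> p w"
        using False p \<theta> by (intro mult_right_mono ennreal_leI mult_left_mono) auto
      finally show ?thesis
        by (simp add: mult_right_mono mult.assoc[symmetric])
    qed (simp add: supp)
  qed
  also have "\<dots> = ennreal (3 / sqrt (pi * \<theta>) * sqrt \<tau>) * st_conv \<theta> f p"
    unfolding st_conv_def by (rule nn_integral_cmult) simp
  finally show ?thesis .
qed

section \<open>The heat flow of the initial measure\<close>

definition heat_flow :: "real \<Rightarrow> real measure \<Rightarrow> real \<times> real \<Rightarrow> ennreal" where
  "heat_flow \<theta> u\<^sub>0 p = (\<integral>\<^sup>+a. ennreal (heat_kernel \<theta> (fst p) (snd p - a)) \<partial>u\<^sub>0)"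

text \<open>The bilinear form of the reproduction of J^2. The product of kernels splits into one at
  time \<open>2 * s\<close> between \<open>a\<close> and \<open>b\<close> and one at time
  \<open>s / 2\<close> around their midpoint \<open>m\<close>. Convolving the latter with the
  squared kernel gives time \<open>t / 2\<close>, whatever \<open>s\<close> is; the former is
  compared with time \<open>2 * t\<close>, and the two recombine into the product at time
  \<open>t\<close>.\<close>

lemma st_kernel_heat_product:
  assumes \<theta>: "\<theta> > 0" and t: "t > 0"
  shows "(\<integral>\<^sup>+z. st_kernel \<theta> (t, x) z * ennreal (heat_kernel \<theta> (fst z) (snd z - a) * heat_kernel \<theta> (fst z) (snd z - b)) \<partial>lborel)
    \<le> ennreal (3 / sqrt (pi * \<theta>) * sqrt t) * ennreal (heat_kernel \<theta> t (x - a) * heat_kernel \<theta> t (x - b))"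
proof -
  define c where "c = 1 / (2 * sqrt (pi * \<theta>))"
  have c: "c > 0" using \<theta> by (simp add: c_def)
  let ?P = "heat_kernel \<theta> t (x - a) * heat_kernel \<theta> t (x - b)"
  define m where "m = (a + b) / 2"
  have P: "?P = heat_kernel \<theta> (2 * t) (b - a) * heat_kernel \<theta> (t / 2) (x - m)"
    using heat_kernel_mult[OF \<theta> t, of "x - a" "x - b"] by (simp add: m_def field_simps)
  have "(\<integral>\<^sup>+z. st_kernel \<theta> (t, x) z * ennreal (heat_kernel \<theta> (fst z) (snd z - a) * heat_kernel \<theta> (fst z) (snd z - b)) \<partial>lborel)
    = (\<integral>\<^sup>+s\<in>{0<..<t}. (\<integral>\<^sup>+y. ennreal ((heat_kernel \<theta> (t - s) (x - y))\<^sup>2) * ennreal (heat_kernel \<theta> s (y - a) * heat_kernel \<theta> s (y - b)) \<partial>lborel) \<partial>lborel)"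
    using st_conv_iterated[of "\<lambda>z. ennreal (heat_kernel \<theta> (fst z) (snd z - a) * heat_kernel \<theta> (fst z) (snd z - b))" \<theta> t x] 
    by (simp add: st_conv_def)
  also have "\<dots> \<le> (\<integral>\<^sup>+s. ennreal (c * sqrt t * ?P) * (ennreal (1 / sqrt (t - s) * (1 / sqrt (s - 0))) * indicator {0<..<t} s) \<partial>lborel)"
  proof (rule nn_integral_mono)
    fix s
    show "(\<integral>\<^sup>+y. ennreal ((heat_kernel \<theta> (t - s) (x - y))\<^sup>2) * ennreal (heat_kernel \<theta> s (y - a) * heat_kernel \<theta> s (y - b)) \<partial>lborel) * indicator {0<..<t} s 
      \<le> ennreal (c * sqrt t * ?P) * (ennreal (1 / sqrt (t - s) * (1 / sqrt (s - 0))) * indicator {0<..<t} s)"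
    proof (cases "0 < s \<and> s < t")
      case True
      let ?p = "heat_kernel \<theta> (2 * s) (b - a)"
      have "heat_kernel \<theta> s (y - a) * heat_kernel \<theta> s (y - b) = ?p * heat_kernel \<theta> (s / 2) (y - m)" for y
        using heat_kernel_mult[OF \<theta>, of s "y - a" "y - b"] True by (simp add: m_def field_simps)
      then have "(\<integral>\<^sup>+y. ennreal ((heat_kernel \<theta> (t - s) (x - y))\<^sup>2) * ennreal (heat_kernel \<theta> s (y - a) * heat_kernel \<theta> s (y - b)) \<partial>lborel)
        = (\<integral>\<^sup>+y. ennreal ?p * (ennreal ((heat_kernel \<theta> (t - s) (x - y))\<^sup>2) * ennreal (heat_kernel \<theta> (s / 2) (y - m))) \<partial>lborel)"
        by (simp add: ennreal_mult ac_simps)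
      also have "\<dots> = ennreal ?p * ennreal (c * (1 / sqrt (t - s)) * heat_kernel \<theta> ((t - s + s) / 2) (x - m))"
        unfolding c_def using heat_kernel_square_conv[OF \<theta>, of "t - s" s x m] True
        by (subst nn_integral_cmult) auto
      also have "\<dots> = ennreal (?p * (c * (1 / sqrt (t - s)) * heat_kernel \<theta> (t / 2) (x - m)))"
        by (subst ennreal_mult'[symmetric]) simp_all
      \<comment> \<open>The loss \<open>sqrt t / sqrt s\<close> from monotonicity in time supplies
        the second singularity of the Beta integral.\<close>
      also have "\<dots> \<le> ennreal ((sqrt t / sqrt s * heat_kernel \<theta> (2 * t) (b - a)) * (c * (1 / sqrt (t - s)) * heat_kernel \<theta> (t / 2) (x - m)))"
      proof (intro ennreal_leI mult_right_mono)
        show "?p \<le> sqrt t / sqrt s * heat_kernel \<theta> (2 * t) (b - a)"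
          using heat_kernel_time_mono[OF \<theta>, of "2 * s" "2 * t" "b - a"] True by (simp add: real_sqrt_mult)
      qed (use c True in auto)
      also have "\<dots> = ennreal ((c * sqrt t * ?P) * (1 / sqrt (t - s) * (1 / sqrt (s - 0))))"
        unfolding P by (simp add: ac_simps)
      also have "\<dots> = ennreal (c * sqrt t * ?P) * ennreal (1 / sqrt (t - s) * (1 / sqrt (s - 0)))"
        using c t by (intro ennreal_mult') auto
      finally show ?thesis using True by simp
    qed auto
  qed
  also have "\<dots> \<le> ennreal (c * sqrt t * ?P) * 6"
    using t nn_integral_beta_bound[of 0 t] by (subst nn_integral_cmult) (auto intro!: mult_left_mono)
  also have "\<dots> = ennreal (6 * c * sqrt t * ?P)"
    by (subst ennreal_mult''[symmetric, of 6, simplified]) (auto simp: ac_simps)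
  also have "6 * c * sqrt t * ?P = 3 / sqrt (pi * \<theta>) * sqrt t * ?P"
    by (simp add: c_def)
  also have "ennreal \<dots> = ennreal (3 / sqrt (pi * \<theta>) * sqrt t) * ennreal ?P"
    using \<theta> t by (intro ennreal_mult') auto
  finally show ?thesis .
qed

lemma heat_flow_measurable [measurable]:
  assumes "sigma_finite_measure u\<^sub>0" and [measurable_cong]: "sets u\<^sub>0 = sets borel"
  shows "heat_flow \<theta> u\<^sub>0 \<in> borel_measurable borel"
proof -
  interpret sigma_finite_measure u\<^sub>0 by fact
  show ?thesis unfolding heat_flow_def by measurable
qed

text \<open>Conservation of mass, in a form that includes an infinite initial mass.\<close>

lemma nn_integral_heat_flow:
  assumes \<theta>: "\<theta> > 0" and t: "t > 0" and "sigma_finite_measure u\<^sub>0" and [measurable_cong]: "sets u\<^sub>0 = sets borel"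
  shows "(\<integral>\<^sup>+x. heat_flow \<theta> u\<^sub>0 (t, x) \<partial>lborel) = emeasure u\<^sub>0 (space u\<^sub>0)"
proof -
  interpret sigma_finite_measure u\<^sub>0 by fact
  interpret P: pair_sigma_finite u\<^sub>0 "lborel :: real measure" ..
  have "(\<integral>\<^sup>+x. heat_flow \<theta> u\<^sub>0 (t, x) \<partial>lborel) = (\<integral>\<^sup>+a. (\<integral>\<^sup>+x. ennreal (heat_kernel \<theta> t (x - a)) \<partial>lborel) \<partial>u\<^sub>0)"
    unfolding heat_flow_def fst_conv snd_conv by (rule P.Fubini') simp
  also have "\<dots> = emeasure u\<^sub>0 (space u\<^sub>0)"
    by (simp add: nn_integral_heat_kernel[OF \<theta> t])
  finally show ?thesis .
qed

text \<open>The square is a double integral of kernel products over \<open>u\<^sub>0\<close>;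
  Tonelli moves the space-time integral inside, where the bound for fixed \<open>a\<close> and
  \<open>b\<close> applies.\<close>

lemma st_conv_heat_flow_square:
  assumes \<theta>: "\<theta> > 0" and t: "t > 0" and "sigma_finite_measure u\<^sub>0" and [measurable_cong]: "sets u\<^sub>0 = sets borel"
  shows "st_conv \<theta> (\<lambda>z. (heat_flow \<theta> u\<^sub>0 z)\<^sup>2) (t, x) \<le> ennreal (3 / sqrt (pi * \<theta>) * sqrt t) * (heat_flow \<theta> u\<^sub>0 (t, x))\<^sup>2"
proof -
  interpret sigma_finite_measure u\<^sub>0 by fact
  interpret P: pair_sigma_finite u\<^sub>0 "lborel :: (real \<times> real) measure" ..
  let ?C = "ennreal (3 / sqrt (pi * \<theta>) * sqrt t)"
  let ?q = "\<lambda>z a b. ennreal (heat_kernel \<theta> (fst z) (snd z - a) * heat_kernel \<theta> (fst z) (snd z - b))"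
  have sq: "(heat_flow \<theta> u\<^sub>0 z)\<^sup>2 = (\<integral>\<^sup>+a. (\<integral>\<^sup>+b. ?q z a b \<partial>u\<^sub>0) \<partial>u\<^sub>0)" for z
    by (simp add: heat_flow_def power2_eq_square ennreal_mult nn_integral_cmult nn_integral_multc)
  have "st_conv \<theta> (\<lambda>z. (heat_flow \<theta> u\<^sub>0 z)\<^sup>2) (t, x) = (\<integral>\<^sup>+z. (\<integral>\<^sup>+a. (\<integral>\<^sup>+b. st_kernel \<theta> (t, x) z * ?q z a b \<partial>u\<^sub>0) \<partial>u\<^sub>0) \<partial>lborel)"
    unfolding st_conv_def sq by (simp add: nn_integral_cmult)
  also have "\<dots> = (\<integral>\<^sup>+a. (\<integral>\<^sup>+z. (\<integral>\<^sup>+b. st_kernel \<theta> (t, x) z * ?q z a b \<partial>u\<^sub>0) \<partial>lborel) \<partial>u\<^sub>0)"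
    by (rule P.Fubini') simp
  also have "\<dots> = (\<integral>\<^sup>+a. (\<integral>\<^sup>+b. (\<integral>\<^sup>+z. st_kernel \<theta> (t, x) z * ?q z a b \<partial>lborel) \<partial>u\<^sub>0) \<partial>u\<^sub>0)"
    by (intro nn_integral_cong P.Fubini') simp
  also have "\<dots> \<le> (\<integral>\<^sup>+a. (\<integral>\<^sup>+b. ?C * ?q (t, x) a b \<partial>u\<^sub>0) \<partial>u\<^sub>0)"
    using st_kernel_heat_product[OF \<theta> t] by (intro nn_integral_mono) simp
  also have "\<dots> = ?C * (heat_flow \<theta> u\<^sub>0 (t, x))\<^sup>2"
    unfolding sq by (simp add: nn_integral_cmult)
  finally show ?thesis .
qed

section \<open>Absorption in the Volterra inequality\<close>

lemma ennreal_absorb_half: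
  fixes h a b :: ennreal
  assumes "h \<le> a + b * h" "h < \<infinity>" "b \<le> ennreal (1 / 2)"
  shows "h \<le> 2 * a"
proof (cases "a = \<infinity>")
  case True
  then show ?thesis by (simp add: ennreal_mult_top)
next
  case False
  then obtain a' where a: "a = ennreal a'" "a' \<ge> 0" by (cases a rule: ennreal_cases) auto
  \<comment> \<open>Finiteness is what permits subtracting half of \<open>h\<close>: an infinite
    \<open>h\<close> would satisfy the first assumption for every positive \<open>b\<close>.\<close>
  from assms(2) obtain h' where h: "h = ennreal h'" "h' \<ge> 0" by (cases h rule: ennreal_cases) auto
  have "h \<le> a + ennreal (1 / 2) * h"
    using assms(1) mult_right_mono[OF assms(3) zero_le, of h] 
    by (meson add_left_mono order_trans)
  also have "a + ennreal (1 / 2) * h = ennreal a' + ennreal (1 / 2 * h')"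
    unfolding a(1) h(1) by (subst ennreal_mult') simp_all
  also have "\<dots> = ennreal (a' + 1 / 2 * h')"
    using a h by (simp add: ennreal_plus)
  finally have "ennreal h' \<le> ennreal (a' + 1 / 2 * h')"
    using h by simp
  then have "h' \<le> 2 * a'"
    using a h by (subst (asm) ennreal_le_iff) auto
  then show ?thesis
    using a h by (simp add: ennreal_mult'[symmetric] ennreal_leI flip: ennreal_numeral)
qed

text \<open>Induction over windows of fixed length \<tau>. What is already bounded before the window
  enters as a multiple of the squared heat flow, and the part of the convolution coming from the
  window itself is absorbed. The constant may grow with each window, but finitely many windows reach
  \<open>T\<close>.\<close>

lemma volterra_heat_bound:
  assumes \<theta>: "\<theta> > 0" and u0: "sigma_finite_measure u\<^sub>0" "sets u\<^sub>0 = sets borel"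
    and f[measurable]: "f \<in> borel_measurable borel" 
    and supp: "\<And>z. fst z \<le> 0 \<Longrightarrow> f z = 0"
    and AB: "A < \<infinity>" "B < \<infinity>"
    and le: "\<And>z. fst z > 0 \<Longrightarrow> f z \<le> A * (heat_flow \<theta> u\<^sub>0 z)\<^sup>2 + B * st_conv \<theta> f z"
    and fin: "\<And>z. fst z > 0 \<Longrightarrow> st_conv \<theta> f z < \<infinity>"
  shows "\<exists>C<\<infinity>. \<forall>z. 0 < fst z \<and> fst z \<le> T \<longrightarrow> f z \<le> C * (heat_flow \<theta> u\<^sub>0 z)\<^sup>2"
proof -
  let ?J = "\<lambda>z. (heat_flow \<theta> u\<^sub>0 z)\<^sup>2"
  note [measurable] = heat_flow_measurable[OF u0]
  define \<kappa> where "\<kappa> = 3 / sqrt (pi * \<theta>)"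
  have \<kappa>: "\<kappa> > 0" using \<theta> by (simp add: \<kappa>_def)
  obtain B' where B': "B = ennreal B'" "B' \<ge> 0" using AB(2) by (cases B rule: ennreal_cases) auto
  \<comment> \<open>Chosen so that \<open>B' * (\<kappa> * sqrt \<tau>)\<close> equals
    \<open>B' / (2 * (B' + 1))\<close>; the added 1 covers \<open>B' = 0\<close>.\<close>
  define \<tau> where "\<tau> = (1 / (2 * \<kappa> * (B' + 1)))\<^sup>2"
  have \<tau>: "\<tau> > 0" "B * ennreal (\<kappa> * sqrt \<tau>) \<le> ennreal (1 / 2)"
  proof -
    show "\<tau> > 0" using \<kappa> B' by (simp add: \<tau>_def)
    have "B * ennreal (\<kappa> * sqrt \<tau>) = ennreal (B' * (\<kappa> * sqrt \<tau>))"
      using B' by (simp add: ennreal_mult')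
    also have "B' * (\<kappa> * sqrt \<tau>) = B' / (2 * (B' + 1))"
      using \<kappa> B' by (simp add: \<tau>_def)
    also have "ennreal (B' / (2 * (B' + 1))) \<le> ennreal (1 / 2)"
      using B' by (intro ennreal_leI) (simp add: divide_simps)
    finally show "B * ennreal (\<kappa> * sqrt \<tau>) \<le> ennreal (1 / 2)" .
  qed
  have J: "st_conv \<theta> ?J z \<le> ennreal (\<kappa> * sqrt S) * ?J z" if "fst z > 0" "fst z \<le> S" for z S
  proof -
    have "st_conv \<theta> ?J z \<le> ennreal (\<kappa> * sqrt (fst z)) * ?J z"
      using st_conv_heat_flow_square[OF \<theta> that(1) u0, of "snd z"] by (simp add: \<kappa>_def)
    also have "\<dots> \<le> ennreal (\<kappa> * sqrt S) * ?J z"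
      using that \<kappa> by (intro mult_right_mono ennreal_leI) auto
    finally show ?thesis .
  qed
  have "\<exists>C<\<infinity>. \<forall>z. 0 < fst z \<and> fst z \<le> real n * \<tau> \<longrightarrow> f z \<le> C * ?J z" for n
  proof (induction n)
    case 0
    show ?case by (intro exI[of _ 0]) auto
  next
    case (Suc n)
    then obtain C where C: "C < \<infinity>" "\<And>z. 0 < fst z \<Longrightarrow> fst z \<le> real n * \<tau> \<Longrightarrow> f z \<le> C * ?J z"
      by blast
    define S where "S = real n * \<tau>"
    have S: "real (Suc n) * \<tau> = S + \<tau>" "S \<ge> 0" using \<tau> by (simp_all add: S_def algebra_simps)
    \<comment> \<open>The induction hypothesis bounds \<open>f0\<close>, while \<open>f1\<close>
      vanishes up to time \<open>S\<close>, as the short-window estimate requires.\<close>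
    define f0 where "f0 = (\<lambda>z. f z * indicator {z. fst z \<le> S} z)"
    define f1 where "f1 = (\<lambda>z. f z * indicator {z. S < fst z} z)"
    have [measurable]: "f0 \<in> borel_measurable borel" "f1 \<in> borel_measurable borel"
      unfolding f0_def f1_def by measurable
    have split: "f = (\<lambda>z. f0 z + f1 z)"
      by (auto simp: f0_def f1_def indicator_def)
    let ?K = "ennreal (\<kappa> * sqrt (S + \<tau>))"
    define D where "D = A + B * (C * ?K)"
    have D: "D < \<infinity>" using AB C by (simp add: D_def ennreal_mult_less_top)
    have fD: "f z \<le> D * ?J z + B * st_conv \<theta> f1 z" if z: "0 < fst z" "fst z \<le> S + \<tau>" for z
    proof -
      have "st_conv \<theta> f0 z \<le> st_conv \<theta> (\<lambda>z. C * ?J z) z"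
        by (rule st_conv_mono) (auto simp: f0_def indicator_def C(2) S_def)
      also have "\<dots> = C * st_conv \<theta> ?J z"
        by (rule st_conv_cmult) simp
      also have "\<dots> \<le> C * (?K * ?J z)"
        using J[OF z] by (rule mult_left_mono) simp
      finally have 0: "st_conv \<theta> f0 z \<le> C * (?K * ?J z)" .
      have "f z \<le> A * ?J z + B * st_conv \<theta> f z" by (rule le[OF z(1)])
      also have "st_conv \<theta> f z = st_conv \<theta> f0 z + st_conv \<theta> f1 z"
        by (subst split) (rule st_conv_add; simp)
      also have "A * ?J z + B * (st_conv \<theta> f0 z + st_conv \<theta> f1 z) \<le> A * ?J z + B * (C * (?K * ?J z) + st_conv \<theta> f1 z)"
        using 0 by (intro add_left_mono mult_left_mono add_right_mono) auto
      also have "\<dots> = D * ?J z + B * st_conv \<theta> f1 z"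
        by (simp add: D_def algebra_simps)
      finally show ?thesis .
    qed
    \<comment> \<open>Convolving the inequality for \<open>f\<close> once more puts
      \<open>st_conv \<theta> f1\<close> on both sides, with a small factor on the right.\<close>
    have h: "st_conv \<theta> f1 z \<le> 2 * (D * (?K * ?J z))" if z: "0 < fst z" "fst z \<le> S + \<tau>" for z
    proof (rule ennreal_absorb_half)
      have "st_conv \<theta> f1 z \<le> st_conv \<theta> (\<lambda>z. D * ?J z + B * st_conv \<theta> f1 z) z"
      proof (rule st_conv_mono)
        fix w :: "real \<times> real" assume "0 < fst w" "fst w < fst z"
        then show "f1 w \<le> D * ?J w + B * st_conv \<theta> f1 w"
          using fD[of w] z by (auto simp: f1_def indicator_def)
      qed
      also have "\<dots> = D * st_conv \<theta> ?J z + B * st_conv \<theta> (st_conv \<theta> f1) z"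
        by (simp add: st_conv_add st_conv_cmult)
      also have "\<dots> \<le> D * (?K * ?J z) + B * (ennreal (\<kappa> * sqrt \<tau>) * st_conv \<theta> f1 z)"
      proof (intro add_mono mult_left_mono J z)
        show "st_conv \<theta> (st_conv \<theta> f1) z \<le> ennreal (\<kappa> * sqrt \<tau>) * st_conv \<theta> f1 z"
          unfolding \<kappa>_def by (rule st_conv_st_conv[OF \<theta>, where T=S]) (use z in \<open>auto simp: f1_def\<close>)
      qed auto
      finally show "st_conv \<theta> f1 z \<le> D * (?K * ?J z) + (B * ennreal (\<kappa> * sqrt \<tau>)) * st_conv \<theta> f1 z"
        by (simp add: mult.assoc)
      \<comment> \<open>Finiteness of the window part is inherited from the full convolution, where
        it is assumed.\<close>
      have "st_conv \<theta> f1 z \<le> st_conv \<theta> f z"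
        by (rule st_conv_mono) (auto simp: f1_def indicator_def)
      then show "st_conv \<theta> f1 z < \<infinity>" using fin[OF z(1)] by simp
      show "B * ennreal (\<kappa> * sqrt \<tau>) \<le> ennreal (1 / 2)" by (rule \<tau>)
    qed
    have "f z \<le> (D + B * (2 * (D * ?K))) * ?J z" if z: "0 < fst z" "fst z \<le> S + \<tau>" for z
    proof -
      have "f z \<le> D * ?J z + B * (2 * (D * (?K * ?J z)))"
        using fD[OF z] mult_left_mono[OF h[OF z], of B] by (meson add_left_mono order_trans zero_le)
      then show ?thesis by (simp add: algebra_simps)
    qed
    moreover have "D + B * (2 * (D * ?K)) < \<infinity>"
      using D AB by (simp add: ennreal_mult_less_top)
    ultimately show ?case unfolding S by blast
  qed
  moreover obtain n where "T \<le> real n * \<tau>"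
    using reals_Archimedean3[OF \<tau>(1)] less_imp_le by blast
  ultimately show ?thesis by (meson order_trans)
qed

section \<open>Moments of the mild solution\<close>

lemma time_slice_measurable:
  assumes "(t::real) > 0"
  shows "(\<lambda>p. ((t, fst p :: real), snd p)) \<in> measurable (borel \<Otimes>\<^sub>M N) (restrict_space borel ({0<..} \<times> UNIV) \<Otimes>\<^sub>M N)"
proof (rule measurable_Pair)
  have "(\<lambda>p. (t, fst p)) \<in> measurable (borel \<Otimes>\<^sub>M N) (borel \<Otimes>\<^sub>M borel)"
    by simp
  then show "(\<lambda>p. (t, fst p :: real)) \<in> measurable (borel \<Otimes>\<^sub>M N) (restrict_space borel ({0<..} \<times> UNIV))"
    using assms unfolding borel_prod by (intro measurable_restrict_space2) simp_all
qed simp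

locale mild = noise +
  fixes \<theta> :: real and \<sigma> :: "real \<Rightarrow> real" and u\<^sub>0 :: "real measure" and u :: "real \<Rightarrow> real \<Rightarrow> 'a \<Rightarrow> real"
  assumes \<theta>: "\<theta> > 0"
    and lip: "\<exists>K. K-lipschitz_on UNIV \<sigma>"
    and \<sigma>0: "\<sigma> 0 = 0"
    and sets_u0: "sets u\<^sub>0 = sets borel"
    and exp_fin: "\<And>c. c > 0 \<Longrightarrow> (\<integral>\<^sup>+x. ennreal (exp (- c * x\<^sup>2)) \<partial>u\<^sub>0) < \<infinity>"
    and sol: "mild_solution M \<xi> \<theta> \<sigma> u\<^sub>0 u"
begin

lemma \<sigma>_measurable [measurable]: "\<sigma> \<in> borel_measurable borel"
proof -
  from lip obtain K where "K-lipschitz_on UNIV \<sigma>" by blast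
  then have "continuous_on UNIV \<sigma>" by (rule lipschitz_on_continuous_on)
  then show ?thesis by (rule borel_measurable_continuous_onI)
qed

lemma \<sigma>_linear_growth: "\<exists>K\<ge>0. \<forall>v. \<bar>\<sigma> v\<bar> \<le> K * \<bar>v\<bar>"
proof -
  from lip obtain K where K: "K-lipschitz_on UNIV \<sigma>" by blast
  have "\<bar>\<sigma> v\<bar> \<le> K * \<bar>v\<bar>" for v
    using lipschitz_onD[OF K, of v 0] by (simp add: \<sigma>0 dist_real_def)
  then show ?thesis using lipschitz_on_nonneg[OF K] by blast
qed

text \<open>On a bounded interval the Gaussian weight is bounded below, so bounded intervals have
  finite mass. Tonelli with respect to \<open>u\<^sub>0\<close> rests on this.\<close>

lemma sigma_finite_u0: "sigma_finite_measure u\<^sub>0"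
proof (rule sigma_finite_measure.intro, intro exI conjI)
  let ?A = "range (\<lambda>n::nat. {- real n .. real n})"
  show "countable ?A" by simp
  show "?A \<subseteq> sets u\<^sub>0" unfolding sets_u0 by (simp add: image_subset_iff)
  show "\<Union>?A = space u\<^sub>0"
  proof -
    have "\<exists>n. - real n \<le> x \<and> x \<le> real n" for x
      using real_arch_simple[of "\<bar>x\<bar>"] by (metis abs_le_iff minus_le_iff)
    then show ?thesis using sets_eq_imp_space_eq[OF sets_u0] by auto
  qed
  show "\<forall>a\<in>?A. emeasure u\<^sub>0 a \<noteq> \<infinity>"
  proof clarify
    fix n :: nat assume inf: "emeasure u\<^sub>0 {- real n .. real n} = \<infinity>"
    have "emeasure u\<^sub>0 {- real n .. real n} = (\<integral>\<^sup>+x. indicator {- real n .. real n} x \<partial>u\<^sub>0)"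
      using sets_u0 by (subst nn_integral_indicator) auto
    also have "\<dots> \<le> (\<integral>\<^sup>+x. ennreal (exp ((real n)\<^sup>2)) * ennreal (exp (- 1 * x\<^sup>2)) \<partial>u\<^sub>0)"
    proof (rule nn_integral_mono)
      fix x
      show "indicator {- real n .. real n} x \<le> ennreal (exp ((real n)\<^sup>2)) * ennreal (exp (- 1 * x\<^sup>2))"
      proof (cases "x \<in> {- real n .. real n}")
        case True
        then have "x\<^sup>2 \<le> (real n)\<^sup>2" by (intro power2_le_iff_abs_le[THEN iffD2]) auto
        then show ?thesis
          using True by (simp add: ennreal_mult'[symmetric] mult_exp_exp flip: ennreal_1)
      qed simp
    qed
    also have "\<dots> = ennreal (exp ((real n)\<^sup>2)) * (\<integral>\<^sup>+x. ennreal (exp (- 1 * x\<^sup>2)) \<partial>u\<^sub>0)"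
      by (rule nn_integral_cmult) (simp add: measurable_cong_sets[OF sets_u0 refl])
    also have "\<dots> < \<infinity>" using exp_fin[of 1] by (simp add: ennreal_mult_less_top)
    finally show False using inf by simp
  qed
qed

lemma integrable_heat_kernel:
  assumes t: "t > 0"
  shows "integrable u\<^sub>0 (\<lambda>y. heat_kernel \<theta> t (x - y))"
proof (rule integrableI_bounded)
  show "(\<lambda>y. heat_kernel \<theta> t (x - y)) \<in> borel_measurable u\<^sub>0"
    unfolding measurable_cong_sets[OF sets_u0 refl] by measurable
  define c where "c = 1 / (4 * \<theta> * t)"
  have c: "c > 0" using \<theta> t by (simp add: c_def)
  define D where "D = (2 * pi * \<theta> * t) powr (-1/2) * exp (x\<^sup>2 / (2 * \<theta> * t))"
  have "(\<integral>\<^sup>+y. ennreal (norm (heat_kernel \<theta> t (x - y))) \<partial>u\<^sub>0) \<le> (\<integral>\<^sup>+y. ennreal D * ennreal (exp (- c * y\<^sup>2)) \<partial>u\<^sub>0)"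
  proof (rule nn_integral_mono)
    fix y
    \<comment> \<open>Equivalent to \<open>(2 * x - y)\<^sup>2 \<ge> 0\<close>. Half of the decay in
      \<open>y\<close> survives, whence \<open>c = 1 / (4 * \<theta> * t)\<close>.\<close>
    have "- (x - y)\<^sup>2 \<le> x\<^sup>2 - y\<^sup>2 / 2"
      using zero_le_power2[of "2 * x - y"] by (simp add: power2_eq_square algebra_simps)
    then have "- (x - y)\<^sup>2 / (2 * \<theta> * t) \<le> (x\<^sup>2 - y\<^sup>2 / 2) / (2 * \<theta> * t)"
      using \<theta> t by (intro divide_right_mono) auto
    also have "\<dots> = x\<^sup>2 / (2 * \<theta> * t) + - c * y\<^sup>2"
      by (simp add: c_def diff_divide_distrib)
    finally have "exp (- (x - y)\<^sup>2 / (2 * \<theta> * t)) \<le> exp (x\<^sup>2 / (2 * \<theta> * t)) * exp (- c * y\<^sup>2)"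
      by (simp add: mult_exp_exp)
    then have "heat_kernel \<theta> t (x - y) \<le> D * exp (- c * y\<^sup>2)"
      unfolding heat_kernel_def D_def mult.assoc by (intro mult_left_mono) auto
    then show "ennreal (norm (heat_kernel \<theta> t (x - y))) \<le> ennreal D * ennreal (exp (- c * y\<^sup>2))"
      by (simp add: ennreal_mult'[symmetric] ennreal_leI D_def)
  qed
  also have "\<dots> = ennreal D * (\<integral>\<^sup>+y. ennreal (exp (- c * y\<^sup>2)) \<partial>u\<^sub>0)"
    by (rule nn_integral_cmult) (simp add: measurable_cong_sets[OF sets_u0 refl])
  also have "\<dots> < \<infinity>" using exp_fin[OF c] by (simp add: ennreal_mult_less_top)
  finally show "(\<integral>\<^sup>+y. ennreal (norm (heat_kernel \<theta> t (x - y))) \<partial>u\<^sub>0) < \<infinity>" .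
qed

abbreviation J :: "real \<Rightarrow> real \<Rightarrow> real" where
  "J t x \<equiv> (LINT y|u\<^sub>0. heat_kernel \<theta> t (x - y))"

lemma J_nonneg: "J t x \<ge> 0"
  by simp

lemma heat_flow_eq: "t > 0 \<Longrightarrow> heat_flow \<theta> u\<^sub>0 (t, x) = ennreal (J t x)"
  unfolding heat_flow_def using integrable_heat_kernel by (simp add: nn_integral_eq_integral)

lemma u_joint: "(\<lambda>((t, x), \<omega>). u t x \<omega>) \<in> borel_measurable (restrict_space borel ({0<..} \<times> UNIV) \<Otimes>\<^sub>M M)"
  using sol unfolding mild_solution_def by blast

lemma u_measurable: "t > 0 \<Longrightarrow> u t x \<in> borel_measurable M"
  by (rule noise_filtration_measurable[of _ t]) (use sol in \<open>simp add: mild_solution_def\<close>)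

lemma u_space_measurable:
  assumes t: "t > 0"
  shows "(\<lambda>(x, \<omega>). u t x \<omega>) \<in> borel_measurable (borel \<Otimes>\<^sub>M M)"
  using measurable_compose[OF time_slice_measurable[OF t] u_joint] by (simp add: case_prod_beta')

text \<open>The function f of the overview, set to 0 at times where \<open>u\<close> carries no
  information, so that it is measurable on the whole plane.\<close>

definition sigma_moment :: "real \<times> real \<Rightarrow> ennreal" where
  "sigma_moment z = (if 0 < fst z then \<integral>\<^sup>+\<omega>. ennreal ((\<sigma> (u (fst z) (snd z) \<omega>))\<^sup>2) \<partial>M else 0)"

lemma sigma_moment_measurable [measurable]: "sigma_moment \<in> borel_measurable borel"
proof -
  have H: "{0<..} \<times> UNIV \<in> sets (borel :: (real \<times> real) measure)"
    unfolding borel_prod[symmetric] by auto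
  note [measurable] = u_joint
  have "(\<lambda>(z, \<omega>). ennreal ((\<sigma> (u (fst z) (snd z) \<omega>))\<^sup>2)) \<in> borel_measurable (restrict_space borel ({0<..} \<times> UNIV) \<Otimes>\<^sub>M M)"
    using measurable_compose[OF u_joint, of "\<lambda>v. ennreal ((\<sigma> v)\<^sup>2)" borel] by (simp add: case_prod_beta')
  then have "(\<lambda>z. \<integral>\<^sup>+\<omega>. ennreal ((\<sigma> (u (fst z) (snd z) \<omega>))\<^sup>2) \<partial>M) \<in> borel_measurable (restrict_space borel ({0<..} \<times> UNIV))"
    by (rule borel_measurable_nn_integral)
  then have "(\<lambda>z. if z \<in> {0<..} \<times> UNIV then \<integral>\<^sup>+\<omega>. ennreal ((\<sigma> (u (fst z) (snd z) \<omega>))\<^sup>2) \<partial>M else 0) \<in> borel_measurable borel"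
    using H by (subst (asm) measurable_restrict_space_iff[where c=0]) auto
  also have "(\<lambda>z. if z \<in> {0<..} \<times> UNIV then \<integral>\<^sup>+\<omega>. ennreal ((\<sigma> (u (fst z) (snd z) \<omega>))\<^sup>2) \<partial>M else 0) = sigma_moment"
    by (auto simp: sigma_moment_def fun_eq_iff)
  finally show ?thesis .
qed

lemma st_conv_sigma_moment_finite:
  assumes t: "t > 0"
  shows "st_conv \<theta> sigma_moment (t, x) < \<infinity>"
proof -
  have "st_conv \<theta> sigma_moment (t, x) = (\<integral>\<^sup>+s\<in>{0<..<t}. (\<integral>\<^sup>+y. ennreal ((heat_kernel \<theta> (t - s) (x - y))\<^sup>2) *
          (\<integral>\<^sup>+\<omega>. ennreal ((\<sigma> (u s y \<omega>))\<^sup>2) \<partial>M) \<partial>lborel) \<partial>lborel)"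
    unfolding st_conv_iterated[OF sigma_moment_measurable] by (intro nn_integral_cong) (auto simp: sigma_moment_def indicator_def)
  then show ?thesis
    using sol t unfolding mild_solution_def by auto
qed

text \<open>Joint measurability is assumed here because \<open>has_walsh_integral\<close> supplies
  it. The cutoff in \<open>mild_integrand\<close> matches the times at which
  \<open>st_kernel\<close> is cut off.\<close>

lemma nn_integral_mild_integrand:
  assumes t: "t > 0"
    and m: "(\<lambda>(z, \<omega>). mild_integrand \<theta> \<sigma> u t x z \<omega>) \<in> borel_measurable (spacetime \<Otimes>\<^sub>M M)"
  shows "(\<integral>\<^sup>+(z, \<omega>). ennreal ((mild_integrand \<theta> \<sigma> u t x z \<omega>)\<^sup>2) \<partial>(spacetime \<Otimes>\<^sub>M M)) = st_conv \<theta> sigma_moment (t, x)"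
proof -
  have "(\<integral>\<^sup>+(z, \<omega>). ennreal ((mild_integrand \<theta> \<sigma> u t x z \<omega>)\<^sup>2) \<partial>(spacetime \<Otimes>\<^sub>M M)) =
     (\<integral>\<^sup>+z. \<integral>\<^sup>+\<omega>. ennreal ((mild_integrand \<theta> \<sigma> u t x z \<omega>)\<^sup>2) \<partial>M \<partial>spacetime)"
    using m by (subst nn_integral_fst[symmetric]) (auto simp: case_prod_beta')
  also have "\<dots> = (\<integral>\<^sup>+z. (\<integral>\<^sup>+\<omega>. ennreal ((mild_integrand \<theta> \<sigma> u t x z \<omega>)\<^sup>2) \<partial>M) * indicator ({0..} \<times> UNIV) z \<partial>lborel)"
    unfolding spacetime_def using halfplane_borel by (subst nn_integral_restrict_space) auto
  also have "\<dots> = st_conv \<theta> sigma_moment (t, x)"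
    unfolding st_conv_def
  proof (rule nn_integral_cong)
    fix z :: "real \<times> real"
    obtain s y where z: "z = (s, y)" by fastforce
    show "(\<integral>\<^sup>+\<omega>. ennreal ((mild_integrand \<theta> \<sigma> u t x z \<omega>)\<^sup>2) \<partial>M) * indicator ({0..} \<times> UNIV) z = st_kernel \<theta> (t, x) z * sigma_moment z"
    proof (cases "0 < s \<and> s < t")
      case True
      note [measurable] = u_measurable[of s y]
      have "(\<integral>\<^sup>+\<omega>. ennreal ((mild_integrand \<theta> \<sigma> u t x z \<omega>)\<^sup>2) \<partial>M) = 
        (\<integral>\<^sup>+\<omega>. ennreal ((heat_kernel \<theta> (t - s) (x - y))\<^sup>2) * ennreal ((\<sigma> (u s y \<omega>))\<^sup>2) \<partial>M)"
        using True by (simp add: mild_integrand_def z power_mult_distrib ennreal_mult)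
      also have "\<dots> = st_kernel \<theta> (t, x) z * sigma_moment z"
        using True by (subst nn_integral_cmult) (auto simp: st_kernel_def sigma_moment_def z)
      finally show ?thesis using True by (simp add: z)
    qed (auto simp: mild_integrand_def z st_kernel_def)
  qed
  finally show ?thesis .
qed

text \<open>The finite convolution demanded of a mild solution is exactly square integrability of
  the integrand, which is what the mean and moment results for Walsh integrals require.\<close>

lemma mild_decomposition:
  assumes t: "t > 0"
  obtains I where "I \<in> borel_measurable M" "AE \<omega> in M. u t x \<omega> = J t x + I \<omega>"
    "(\<integral>\<^sup>+\<omega>. ennreal ((I \<omega>)\<^sup>2) \<partial>M) \<le> 4 * st_conv \<theta> sigma_moment (t, x)"
    "integrable M (\<lambda>\<omega>. (I \<omega>)\<^sup>2)" "integrable M I" "expectation I = 0"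
proof -
  from sol t obtain I where I: "has_walsh_integral M \<xi> (mild_integrand \<theta> \<sigma> u t x) I"
    "AE \<omega> in M. u t x \<omega> = J t x + I \<omega>"
    unfolding mild_solution_def by blast
  then have m: "(\<lambda>(z, \<omega>). mild_integrand \<theta> \<sigma> u t x z \<omega>) \<in> borel_measurable (spacetime \<Otimes>\<^sub>M M)"
    and [measurable]: "I \<in> borel_measurable M"
    unfolding has_walsh_integral_def by auto
  note e = nn_integral_mild_integrand[OF t m]
  have fin: "(\<integral>\<^sup>+(z, \<omega>). ennreal ((mild_integrand \<theta> \<sigma> u t x z \<omega>)\<^sup>2) \<partial>(spacetime \<Otimes>\<^sub>M M)) < \<infinity>"
    unfolding e by (rule st_conv_sigma_moment_finite[OF t])
  show ?thesis
    using that[of I] I(2) walsh_integral_bound[OF I(1), unfolded e] walsh_integral_mean[OF I(1) fin] by simp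
qed

lemma mild_mean:
  assumes t: "t > 0"
  shows "integrable M (u t x)" "integrable M (\<lambda>\<omega>. (u t x \<omega>)\<^sup>2)" "expectation (u t x) = J t x"
proof -
  obtain I where [measurable]: "I \<in> borel_measurable M" and u: "AE \<omega> in M. u t x \<omega> = J t x + I \<omega>"
    and I2: "integrable M (\<lambda>\<omega>. (I \<omega>)\<^sup>2)" and I1: "integrable M I" and I0: "expectation I = 0"
    by (rule mild_decomposition[OF t])
  note [measurable] = u_measurable[OF t]
  have "integrable M (u t x) \<longleftrightarrow> integrable M (\<lambda>\<omega>. J t x + I \<omega>)"
    using u by (intro integrable_cong_AE) auto
  then show "integrable M (u t x)" using I1 by simp
  have "integrable M (\<lambda>\<omega>. (u t x \<omega>)\<^sup>2) \<longleftrightarrow> integrable M (\<lambda>\<omega>. (J t x + I \<omega>)\<^sup>2)"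
    using u by (intro integrable_cong_AE) auto
  then show "integrable M (\<lambda>\<omega>. (u t x \<omega>)\<^sup>2)" using I1 I2 by (simp add: power2_sum)
  have "expectation (u t x) = expectation (\<lambda>\<omega>. J t x + I \<omega>)"
    using u by (intro integral_cong_AE) auto
  then show "expectation (u t x) = J t x" using I1 I0 by (simp add: prob_space)
qed

text \<open>The factor 2 comes from splitting off the deterministic part, and 8 is 2 times the
  factor 4 in the bound for the Walsh integral.\<close>

lemma nn_second_moment:
  assumes t: "t > 0"
  shows "(\<integral>\<^sup>+\<omega>. ennreal ((u t x \<omega>)\<^sup>2) \<partial>M) \<le> 2 * (heat_flow \<theta> u\<^sub>0 (t, x))\<^sup>2 + 8 * st_conv \<theta> sigma_moment (t, x)"
proof -
  obtain I where [measurable]: "I \<in> borel_measurable M" and u: "AE \<omega> in M. u t x \<omega> = J t x + I \<omega>"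
    and I: "(\<integral>\<^sup>+\<omega>. ennreal ((I \<omega>)\<^sup>2) \<partial>M) \<le> 4 * st_conv \<theta> sigma_moment (t, x)"
    by (rule mild_decomposition[OF t])
  note [measurable] = u_measurable[OF t]
  have "(\<integral>\<^sup>+\<omega>. ennreal ((u t x \<omega>)\<^sup>2) \<partial>M) \<le> 2 * (\<integral>\<^sup>+\<omega>. ennreal ((J t x)\<^sup>2) \<partial>M) + 2 * (\<integral>\<^sup>+\<omega>. ennreal ((J t x - u t x \<omega>)\<^sup>2) \<partial>M)"
    by (rule nn_integral_square_triangle) auto
  also have "(\<integral>\<^sup>+\<omega>. ennreal ((J t x)\<^sup>2) \<partial>M) = (heat_flow \<theta> u\<^sub>0 (t, x))\<^sup>2"
    by (simp add: heat_flow_eq[OF t] emeasure_space_1 ennreal_power)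
  also have "(\<integral>\<^sup>+\<omega>. ennreal ((J t x - u t x \<omega>)\<^sup>2) \<partial>M) = (\<integral>\<^sup>+\<omega>. ennreal ((I \<omega>)\<^sup>2) \<partial>M)"
    using u by (intro nn_integral_cong_AE) (auto simp: power2_commute)
  also have "2 * (\<integral>\<^sup>+\<omega>. ennreal ((I \<omega>)\<^sup>2) \<partial>M) \<le> 2 * (4 * st_conv \<theta> sigma_moment (t, x))"
    using I by (rule mult_left_mono) simp
  finally show ?thesis by (simp add: add_left_mono mult.assoc[symmetric])
qed

text \<open>The Volterra bound controls the moment of \<open>\<sigma> (u s y \<omega>)\<close> by
  J^2. Put back into the second moment inequality, where K J^2 is again bounded by J^2, it gives a
  constant uniform in \<open>x\<close>. The lower bound 1 on that constant permits dividing by it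
  later.\<close>

lemma second_moment_bound:
  assumes t: "t > 0"
  shows "\<exists>C\<ge>1. \<forall>x. expectation (\<lambda>\<omega>. (u t x \<omega>)\<^sup>2) \<le> C * (J t x)\<^sup>2"
proof -
  obtain K where K: "K \<ge> 0" "\<And>v. \<bar>\<sigma> v\<bar> \<le> K * \<bar>v\<bar>" using \<sigma>_linear_growth by blast
  have "\<exists>C<\<infinity>. \<forall>z. 0 < fst z \<and> fst z \<le> t \<longrightarrow> sigma_moment z \<le> C * (heat_flow \<theta> u\<^sub>0 z)\<^sup>2"
  proof (rule volterra_heat_bound[OF \<theta> sigma_finite_u0 sets_u0 sigma_moment_measurable])
    show "sigma_moment z = 0" if "fst z \<le> 0" for z using that by (simp add: sigma_moment_def)
    show "st_conv \<theta> sigma_moment z < \<infinity>" if "0 < fst z" for z using st_conv_sigma_moment_finite[OF that, of "snd z"] by simp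
    \<comment> \<open>The constants of the Volterra inequality: linear growth of \<sigma>
      contributes \<open>K\<^sup>2\<close>, the second moment inequality 2 and 8.\<close>
    show "ennreal (K\<^sup>2) * 2 < \<infinity>" "ennreal (K\<^sup>2) * 8 < \<infinity>" by (auto simp: ennreal_mult_less_top)
    fix z :: "real \<times> real" assume z: "0 < fst z"
    obtain s y where sy: "z = (s, y)" by fastforce
    with z have s: "s > 0" by simp
    note [measurable] = u_measurable[OF s]
    have "sigma_moment z \<le> (\<integral>\<^sup>+\<omega>. ennreal (K\<^sup>2) * ennreal ((u s y \<omega>)\<^sup>2) \<partial>M)"
      unfolding sigma_moment_def sy fst_conv snd_conv
    proof (subst if_P[OF s], rule nn_integral_mono)
      fix \<omega>
      have "(\<sigma> (u s y \<omega>))\<^sup>2 \<le> (K * \<bar>u s y \<omega>\<bar>)\<^sup>2"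
        using power_mono[OF K(2)[of "u s y \<omega>"] abs_ge_zero, of 2] by simp
      then have "(\<sigma> (u s y \<omega>))\<^sup>2 \<le> K\<^sup>2 * (u s y \<omega>)\<^sup>2" by (simp add: power_mult_distrib)
      then show "ennreal ((\<sigma> (u s y \<omega>))\<^sup>2) \<le> ennreal (K\<^sup>2) * ennreal ((u s y \<omega>)\<^sup>2)"
        by (simp add: ennreal_mult[symmetric] ennreal_leI)
    qed
    also have "\<dots> = ennreal (K\<^sup>2) * (\<integral>\<^sup>+\<omega>. ennreal ((u s y \<omega>)\<^sup>2) \<partial>M)"
      by (rule nn_integral_cmult) simp
    also have "\<dots> \<le> ennreal (K\<^sup>2) * (2 * (heat_flow \<theta> u\<^sub>0 (s, y))\<^sup>2 + 8 * st_conv \<theta> sigma_moment (s, y))"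
      by (intro mult_left_mono nn_second_moment s) simp
    finally show "sigma_moment z \<le> ennreal (K\<^sup>2) * 2 * (heat_flow \<theta> u\<^sub>0 z)\<^sup>2 + ennreal (K\<^sup>2) * 8 * st_conv \<theta> sigma_moment z"
      by (simp add: sy distrib_left mult.assoc)
  qed
  then obtain C where C: "C < \<infinity>" "\<And>z. 0 < fst z \<Longrightarrow> fst z \<le> t \<Longrightarrow> sigma_moment z \<le> C * (heat_flow \<theta> u\<^sub>0 z)\<^sup>2" by blast
  obtain C' where C': "C = ennreal C'" "C' \<ge> 0" using C(1) by (cases C rule: ennreal_cases) auto
  define \<kappa> where "\<kappa> = 3 / sqrt (pi * \<theta>) * sqrt t"
  have \<kappa>: "\<kappa> \<ge> 0" using \<theta> t by (simp add: \<kappa>_def)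
  note [measurable] = heat_flow_measurable[OF sigma_finite_u0 sets_u0]
  have "expectation (\<lambda>\<omega>. (u t x \<omega>)\<^sup>2) \<le> (2 + 8 * (C' * \<kappa>)) * (J t x)\<^sup>2" for x
  proof -
    have "st_conv \<theta> sigma_moment (t, x) \<le> st_conv \<theta> (\<lambda>z. C * (heat_flow \<theta> u\<^sub>0 z)\<^sup>2) (t, x)"
      by (rule st_conv_mono) (simp add: C)
    also have "\<dots> = C * st_conv \<theta> (\<lambda>z. (heat_flow \<theta> u\<^sub>0 z)\<^sup>2) (t, x)"
      by (rule st_conv_cmult) simp
    also have "\<dots> \<le> C * (ennreal \<kappa> * (heat_flow \<theta> u\<^sub>0 (t, x))\<^sup>2)"
      unfolding \<kappa>_def by (intro mult_left_mono st_conv_heat_flow_square \<theta> t sigma_finite_u0 sets_u0) simp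
    also have "\<dots> = ennreal (C' * \<kappa> * (J t x)\<^sup>2)"
      using C' \<kappa> by (simp add: heat_flow_eq[OF t] ennreal_power ennreal_mult mult.assoc)
    finally have 1: "st_conv \<theta> sigma_moment (t, x) \<le> ennreal (C' * \<kappa> * (J t x)\<^sup>2)" .
    have "ennreal (expectation (\<lambda>\<omega>. (u t x \<omega>)\<^sup>2)) = (\<integral>\<^sup>+\<omega>. ennreal ((u t x \<omega>)\<^sup>2) \<partial>M)"
      by (rule nn_integral_eq_integral[symmetric]) (use mild_mean[OF t] in auto)
    also have "\<dots> \<le> 2 * (heat_flow \<theta> u\<^sub>0 (t, x))\<^sup>2 + 8 * ennreal (C' * \<kappa> * (J t x)\<^sup>2)"
      using nn_second_moment[OF t] mult_left_mono[OF 1, of 8] by (meson add_left_mono order_trans zero_le)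
    also have "\<dots> = ennreal 2 * ennreal ((J t x)\<^sup>2) + ennreal 8 * ennreal (C' * \<kappa> * (J t x)\<^sup>2)"
      by (simp add: heat_flow_eq[OF t] ennreal_power)
    also have "\<dots> = ennreal (2 * (J t x)\<^sup>2 + 8 * (C' * \<kappa> * (J t x)\<^sup>2))"
      using C' \<kappa> by (subst ennreal_plus) (auto simp only: ennreal_mult' intro!: mult_nonneg_nonneg zero_le_power2)
    finally have "expectation (\<lambda>\<omega>. (u t x \<omega>)\<^sup>2) \<le> 2 * (J t x)\<^sup>2 + 8 * (C' * \<kappa> * (J t x)\<^sup>2)"
      using C' \<kappa> by (subst (asm) ennreal_le_iff) auto
    then show ?thesis by (simp add: algebra_simps)
  qed
  then show ?thesis
    using C' \<kappa> by (intro exI[of _ "2 + 8 * (C' * \<kappa>)"]) auto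
qed

text \<open>The mean gives the lower bound; the second moment and the Cauchy-Schwarz inequality give
  the upper one.\<close>

lemma expectation_abs_bounds:
  assumes t: "t > 0" and C: "C \<ge> 0" "\<And>x. expectation (\<lambda>\<omega>. (u t x \<omega>)\<^sup>2) \<le> C * (J t x)\<^sup>2"
  shows "J t x \<le> expectation (\<lambda>\<omega>. \<bar>u t x \<omega>\<bar>)" "expectation (\<lambda>\<omega>. \<bar>u t x \<omega>\<bar>) \<le> sqrt C * J t x"
proof -
  note [measurable] = u_measurable[OF t]
  have "\<bar>expectation (u t x)\<bar> \<le> expectation (\<lambda>\<omega>. \<bar>u t x \<omega>\<bar>)"
    by (rule integral_abs_bound)
  then show "J t x \<le> expectation (\<lambda>\<omega>. \<bar>u t x \<omega>\<bar>)"
    unfolding mild_mean(3)[OF t] by linarith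
  have "(expectation (\<lambda>\<omega>. \<bar>u t x \<omega>\<bar>))\<^sup>2 \<le> expectation (\<lambda>\<omega>. (u t x \<omega>)\<^sup>2)"
    using expectation_square_le[of "\<lambda>\<omega>. \<bar>u t x \<omega>\<bar>"] mild_mean(2)[OF t] by simp
  also have "\<dots> \<le> (sqrt C * J t x)\<^sup>2"
    using C by (simp add: power_mult_distrib)
  finally show "expectation (\<lambda>\<omega>. \<bar>u t x \<omega>\<bar>) \<le> sqrt C * J t x"
    by (rule power2_le_imp_le) (use C in simp)
qed

section \<open>The spatial L1 norm and the total mass of the initial measure\<close>

lemma abs_space_measurable:
  "t > 0 \<Longrightarrow> (\<lambda>(x, \<omega>). ennreal \<bar>u t x \<omega>\<bar>) \<in> borel_measurable (borel \<Otimes>\<^sub>M M)"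
  using measurable_compose[OF u_space_measurable, of t "\<lambda>v. ennreal \<bar>v\<bar>" borel] by (simp add: case_prod_beta')

lemma L1_norm_measurable: "t > 0 \<Longrightarrow> (\<lambda>\<omega>. \<integral>\<^sup>+x. ennreal \<bar>u t x \<omega>\<bar> \<partial>lborel) \<in> borel_measurable M"
proof -
  assume t: "t > 0"
  have "(\<lambda>(\<omega>, x). ennreal \<bar>u t x \<omega>\<bar>) \<in> borel_measurable (M \<Otimes>\<^sub>M lborel)"
    using measurable_pair_swap[OF abs_space_measurable[OF t]] by (simp add: case_prod_beta' cong: measurable_cong_sets)
  then show ?thesis by (rule lborel.borel_measurable_nn_integral)
qed

text \<open>The event \<open>A\<close> lets one identity serve both directions, with
  \<open>space M\<close> in one and the complement of a tail event in the other.\<close>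

lemma L1_norm_Fubini:
  assumes t: "t > 0" and [measurable]: "A \<in> sets M"
  shows "(\<integral>\<^sup>+\<omega>. (\<integral>\<^sup>+x. ennreal \<bar>u t x \<omega>\<bar> \<partial>lborel) * indicator A \<omega> \<partial>M) =
    (\<integral>\<^sup>+x. (\<integral>\<^sup>+\<omega>. ennreal \<bar>u t x \<omega>\<bar> * indicator A \<omega> \<partial>M) \<partial>lborel)"
proof -
  interpret P: pair_sigma_finite "lborel :: real measure" M ..
  have [measurable]: "(\<lambda>(x, \<omega>). ennreal \<bar>u t x \<omega>\<bar>) \<in> borel_measurable (lborel \<Otimes>\<^sub>M M)"
    using abs_space_measurable[OF t] by (simp cong: measurable_cong_sets)
  have mx: "(\<lambda>x. ennreal \<bar>u t x \<omega>\<bar>) \<in> borel_measurable borel" if "\<omega> \<in> space M" for \<omega>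
    using measurable_compose[OF measurable_Pair2'[OF that, of borel] abs_space_measurable[OF t]] by simp
  have "(\<integral>\<^sup>+\<omega>. (\<integral>\<^sup>+x. ennreal \<bar>u t x \<omega>\<bar> \<partial>lborel) * indicator A \<omega> \<partial>M) =
     (\<integral>\<^sup>+\<omega>. (\<integral>\<^sup>+x. ennreal \<bar>u t x \<omega>\<bar> * indicator A \<omega> \<partial>lborel) \<partial>M)"
    using mx by (intro nn_integral_cong nn_integral_multc[symmetric]) simp
  also have "\<dots> = (\<integral>\<^sup>+x. (\<integral>\<^sup>+\<omega>. ennreal \<bar>u t x \<omega>\<bar> * indicator A \<omega> \<partial>M) \<partial>lborel)"
    by (rule P.Fubini') simp
  finally show ?thesis .
qed

lemma finite_imp_L1:
  assumes u0: "finite_measure u\<^sub>0" and t: "t > 0"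
  shows "AE \<omega> in M. (\<integral>\<^sup>+x. ennreal \<bar>u t x \<omega>\<bar> \<partial>lborel) < \<infinity>"
proof -
  obtain C where C: "C \<ge> 1" "\<And>x. expectation (\<lambda>\<omega>. (u t x \<omega>)\<^sup>2) \<le> C * (J t x)\<^sup>2"
    using second_moment_bound[OF t] by blast
  note [measurable] = L1_norm_measurable[OF t] u_measurable[OF t] heat_flow_measurable[OF sigma_finite_u0 sets_u0]
  have "(\<integral>\<^sup>+\<omega>. (\<integral>\<^sup>+x. ennreal \<bar>u t x \<omega>\<bar> \<partial>lborel) * indicator (space M) \<omega> \<partial>M) = 
      (\<integral>\<^sup>+x. (\<integral>\<^sup>+\<omega>. ennreal \<bar>u t x \<omega>\<bar> * indicator (space M) \<omega> \<partial>M) \<partial>lborel)"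
    by (rule L1_norm_Fubini[OF t]) simp
  also have "\<dots> \<le> (\<integral>\<^sup>+x. ennreal (sqrt C) * heat_flow \<theta> u\<^sub>0 (t, x) \<partial>lborel)"
  proof (rule nn_integral_mono)
    fix x
    have "(\<integral>\<^sup>+\<omega>. ennreal \<bar>u t x \<omega>\<bar> * indicator (space M) \<omega> \<partial>M) = (\<integral>\<^sup>+\<omega>. ennreal \<bar>u t x \<omega>\<bar> \<partial>M)"
      by (intro nn_integral_cong) simp
    also have "\<dots> = ennreal (expectation (\<lambda>\<omega>. \<bar>u t x \<omega>\<bar>))"
      using mild_mean(1)[OF t] by (intro nn_integral_eq_integral) auto
    also have "\<dots> \<le> ennreal (sqrt C * J t x)"
      using C by (intro ennreal_leI expectation_abs_bounds(2)[OF t]) auto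
    also have "\<dots> = ennreal (sqrt C) * heat_flow \<theta> u\<^sub>0 (t, x)"
      using C by (simp add: heat_flow_eq[OF t] ennreal_mult')
    finally show "(\<integral>\<^sup>+\<omega>. ennreal \<bar>u t x \<omega>\<bar> * indicator (space M) \<omega> \<partial>M) \<le> ennreal (sqrt C) * heat_flow \<theta> u\<^sub>0 (t, x)" .
  qed
  also have "\<dots> = ennreal (sqrt C) * emeasure u\<^sub>0 (space u\<^sub>0)"
  proof -
    have "(\<lambda>x. heat_flow \<theta> u\<^sub>0 (t, x)) \<in> borel_measurable borel"
      by (rule measurable_compose[OF measurable_Pair1'[of t borel borel], unfolded borel_prod]) (simp_all add: borel_prod)
    then show ?thesis
      by (simp add: nn_integral_cmult nn_integral_heat_flow[OF \<theta> t sigma_finite_u0 sets_u0])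
  qed
  also have "\<dots> < \<infinity>"
    using finite_measure.emeasure_finite[OF u0, of "space u\<^sub>0"] by (simp add: ennreal_mult_less_top less_top)
  finally have "(\<integral>\<^sup>+\<omega>. (\<integral>\<^sup>+x. ennreal \<bar>u t x \<omega>\<bar> \<partial>lborel) \<partial>M) < \<infinity>"
    by (simp cong: nn_integral_cong)
  then have "AE \<omega> in M. (\<integral>\<^sup>+x. ennreal \<bar>u t x \<omega>\<bar> \<partial>lborel) \<noteq> \<infinity>"
    by (intro nn_integral_PInf_AE) auto
  then show ?thesis by (simp add: less_top)
qed

lemma L1_imp_finite:
  assumes t: "t > 0" and L1: "AE \<omega> in M. (\<integral>\<^sup>+x. ennreal \<bar>u t x \<omega>\<bar> \<partial>lborel) < \<infinity>"
  shows "finite_measure u\<^sub>0"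
proof -
  define X where "X \<omega> = (\<integral>\<^sup>+x. ennreal \<bar>u t x \<omega>\<bar> \<partial>lborel)" for \<omega>
  obtain C where C: "C \<ge> 1" "\<And>x. expectation (\<lambda>\<omega>. (u t x \<omega>)\<^sup>2) \<le> C * (J t x)\<^sup>2"
    using second_moment_bound[OF t] by blast
  have X[measurable]: "X \<in> borel_measurable M"
    unfolding X_def using L1_norm_measurable[OF t] .
  note [measurable] = u_measurable[OF t] heat_flow_measurable[OF sigma_finite_u0 sets_u0]
  \<comment> \<open>The threshold makes the probability of the tail event, weighted by
    \<open>C * J t x\<close>, at most \<open>J t x / 4\<close>.\<close>
  have "\<exists>n::nat. prob {\<omega> \<in> space M. X \<omega> > of_nat n} < 1 / (4 * C)"
    using L1 C(1) by (intro small_probability_tail X) (simp_all add: X_def)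
  then obtain n :: nat where n: "prob {\<omega> \<in> space M. X \<omega> > of_nat n} < 1 / (4 * C)" by blast
  define A where "A = {\<omega> \<in> space M. X \<omega> > of_nat n}"
  define B where "B = space M - A"
  have [measurable]: "A \<in> sets M" "B \<in> sets M" unfolding A_def B_def by measurable
  have PA: "prob A * C \<le> 1 / 4"
    using n C(1) unfolding A_def[symmetric] by (simp add: field_simps)
  have main: "J t x \<le> 2 * expectation (\<lambda>\<omega>. \<bar>u t x \<omega>\<bar> * indicator B \<omega>)" for x
  proof (cases "J t x = 0")
    case False
    then have J: "J t x > 0" by (rule le_neq_trans[OF J_nonneg not_sym])
    note i = mild_mean[OF t, of x]
    have iA: "integrable M (\<lambda>\<omega>. indicator A \<omega> :: real)" 
      by (rule integrable_real_indicator) (auto simp: less_top[symmetric])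
    have ia: "integrable M (\<lambda>\<omega>. \<bar>u t x \<omega>\<bar> * indicator D \<omega>)" if "D \<in> sets M" for D
      using integrable_mult_indicator[OF that integrable_abs[OF i(1)]] by (simp add: mult.commute)
    have "expectation (\<lambda>\<omega>. \<bar>u t x \<omega>\<bar>) = expectation (\<lambda>\<omega>. \<bar>u t x \<omega>\<bar> * indicator A \<omega> + \<bar>u t x \<omega>\<bar> * indicator B \<omega>)"
      by (intro Bochner_Integration.integral_cong) (auto simp: B_def indicator_def)
    also have "\<dots> = expectation (\<lambda>\<omega>. \<bar>u t x \<omega>\<bar> * indicator A \<omega>) + expectation (\<lambda>\<omega>. \<bar>u t x \<omega>\<bar> * indicator B \<omega>)"
      by (intro Bochner_Integration.integral_add ia) auto
    also have "expectation (\<lambda>\<omega>. \<bar>u t x \<omega>\<bar> * indicator A \<omega>) \<le> expectation (\<lambda>\<omega>. (u t x \<omega>)\<^sup>2 / (4 * C * J t x) + C * J t x * indicator A \<omega>)"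
    proof (rule integral_mono[OF ia])
      show "integrable M (\<lambda>\<omega>. (u t x \<omega>)\<^sup>2 / (4 * C * J t x) + C * J t x * indicator A \<omega>)"
        using i iA by simp
      fix \<omega>
      have c: "C * J t x > 0" using C(1) J by simp
      \<comment> \<open>Young's inequality, from the square of \<open>\<bar>v\<bar> - 2 * d\<close>.
        With \<open>d = C * J t x\<close> the quadratic term has mean at most
        \<open>J t x / 4\<close>, so both terms together take at most half of the lower bound
        \<open>J t x\<close> for the absolute mean.\<close>
      have "\<bar>v\<bar> \<le> v\<^sup>2 / (4 * d) + d" if "d > 0" for v d :: real
        using that zero_le_power2[of "\<bar>v\<bar> - 2 * d"] by (simp add: power2_diff divide_simps) (simp add: power2_eq_square algebra_simps)
      from this[OF c] c show "\<bar>u t x \<omega>\<bar> * indicator A \<omega> \<le> (u t x \<omega>)\<^sup>2 / (4 * C * J t x) + C * J t x * indicator A \<omega>"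
        by (auto simp: indicator_def mult.assoc)
    qed simp
    also have "\<dots> = expectation (\<lambda>\<omega>. (u t x \<omega>)\<^sup>2) / (4 * C * J t x) + C * J t x * prob A"
      using i iA by simp
    also have "\<dots> \<le> J t x / 4 + J t x / 4"
    proof (rule add_mono)
      have "expectation (\<lambda>\<omega>. (u t x \<omega>)\<^sup>2) / (4 * C * J t x) \<le> C * (J t x)\<^sup>2 / (4 * C * J t x)"
        using C J by (intro divide_right_mono) auto
      also have "\<dots> = J t x / 4" using C(1) J by (simp add: power2_eq_square)
      finally show "expectation (\<lambda>\<omega>. (u t x \<omega>)\<^sup>2) / (4 * C * J t x) \<le> J t x / 4" .
      show "C * J t x * prob A \<le> J t x / 4"
        using mult_left_mono[OF PA J_nonneg[of t x]] by (simp add: ac_simps)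
    qed
    finally show ?thesis
      using expectation_abs_bounds(1)[OF t _ C(2), of x] C(1) by simp
  qed simp
  have "emeasure u\<^sub>0 (space u\<^sub>0) = (\<integral>\<^sup>+x. heat_flow \<theta> u\<^sub>0 (t, x) \<partial>lborel)"
    using nn_integral_heat_flow[OF \<theta> t sigma_finite_u0 sets_u0] by simp
  also have "\<dots> \<le> (\<integral>\<^sup>+x. 2 * (\<integral>\<^sup>+\<omega>. ennreal \<bar>u t x \<omega>\<bar> * indicator B \<omega> \<partial>M) \<partial>lborel)"
  proof (rule nn_integral_mono)
    fix x
    have "heat_flow \<theta> u\<^sub>0 (t, x) \<le> ennreal (2 * expectation (\<lambda>\<omega>. \<bar>u t x \<omega>\<bar> * indicator B \<omega>))"
      unfolding heat_flow_eq[OF t] by (rule ennreal_leI[OF main])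
    also have "\<dots> = 2 * ennreal (expectation (\<lambda>\<omega>. \<bar>u t x \<omega>\<bar> * indicator B \<omega>))"
      by (simp add: ennreal_mult')
    also have "ennreal (expectation (\<lambda>\<omega>. \<bar>u t x \<omega>\<bar> * indicator B \<omega>)) = (\<integral>\<^sup>+\<omega>. ennreal (\<bar>u t x \<omega>\<bar> * indicator B \<omega>) \<partial>M)"
      using integrable_mult_indicator[OF \<open>B \<in> sets M\<close> integrable_abs[OF mild_mean(1)[OF t]]]
      by (intro nn_integral_eq_integral[symmetric]) (auto simp: mult.commute)
    also have "\<dots> = (\<integral>\<^sup>+\<omega>. ennreal \<bar>u t x \<omega>\<bar> * indicator B \<omega> \<partial>M)"
      by (intro nn_integral_cong) (auto simp: indicator_def)
    finally show "heat_flow \<theta> u\<^sub>0 (t, x) \<le> 2 * (\<integral>\<^sup>+\<omega>. ennreal \<bar>u t x \<omega>\<bar> * indicator B \<omega> \<partial>M)" .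
  qed
  also have "\<dots> = 2 * (\<integral>\<^sup>+x. (\<integral>\<^sup>+\<omega>. ennreal \<bar>u t x \<omega>\<bar> * indicator B \<omega> \<partial>M) \<partial>lborel)"
  proof (rule nn_integral_cmult)
    have "(\<lambda>(x, \<omega>). ennreal \<bar>u t x \<omega>\<bar> * indicator B \<omega>) \<in> borel_measurable (lborel \<Otimes>\<^sub>M M)"
      using abs_space_measurable[OF t] by (simp add: case_prod_beta' cong: measurable_cong_sets)
    then show "(\<lambda>x. \<integral>\<^sup>+\<omega>. ennreal \<bar>u t x \<omega>\<bar> * indicator B \<omega> \<partial>M) \<in> borel_measurable lborel"
      by (rule borel_measurable_nn_integral)
  qed
  also have "\<dots> = 2 * (\<integral>\<^sup>+\<omega>. X \<omega> * indicator B \<omega> \<partial>M)"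
    unfolding X_def using L1_norm_Fubini[OF t \<open>B \<in> sets M\<close>] by simp
  also have "\<dots> \<le> 2 * (\<integral>\<^sup>+\<omega>. of_nat n \<partial>M)"
    by (intro mult_left_mono nn_integral_mono) (auto simp: B_def A_def indicator_def not_less)
  also have "\<dots> < \<infinity>"
    by (simp add: emeasure_space_1 ennreal_mult_less_top of_nat_less_top)
  finally show ?thesis
    by (intro finite_measureI) auto
qed

end

theorem corollary3p1:
  fixes M :: "'a measure"
    and \<xi> :: "(real \<times> real \<Rightarrow> real) \<Rightarrow> 'a \<Rightarrow> real"
    and \<theta> :: real
    and \<sigma> :: "real \<Rightarrow> real"
    and u\<^sub>0 :: "real measure"
    and u :: "real \<Rightarrow> real \<Rightarrow> 'a \<Rightarrow> real"
  assumes "prob_space M"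
    and "\<theta> > 0"
    and "\<exists>K. K-lipschitz_on UNIV \<sigma>"
    and "\<And>v. \<sigma> v \<ge> 0"
    and "\<sigma> 0 = 0"
    and "white_noise M \<xi>"
    and "sets u\<^sub>0 = sets borel"
    and "\<And>c. c > 0 \<Longrightarrow> (\<integral>\<^sup>+x. ennreal (exp (- c * x\<^sup>2)) \<partial>u\<^sub>0) < \<infinity>"
    and "mild_solution M \<xi> \<theta> \<sigma> u\<^sub>0 u"
  shows "finite_measure u\<^sub>0 \<longleftrightarrow>
    (\<forall>t>0. AE \<omega> in M. (\<integral>\<^sup>+x. ennreal \<bar>u t x \<omega>\<bar> \<partial>lborel) < \<infinity>)"
proof -
  interpret prob_space M by fact
  interpret mild M \<xi> \<theta> \<sigma> u\<^sub>0 u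
    by unfold_locales (use assms in auto)
  show ?thesis
    \<comment> \<open>Almost sure finiteness at the single time 1 already forces a finite initial
      mass.\<close>
    using finite_imp_L1 L1_imp_finite[of 1] by auto
qed

end
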